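(* Let $\mathscr{A}$ be an abelian category with enough projective objects. Then there are maps \[\Phi:\{\text{support }\tau\text{-tilting subcategories of }\mathscr{A}\}\longrightarrow\{\tau\text{-cotorsion torsion triples in }\mathscr{A}\},\qquad \mathscr{T}\longmapsto\bigl({}^{\perp_1}(\mathrm{Fac}(\mathscr{T})),\ \mathrm{Fac}(\mathscr{T}),\ \mathscr{T}^{\perp_0}\bigr),\] \[\Psi:\{\tau\text{-cotorsion torsion triples in }\mathscr{A}\}\longrightarrow\{\text{support }\tau\text{-tilting subcategories of }\mathscr{A}\},\qquad (\mathscr{C},\mathscr{D},\mathscr{F})\longmapsto\mathscr{C}\cap\mathscr{D},\] which are well-defined, bijective and mutually inverse. Moreover, these bijections restrict to bijections between the collection of tilting subcategories of $\mathscr{A}$ and the collection of cotorsion torsion triples in $\mathscr{A}$.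
   Context: Subcategories are full and closed under isomorphisms. For a subcategory $\mathscr{X}$ of $\mathscr{A}$ put $\mathscr{X}^{\perp_n}=\{A\mid \mathrm{Ext}^n_{\mathscr{A}}(\mathscr{X},A)=0\}$ and ${}^{\perp_n}\mathscr{X}=\{A\mid \mathrm{Ext}^n_{\mathscr{A}}(A,\mathscr{X})=0\}$, where $\mathrm{Ext}^0=\mathrm{Hom}$. $\mathrm{Fac}(\mathscr{X})$ is the full subcategory of all quotients (factor objects) of objects of $\mathscr{X}$ (for a single object $T$, $\mathrm{Fac}(T)$ consists of quotients of finite direct sums of copies of $T$). A left $\mathscr{X}$-approximation of $A$ is a morphism $f:A\to X$ with $X\in\mathscr{X}$ such that every morphism $A\to X'$ with $X'\in\mathscr{X}$ factors through $f$; right approximations are defined dually. $\mathscr{X}$ is contravariantly finite if every object of $\mathscr{A}$ has a right $\mathscr{X}$-approximation. Support $\tau$-tilting subcategory: an additive full subcategory $\mathscr{T}$ (closed under finite direct sums and direct summands), contravariantly finite in $\mathscr{A}$, such that (i) $\mathrm{Ext}^1_{\mathscr{A}}(T_1,\mathrm{Fac}(T_2))=0$ for all $T_1,T_2\in\mathscr{T}$; (ii) for every projective $P$ in $\mathscr{A}$ there is an exact sequence $P\xrightarrow{f}T^0\to T^1\to0$ with $T^0,T^1\in\mathscr{T}$ and $f$ a left $\mathscr{T}$-approximation of $P$. Torsion pair $(\mathscr{D},\mathscr{F})$: $\mathrm{Hom}_{\mathscr{A}}(\mathscr{D},\mathscr{F})=0$ and every $A\in\mathscr{A}$ has a short exact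 sequence $0\to tA\to A\to fA\to0$ with $tA\in\mathscr{D}$, $fA\in\mathscr{F}$. $\tau$-cotorsion torsion triple: a triple $(\mathscr{C},\mathscr{D},\mathscr{F})$ of full subcategories such that (1) $\mathscr{C}={}^{\perp_1}\mathscr{D}$; (2) for every projective $P$ there is an exact sequence $P\xrightarrow{f}D\to C\to0$ with $D\in\mathscr{C}\cap\mathscr{D}$, $C\in\mathscr{C}$ and $f$ a left $\mathscr{D}$-approximation; (3) $\mathscr{C}\cap\mathscr{D}$ is contravariantly finite in $\mathscr{A}$; (4) $(\mathscr{D},\mathscr{F})$ is a torsion pair. Tilting subcategory: a contravariantly finite subcategory $\mathscr{T}$ closed under finite direct sums and direct summands such that $\mathrm{Ext}^i_{\mathscr{A}}(T_1,T_2)=0$ for all $T_1,T_2\in\mathscr{T}$, $i\ge1$; every $T\in\mathscr{T}$ has projective dimension at most $1$; and for every projective $P$ there is a short exact sequence $0\to P\to T^0\to T^1\to0$ with $T^0,T^1\in\mathscr{T}$. Cotorsion pair $(\mathscr{C},\mathscr{D})$: $\mathscr{C}={}^{\perp_1}\mathscr{D}$, $\mathscr{D}=\mathscr{C}^{\perp_1}$, and for every $A\in\mathscr{A}$ there are short exact sequences $0\to D\to C\to A\to0$ and $0\to A\to D'\to C'\to0$ with $C,C'\in\mathscr{C}$, $D,D'\in\mathscr{D}$. Cotorsion torsion triple: $(\mathscr{C},\mathscr{D},\mathscr{F})$ with $(\mathscr{C},\mathscr{D})$ a cotorsion pair and $(\mathscr{D},\mathscr{F})$ a torsion pair. *)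

theory Defs
  imports "HOL-Algebra.FiniteProduct" "HOL-Algebra.Coset" "HOL-Algebra.Elementary_Groups"
begin

section \<open>Abelian categories\<close>

text \<open>
  A category is given by its sets of objects and arrows; \<open>g \<cdot> f\<close> is the composite
  "first \<open>f\<close>, then \<open>g\<close>" and is only meaningful for composable arrows. \<open>Plus\<close> adds
  parallel arrows and \<open>Zero A B\<close> is the zero arrow from \<open>A\<close> to \<open>B\<close>.
\<close>

record ('o, 'm) cat =
  Ob :: "'o set"
  Arr :: "'m set"
  Dom :: "'m \<Rightarrow> 'o"
  Cod :: "'m \<Rightarrow> 'o"
  Id :: "'o \<Rightarrow> 'm"
  Comp :: "'m \<Rightarrow> 'm \<Rightarrow> 'm" (infixl "\<cdot>\<index>" 70)
  Plus :: "'m \<Rightarrow> 'm \<Rightarrow> 'm"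
  Zero :: "'o \<Rightarrow> 'o \<Rightarrow> 'm"

definition Hom :: "('o, 'm) cat \<Rightarrow> 'o \<Rightarrow> 'o \<Rightarrow> 'm set" where
  "Hom \<A> A B = {f \<in> Arr \<A>. Dom \<A> f = A \<and> Cod \<A> f = B}"

text \<open>The group operation on \<open>Hom A B\<close> is written multiplicatively, as in the library.\<close>

definition Hom_group :: "('o, 'm) cat \<Rightarrow> 'o \<Rightarrow> 'o \<Rightarrow> 'm monoid" where
  "Hom_group \<A> A B = \<lparr>carrier = Hom \<A> A B, monoid.mult = Plus \<A>, one = Zero \<A> A B\<rparr>"

locale category =
  fixes \<A> :: "('o, 'm) cat" (structure)
  assumes Dom_closed: "f \<in> Arr \<A> \<Longrightarrow> Dom \<A> f \<in> Ob \<A>"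
    and Cod_closed: "f \<in> Arr \<A> \<Longrightarrow> Cod \<A> f \<in> Ob \<A>"
    and Id_closed: "A \<in> Ob \<A> \<Longrightarrow> Id \<A> A \<in> Hom \<A> A A"
    and Comp_closed: "\<lbrakk>f \<in> Hom \<A> A B; g \<in> Hom \<A> B C\<rbrakk> \<Longrightarrow> g \<cdot> f \<in> Hom \<A> A C"
    and Comp_assoc: "\<lbrakk>f \<in> Hom \<A> A B; g \<in> Hom \<A> B C; h \<in> Hom \<A> C D\<rbrakk>
      \<Longrightarrow> (h \<cdot> g) \<cdot> f = h \<cdot> (g \<cdot> f)"
    and Id_right: "f \<in> Hom \<A> A B \<Longrightarrow> f \<cdot> Id \<A> A = f"
    and Id_left: "f \<in> Hom \<A> A B \<Longrightarrow> Id \<A> B \<cdot> f = f"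

locale preadditive_category = category +
  assumes Hom_comm_group: "\<lbrakk>A \<in> Ob \<A>; B \<in> Ob \<A>\<rbrakk> \<Longrightarrow> comm_group (Hom_group \<A> A B)"
    and Comp_Plus_right: "\<lbrakk>f \<in> Hom \<A> A B; f' \<in> Hom \<A> A B; g \<in> Hom \<A> B C\<rbrakk>
      \<Longrightarrow> g \<cdot> Plus \<A> f f' = Plus \<A> (g \<cdot> f) (g \<cdot> f')"
    and Comp_Plus_left: "\<lbrakk>f \<in> Hom \<A> A B; g \<in> Hom \<A> B C; g' \<in> Hom \<A> B C\<rbrakk>
      \<Longrightarrow> Plus \<A> g g' \<cdot> f = Plus \<A> (g \<cdot> f) (g' \<cdot> f)"

text \<open>
  \<open>S\<close> is a biproduct of the family \<open>X\<close> over the finite index set \<open>I\<close>; the last clause says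
  \<open>\<Sum>k\<in>I. \<iota> k \<cdot> \<pi> k = Id S\<close>. For \<open>I = {}\<close> this says that \<open>S\<close> is a zero object.
\<close>

definition is_direct_sum ::
    "('o, 'm) cat \<Rightarrow> nat set \<Rightarrow> (nat \<Rightarrow> 'o) \<Rightarrow> 'o \<Rightarrow> (nat \<Rightarrow> 'm) \<Rightarrow> (nat \<Rightarrow> 'm) \<Rightarrow> bool" where
  "is_direct_sum \<A> I X S \<iota> \<pi> \<longleftrightarrow>
     finite I \<and> S \<in> Ob \<A> \<and>
     (\<forall>k\<in>I. X k \<in> Ob \<A> \<and> \<iota> k \<in> Hom \<A> (X k) S \<and> \<pi> k \<in> Hom \<A> S (X k)) \<and>
     (\<forall>k\<in>I. \<forall>l\<in>I. \<pi> k \<cdot>\<^bsub>\<A>\<^esub> \<iota> l = (if k = l then Id \<A> (X k) else Zero \<A> (X l) (X k))) \<and>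
     finprod (Hom_group \<A> S S) (\<lambda>k. \<iota> k \<cdot>\<^bsub>\<A>\<^esub> \<pi> k) I = Id \<A> S"

definition is_zero_object :: "('o, 'm) cat \<Rightarrow> 'o \<Rightarrow> bool" where
  "is_zero_object \<A> Z \<longleftrightarrow>
     Z \<in> Ob \<A> \<and> (\<forall>A\<in>Ob \<A>. (\<exists>!f. f \<in> Hom \<A> A Z) \<and> (\<exists>!f. f \<in> Hom \<A> Z A))"

definition is_iso :: "('o, 'm) cat \<Rightarrow> 'm \<Rightarrow> bool" where
  "is_iso \<A> f \<longleftrightarrow> f \<in> Arr \<A> \<and>
     (\<exists>g\<in>Hom \<A> (Cod \<A> f) (Dom \<A> f).
        g \<cdot>\<^bsub>\<A>\<^esub> f = Id \<A> (Dom \<A> f) \<and> f \<cdot>\<^bsub>\<A>\<^esub> g = Id \<A> (Cod \<A> f))"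

definition isomorphic :: "('o, 'm) cat \<Rightarrow> 'o \<Rightarrow> 'o \<Rightarrow> bool" where
  "isomorphic \<A> A B \<longleftrightarrow> (\<exists>f\<in>Hom \<A> A B. is_iso \<A> f)"

definition is_mono :: "('o, 'm) cat \<Rightarrow> 'm \<Rightarrow> bool" where
  "is_mono \<A> f \<longleftrightarrow> f \<in> Arr \<A> \<and>
     (\<forall>X\<in>Ob \<A>. \<forall>u\<in>Hom \<A> X (Dom \<A> f). \<forall>v\<in>Hom \<A> X (Dom \<A> f).
        f \<cdot>\<^bsub>\<A>\<^esub> u = f \<cdot>\<^bsub>\<A>\<^esub> v \<longrightarrow> u = v)"

definition is_epi :: "('o, 'm) cat \<Rightarrow> 'm \<Rightarrow> bool" where
  "is_epi \<A> f \<longleftrightarrow> f \<in> Arr \<A> \<and>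
     (\<forall>X\<in>Ob \<A>. \<forall>u\<in>Hom \<A> (Cod \<A> f) X. \<forall>v\<in>Hom \<A> (Cod \<A> f) X.
        u \<cdot>\<^bsub>\<A>\<^esub> f = v \<cdot>\<^bsub>\<A>\<^esub> f \<longrightarrow> u = v)"

definition is_kernel :: "('o, 'm) cat \<Rightarrow> 'm \<Rightarrow> 'm \<Rightarrow> bool" where
  "is_kernel \<A> k f \<longleftrightarrow> f \<in> Arr \<A> \<and> k \<in> Arr \<A> \<and> Cod \<A> k = Dom \<A> f \<and>
     f \<cdot>\<^bsub>\<A>\<^esub> k = Zero \<A> (Dom \<A> k) (Cod \<A> f) \<and>
     (\<forall>X\<in>Ob \<A>. \<forall>u\<in>Hom \<A> X (Dom \<A> f). f \<cdot>\<^bsub>\<A>\<^esub> u = Zero \<A> X (Cod \<A> f) \<longrightarrow>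
        (\<exists>!v. v \<in> Hom \<A> X (Dom \<A> k) \<and> k \<cdot>\<^bsub>\<A>\<^esub> v = u))"

definition is_cokernel :: "('o, 'm) cat \<Rightarrow> 'm \<Rightarrow> 'm \<Rightarrow> bool" where
  "is_cokernel \<A> c f \<longleftrightarrow> f \<in> Arr \<A> \<and> c \<in> Arr \<A> \<and> Dom \<A> c = Cod \<A> f \<and>
     c \<cdot>\<^bsub>\<A>\<^esub> f = Zero \<A> (Dom \<A> f) (Cod \<A> c) \<and>
     (\<forall>X\<in>Ob \<A>. \<forall>u\<in>Hom \<A> (Cod \<A> f) X. u \<cdot>\<^bsub>\<A>\<^esub> f = Zero \<A> (Dom \<A> f) X \<longrightarrow>
        (\<exists>!v. v \<in> Hom \<A> (Cod \<A> c) X \<and> v \<cdot>\<^bsub>\<A>\<^esub> c = u))"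

locale abelian_category = preadditive_category +
  assumes finite_direct_sums: "\<lbrakk>finite I; X ` I \<subseteq> Ob \<A>\<rbrakk> \<Longrightarrow> \<exists>S \<iota> \<pi>. is_direct_sum \<A> I X S \<iota> \<pi>"
    and kernels: "f \<in> Arr \<A> \<Longrightarrow> \<exists>k. is_kernel \<A> k f"
    and cokernels: "f \<in> Arr \<A> \<Longrightarrow> \<exists>c. is_cokernel \<A> c f"
    and mono_normal: "is_mono \<A> f \<Longrightarrow> \<exists>g. is_kernel \<A> f g"
    and epi_normal: "is_epi \<A> f \<Longrightarrow> \<exists>g. is_cokernel \<A> f g"

section \<open>Exactness, projective objects and Ext\<close>

text \<open>\<open>k\<close> is (the inclusion of) the image of \<open>f\<close>, that is, the kernel of the cokernel of \<open>f\<close>.\<close>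

definition is_image :: "('o, 'm) cat \<Rightarrow> 'm \<Rightarrow> 'm \<Rightarrow> bool" where
  "is_image \<A> k f \<longleftrightarrow> (\<exists>c. is_cokernel \<A> c f \<and> is_kernel \<A> k c)"

text \<open>Exactness of \<open>A \<rightarrow> B \<rightarrow> C\<close> at \<open>B\<close>: the image of \<open>f\<close> is the kernel of \<open>g\<close>.\<close>

definition exact_at :: "('o, 'm) cat \<Rightarrow> 'm \<Rightarrow> 'm \<Rightarrow> bool" where
  "exact_at \<A> f g \<longleftrightarrow> (\<exists>k. is_image \<A> k f \<and> is_kernel \<A> k g)"

definition right_exact_seq :: "('o, 'm) cat \<Rightarrow> 'o \<Rightarrow> 'm \<Rightarrow> 'o \<Rightarrow> 'm \<Rightarrow> 'o \<Rightarrow> bool" where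
  "right_exact_seq \<A> A f B g C \<longleftrightarrow>
     f \<in> Hom \<A> A B \<and> g \<in> Hom \<A> B C \<and> exact_at \<A> f g \<and> is_epi \<A> g"

definition short_exact_seq :: "('o, 'm) cat \<Rightarrow> 'o \<Rightarrow> 'm \<Rightarrow> 'o \<Rightarrow> 'm \<Rightarrow> 'o \<Rightarrow> bool" where
  "short_exact_seq \<A> A f B g C \<longleftrightarrow>
     f \<in> Hom \<A> A B \<and> g \<in> Hom \<A> B C \<and> is_mono \<A> f \<and> exact_at \<A> f g \<and> is_epi \<A> g"

definition projective :: "('o, 'm) cat \<Rightarrow> 'o \<Rightarrow> bool" where
  "projective \<A> P \<longleftrightarrow> P \<in> Ob \<A> \<and>
     (\<forall>e. is_epi \<A> e \<longrightarrow> (\<forall>f\<in>Hom \<A> P (Cod \<A> e). \<exists>g\<in>Hom \<A> P (Dom \<A> e). e \<cdot>\<^bsub>\<A>\<^esub> g = f))"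

definition enough_projectives :: "('o, 'm) cat \<Rightarrow> bool" where
  "enough_projectives \<A> \<longleftrightarrow>
     (\<forall>A\<in>Ob \<A>. \<exists>P e. projective \<A> P \<and> e \<in> Hom \<A> P A \<and> is_epi \<A> e)"

text \<open>
  A projective resolution \<open>\<dots> \<rightarrow> P 1 \<rightarrow> P 0 \<rightarrow> A \<rightarrow> 0\<close>: here \<open>d 0 : P 0 \<rightarrow> A\<close> is the
  augmentation and \<open>d (Suc n) : P (Suc n) \<rightarrow> P n\<close> are the differentials.
\<close>

definition projective_resolution ::
    "('o, 'm) cat \<Rightarrow> 'o \<Rightarrow> (nat \<Rightarrow> 'o) \<Rightarrow> (nat \<Rightarrow> 'm) \<Rightarrow> bool" where
  "projective_resolution \<A> A P d \<longleftrightarrow>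
     (\<forall>n. projective \<A> (P n)) \<and> d 0 \<in> Hom \<A> (P 0) A \<and> is_epi \<A> (d 0) \<and>
     (\<forall>n. d (Suc n) \<in> Hom \<A> (P (Suc n)) (P n) \<and> exact_at \<A> (d (Suc n)) (d n))"

definition proj_dim_le :: "('o, 'm) cat \<Rightarrow> nat \<Rightarrow> 'o \<Rightarrow> bool" where
  "proj_dim_le \<A> n A \<longleftrightarrow>
     (\<exists>P d. projective_resolution \<A> A P d \<and> (\<forall>i>n. is_zero_object \<A> (P i)))"

text \<open>
  The \<open>n\<close>-th cohomology group of the complex \<open>Hom(P 0, B) \<rightarrow> Hom(P 1, B) \<rightarrow> \<dots>\<close>
  obtained from a resolution \<open>(P, d)\<close>. The augmentation \<open>d 0\<close> is not part of the complex.
\<close>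

definition cocycles :: "('o, 'm) cat \<Rightarrow> (nat \<Rightarrow> 'o) \<Rightarrow> (nat \<Rightarrow> 'm) \<Rightarrow> nat \<Rightarrow> 'o \<Rightarrow> 'm set" where
  "cocycles \<A> P d n B = {f \<in> Hom \<A> (P n) B. f \<cdot>\<^bsub>\<A>\<^esub> d (Suc n) = Zero \<A> (P (Suc n)) B}"

definition coboundaries :: "('o, 'm) cat \<Rightarrow> (nat \<Rightarrow> 'o) \<Rightarrow> (nat \<Rightarrow> 'm) \<Rightarrow> nat \<Rightarrow> 'o \<Rightarrow> 'm set" where
  "coboundaries \<A> P d n B =
     (if n = 0 then {Zero \<A> (P 0) B} else (\<lambda>g. g \<cdot>\<^bsub>\<A>\<^esub> d n) ` Hom \<A> (P (n - 1)) B)"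

definition Hom_cohomology ::
    "('o, 'm) cat \<Rightarrow> (nat \<Rightarrow> 'o) \<Rightarrow> (nat \<Rightarrow> 'm) \<Rightarrow> nat \<Rightarrow> 'o \<Rightarrow> 'm set monoid" where
  "Hom_cohomology \<A> P d n B =
     (Hom_group \<A> (P n) B)\<lparr>carrier := cocycles \<A> P d n B\<rparr> Mod coboundaries \<A> P d n B"

text \<open>\<open>Ext\<close> is computed from a chosen resolution; up to isomorphism the choice is irrelevant.\<close>

definition Ext :: "('o, 'm) cat \<Rightarrow> nat \<Rightarrow> 'o \<Rightarrow> 'o \<Rightarrow> 'm set monoid" where
  "Ext \<A> n A B =
     (let R = (SOME R. projective_resolution \<A> A (fst R) (snd R))
      in Hom_cohomology \<A> (fst R) (snd R) n B)"

text \<open>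
  \<open>Ext\<^sup>n(A, B) = 0\<close>. By convention \<open>Ext\<^sup>0\<close> is \<open>Hom\<close> itself, which has a different type
  from (but is isomorphic to) the cohomology group in degree 0.
\<close>

definition Ext_zero :: "('o, 'm) cat \<Rightarrow> nat \<Rightarrow> 'o \<Rightarrow> 'o \<Rightarrow> bool" where
  "Ext_zero \<A> n A B \<longleftrightarrow>
     (if n = 0 then trivial_group (Hom_group \<A> A B) else trivial_group (Ext \<A> n A B))"

section \<open>Subcategories\<close>

text \<open>A full subcategory closed under isomorphisms is identified with its set of objects.\<close>

definition subcategory :: "('o, 'm) cat \<Rightarrow> 'o set \<Rightarrow> bool" where
  "subcategory \<A> \<X> \<longleftrightarrow>
     \<X> \<subseteq> Ob \<A> \<and> (\<forall>A\<in>\<X>. \<forall>B\<in>Ob \<A>. isomorphic \<A> A B \<longrightarrow> B \<in> \<X>)"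

definition right_perp :: "('o, 'm) cat \<Rightarrow> nat \<Rightarrow> 'o set \<Rightarrow> 'o set" where
  "right_perp \<A> n \<X> = {A \<in> Ob \<A>. \<forall>X\<in>\<X>. Ext_zero \<A> n X A}"

definition left_perp :: "('o, 'm) cat \<Rightarrow> nat \<Rightarrow> 'o set \<Rightarrow> 'o set" where
  "left_perp \<A> n \<X> = {A \<in> Ob \<A>. \<forall>X\<in>\<X>. Ext_zero \<A> n A X}"

definition Fac :: "('o, 'm) cat \<Rightarrow> 'o set \<Rightarrow> 'o set" where
  "Fac \<A> \<X> = {A \<in> Ob \<A>. \<exists>X\<in>\<X>. \<exists>e\<in>Hom \<A> X A. is_epi \<A> e}"

definition sums_of_copies :: "('o, 'm) cat \<Rightarrow> 'o \<Rightarrow> 'o set" where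
  "sums_of_copies \<A> T = {S. \<exists>I \<iota> \<pi>. is_direct_sum \<A> I (\<lambda>_. T) S \<iota> \<pi>}"

definition Fac_object :: "('o, 'm) cat \<Rightarrow> 'o \<Rightarrow> 'o set" where
  "Fac_object \<A> T = Fac \<A> (sums_of_copies \<A> T)"

definition left_approximation :: "('o, 'm) cat \<Rightarrow> 'o set \<Rightarrow> 'o \<Rightarrow> 'm \<Rightarrow> bool" where
  "left_approximation \<A> \<X> A f \<longleftrightarrow> f \<in> Arr \<A> \<and> Dom \<A> f = A \<and> Cod \<A> f \<in> \<X> \<and>
     (\<forall>X'\<in>\<X>. \<forall>g\<in>Hom \<A> A X'. \<exists>h\<in>Hom \<A> (Cod \<A> f) X'. h \<cdot>\<^bsub>\<A>\<^esub> f = g)"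

definition right_approximation :: "('o, 'm) cat \<Rightarrow> 'o set \<Rightarrow> 'o \<Rightarrow> 'm \<Rightarrow> bool" where
  "right_approximation \<A> \<X> A f \<longleftrightarrow> f \<in> Arr \<A> \<and> Cod \<A> f = A \<and> Dom \<A> f \<in> \<X> \<and>
     (\<forall>X'\<in>\<X>. \<forall>g\<in>Hom \<A> X' A. \<exists>h\<in>Hom \<A> X' (Dom \<A> f). f \<cdot>\<^bsub>\<A>\<^esub> h = g)"

definition contravariantly_finite :: "('o, 'm) cat \<Rightarrow> 'o set \<Rightarrow> bool" where
  "contravariantly_finite \<A> \<X> \<longleftrightarrow> (\<forall>A\<in>Ob \<A>. \<exists>f. right_approximation \<A> \<X> A f)"

text \<open>The empty sum is included, so such a subcategory contains the zero objects.\<close>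

definition closed_direct_sums :: "('o, 'm) cat \<Rightarrow> 'o set \<Rightarrow> bool" where
  "closed_direct_sums \<A> \<X> \<longleftrightarrow>
     (\<forall>I X S \<iota> \<pi>. is_direct_sum \<A> I X S \<iota> \<pi> \<and> X ` I \<subseteq> \<X> \<longrightarrow> S \<in> \<X>)"

definition closed_direct_summands :: "('o, 'm) cat \<Rightarrow> 'o set \<Rightarrow> bool" where
  "closed_direct_summands \<A> \<X> \<longleftrightarrow>
     (\<forall>I X S \<iota> \<pi>. is_direct_sum \<A> I X S \<iota> \<pi> \<and> S \<in> \<X> \<longrightarrow> X ` I \<subseteq> \<X>)"

section \<open>Tilting subcategories, torsion pairs and cotorsion pairs\<close>

definition support_tau_tilting :: "('o, 'm) cat \<Rightarrow> 'o set \<Rightarrow> bool" where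
  "support_tau_tilting \<A> \<T> \<longleftrightarrow>
     subcategory \<A> \<T> \<and> closed_direct_sums \<A> \<T> \<and> closed_direct_summands \<A> \<T> \<and>
     contravariantly_finite \<A> \<T> \<and>
     (\<forall>T1\<in>\<T>. \<forall>T2\<in>\<T>. \<forall>Y\<in>Fac_object \<A> T2. Ext_zero \<A> 1 T1 Y) \<and>
     (\<forall>P. projective \<A> P \<longrightarrow>
        (\<exists>T0\<in>\<T>. \<exists>T1\<in>\<T>. \<exists>f g. right_exact_seq \<A> P f T0 g T1 \<and> left_approximation \<A> \<T> P f))"

definition tilting :: "('o, 'm) cat \<Rightarrow> 'o set \<Rightarrow> bool" where
  "tilting \<A> \<T> \<longleftrightarrow>
     subcategory \<A> \<T> \<and> closed_direct_sums \<A> \<T> \<and> closed_direct_summands \<A> \<T> \<and>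
     contravariantly_finite \<A> \<T> \<and>
     (\<forall>T1\<in>\<T>. \<forall>T2\<in>\<T>. \<forall>i\<ge>1. Ext_zero \<A> i T1 T2) \<and>
     (\<forall>T\<in>\<T>. proj_dim_le \<A> 1 T) \<and>
     (\<forall>P. projective \<A> P \<longrightarrow> (\<exists>T0\<in>\<T>. \<exists>T1\<in>\<T>. \<exists>f g. short_exact_seq \<A> P f T0 g T1))"

definition torsion_pair :: "('o, 'm) cat \<Rightarrow> 'o set \<Rightarrow> 'o set \<Rightarrow> bool" where
  "torsion_pair \<A> \<D> \<F> \<longleftrightarrow>
     subcategory \<A> \<D> \<and> subcategory \<A> \<F> \<and>
     (\<forall>D\<in>\<D>. \<forall>F\<in>\<F>. Ext_zero \<A> 0 D F) \<and>
     (\<forall>A\<in>Ob \<A>. \<exists>D\<in>\<D>. \<exists>F\<in>\<F>. \<exists>f g. short_exact_seq \<A> D f A g F)"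

definition cotorsion_pair :: "('o, 'm) cat \<Rightarrow> 'o set \<Rightarrow> 'o set \<Rightarrow> bool" where
  "cotorsion_pair \<A> \<C> \<D> \<longleftrightarrow>
     subcategory \<A> \<C> \<and> subcategory \<A> \<D> \<and>
     \<C> = left_perp \<A> 1 \<D> \<and> \<D> = right_perp \<A> 1 \<C> \<and>
     (\<forall>A\<in>Ob \<A>.
        (\<exists>D\<in>\<D>. \<exists>C\<in>\<C>. \<exists>f g. short_exact_seq \<A> D f C g A) \<and>
        (\<exists>D'\<in>\<D>. \<exists>C'\<in>\<C>. \<exists>f g. short_exact_seq \<A> A f D' g C'))"

definition cotorsion_torsion_triple ::
    "('o, 'm) cat \<Rightarrow> 'o set \<Rightarrow> 'o set \<Rightarrow> 'o set \<Rightarrow> bool" where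
  "cotorsion_torsion_triple \<A> \<C> \<D> \<F> \<longleftrightarrow> cotorsion_pair \<A> \<C> \<D> \<and> torsion_pair \<A> \<D> \<F>"

definition tau_cotorsion_torsion_triple ::
    "('o, 'm) cat \<Rightarrow> 'o set \<Rightarrow> 'o set \<Rightarrow> 'o set \<Rightarrow> bool" where
  "tau_cotorsion_torsion_triple \<A> \<C> \<D> \<F> \<longleftrightarrow>
     subcategory \<A> \<C> \<and> subcategory \<A> \<D> \<and> subcategory \<A> \<F> \<and>
     \<C> = left_perp \<A> 1 \<D> \<and>
     (\<forall>P. projective \<A> P \<longrightarrow>
        (\<exists>D\<in>\<C> \<inter> \<D>. \<exists>C\<in>\<C>. \<exists>f g.
           right_exact_seq \<A> P f D g C \<and> left_approximation \<A> \<D> P f)) \<and>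
     contravariantly_finite \<A> (\<C> \<inter> \<D>) \<and>
     torsion_pair \<A> \<D> \<F>"

definition support_tau_tilting_subcategories :: "('o, 'm) cat \<Rightarrow> 'o set set" where
  "support_tau_tilting_subcategories \<A> = {\<T>. support_tau_tilting \<A> \<T>}"

definition tilting_subcategories :: "('o, 'm) cat \<Rightarrow> 'o set set" where
  "tilting_subcategories \<A> = {\<T>. tilting \<A> \<T>}"

definition tau_cotorsion_torsion_triples :: "('o, 'm) cat \<Rightarrow> ('o set \<times> 'o set \<times> 'o set) set" where
  "tau_cotorsion_torsion_triples \<A> =
     {(\<C>, \<D>, \<F>). tau_cotorsion_torsion_triple \<A> \<C> \<D> \<F>}"

definition cotorsion_torsion_triples :: "('o, 'm) cat \<Rightarrow> ('o set \<times> 'o set \<times> 'o set) set" where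
  "cotorsion_torsion_triples \<A> = {(\<C>, \<D>, \<F>). cotorsion_torsion_triple \<A> \<C> \<D> \<F>}"

definition Phi :: "('o, 'm) cat \<Rightarrow> 'o set \<Rightarrow> 'o set \<times> 'o set \<times> 'o set" where
  "Phi \<A> \<T> = (left_perp \<A> 1 (Fac \<A> \<T>), Fac \<A> \<T>, right_perp \<A> 0 \<T>)"

definition Psi :: "'o set \<times> 'o set \<times> 'o set \<Rightarrow> 'o set" where
  "Psi = (\<lambda>(\<C>, \<D>, \<F>). \<C> \<inter> \<D>)"

end

theory Submission
  imports Defs
begin

text \<open>
  A triple and its subcategory determine each other through the torsion class \<open>\<D>\<close>: on one side
  \<open>\<D> = Fac \<T>\<close>, on the other \<open>\<T> = \<C> \<inter> \<D>\<close> consists of the objects of \<open>\<D>\<close> that are Ext-projective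
  in \<open>\<D>\<close>; \<open>\<C>\<close> and \<open>\<F>\<close> are orthogonals of \<open>\<D>\<close>.
  
  Let \<open>\<T>\<close> be support tau-tilting. The torsion part of an object is the image of a right
  \<open>\<T>\<close>-approximation (\<open>torsion_pair_Fac\<close>), and left \<open>\<T>\<close>-approximations of projectives are left
  \<open>Fac \<T>\<close>-approximations because maps from a projective to a quotient of \<open>T\<close> lift to \<open>T\<close>. The main
  point is that \<open>\<T>\<close> can be recovered from \<open>Fac \<T>\<close>. A right \<open>\<T>\<close>-approximation of an object
  of \<open>Fac \<T>\<close> is epic and its kernel lies in \<open>Fac \<T>\<close> again (\<open>kernel_of_approximation_in_Fac\<close>); if the
  object is also left orthogonal to \<open>Fac \<T>\<close>, this sequence splits, and the object is a summand of an
  object of \<open>\<T>\<close> (\<open>stt_left_perp_inter_Fac\<close>). Conversely, given a triple, an epimorphism from a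
  projective \<open>P\<close> to \<open>D \<in> \<D>\<close> factors through the left approximation \<open>P \<rightarrow> D0\<close>, so that \<open>D\<close> is a quotient
  of \<open>D0 \<in> \<C> \<inter> \<D>\<close> (\<open>tau_cotorsion_torsion_Phi_Psi\<close>).
  
  For tilting \<open>\<T>\<close>, projective dimension at most one makes \<open>Ext\<^sup>1(T, -)\<close> right exact, so \<open>\<T>\<close> is support
  tau-tilting. The sequences that make \<open>\<D>\<close> half of a cotorsion pair are pushouts of
  \<open>0 \<rightarrow> P \<rightarrow> T0 \<rightarrow> T1 \<rightarrow> 0\<close> and, for the other half, Salce's pushout of a projective presentation
  (\<open>tilting_imp_cotorsion_torsion\<close>). Conversely, if \<open>\<D>\<close> belongs to a cotorsion pair and is
  closed under quotients, the kernel of any epimorphism from a projective to an object of \<open>\<C>\<close> is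
  projective (\<open>kernel_of_projective_presentation_projective\<close>). This bounds the projective dimension
  and kills all higher Ext groups.
  
  Two devices carry the homological algebra. First, with enough projectives, arrows \<open>x : P \<rightarrow> A\<close> with
  \<open>P\<close> projective behave like elements of \<open>A\<close>: monomorphisms, epimorphisms and exactness can be tested on
  them (\<open>monoI\<close>, \<open>epiI\<close>, \<open>exactI\<close>, \<open>exact_lift\<close>). Second, the vanishing of \<open>Ext\<^sup>1(A, B)\<close> is equivalent to
  lifting maps \<open>A \<rightarrow> Z\<close> along epimorphisms with kernel \<open>B\<close>, and to extending maps \<open>X \<rightarrow> B\<close> along
  monomorphisms with cokernel \<open>A\<close> (\<open>Ext_zero_1_iff\<close>). Used in both forms, this replaces the long exact
  sequences.
\<close>

section \<open>Arithmetic of arrows\<close>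

context category
begin

abbreviation in_hom :: "'m \<Rightarrow> 'o \<Rightarrow> 'o \<Rightarrow> bool" ("\<langle>_ : _ \<rightarrow> _\<rangle>") where
  "\<langle>f : A \<rightarrow> B\<rangle> \<equiv> f \<in> Hom \<A> A B"

lemma hom_iff: "\<langle>f : A \<rightarrow> B\<rangle> \<longleftrightarrow> f \<in> Arr \<A> \<and> Dom \<A> f = A \<and> Cod \<A> f = B"
  by (simp add: Hom_def)

lemma hom_Ob: "\<langle>f : A \<rightarrow> B\<rangle> \<Longrightarrow> A \<in> Ob \<A> \<and> B \<in> Ob \<A>"
  using Dom_closed Cod_closed by (auto simp: hom_iff)

lemma comp_typing [simp]:
  assumes "f \<in> Arr \<A>" "g \<in> Arr \<A>" "Dom \<A> g = Cod \<A> f"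
  shows "g \<cdot> f \<in> Arr \<A>" "Dom \<A> (g \<cdot> f) = Dom \<A> f" "Cod \<A> (g \<cdot> f) = Cod \<A> g"
  using Comp_closed[of f "Dom \<A> f" "Cod \<A> f" g "Cod \<A> g"] assms by (auto simp: Hom_def)

lemma comp_assoc [simp]:
  assumes "f \<in> Arr \<A>" "g \<in> Arr \<A>" "h \<in> Arr \<A>" "Dom \<A> g = Cod \<A> f" "Dom \<A> h = Cod \<A> g"
  shows "(h \<cdot> g) \<cdot> f = h \<cdot> (g \<cdot> f)"
  using Comp_assoc[of f "Dom \<A> f" "Cod \<A> f" g "Cod \<A> g" h "Cod \<A> h"] assms
  by (auto simp: Hom_def)

lemma id_typing [simp]:
  assumes "A \<in> Ob \<A>"
  shows "Id \<A> A \<in> Arr \<A>" "Dom \<A> (Id \<A> A) = A" "Cod \<A> (Id \<A> A) = A"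
  using Id_closed[OF assms] by (auto simp: Hom_def)

lemma comp_id [simp]:
  assumes "f \<in> Arr \<A>"
  shows "Dom \<A> f = A \<Longrightarrow> f \<cdot> Id \<A> A = f" "Cod \<A> f = B \<Longrightarrow> Id \<A> B \<cdot> f = f"
  using assms Id_left Id_right by (auto simp: Hom_def)

text \<open>
  The simplifier associates composites to the right, which hides a known composite \<open>g \<cdot> f\<close> inside
  \<open>g \<cdot> (f \<cdot> x)\<close>; this rule recovers it.
\<close>

lemma comp_through:
  assumes "g \<cdot> f = h" "\<langle>f : A \<rightarrow> B\<rangle>" "\<langle>g : B \<rightarrow> C\<rangle>" "\<langle>x : X \<rightarrow> A\<rangle>"
  shows "g \<cdot> (f \<cdot> x) = h \<cdot> x"
  using assms by (auto simp: hom_iff simp flip: assms(1))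

end

context preadditive_category
begin

abbreviation add (infixl "\<oplus>" 65) where "f \<oplus> g \<equiv> Plus \<A> f g"

text \<open>
  Domain and codomain of \<open>f\<close> select the group in which the inverse is taken.
\<close>

definition neg where
  "neg f = inv\<^bsub>Hom_group \<A> (Dom \<A> f) (Cod \<A> f)\<^esub> f"

definition sub (infixl "\<ominus>" 65) where "f \<ominus> g = f \<oplus> neg g"

lemma zero_in_hom: "A \<in> Ob \<A> \<Longrightarrow> B \<in> Ob \<A> \<Longrightarrow> \<langle>Zero \<A> A B : A \<rightarrow> B\<rangle>"
  using comm_groupE(2)[OF Hom_comm_group] by (fastforce simp: Hom_group_def)

lemma zero_typing [simp]:
  assumes "A \<in> Ob \<A>" "B \<in> Ob \<A>"
  shows "Zero \<A> A B \<in> Arr \<A>" "Dom \<A> (Zero \<A> A B) = A" "Cod \<A> (Zero \<A> A B) = B"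
  using zero_in_hom[OF assms] by (auto simp: Hom_def)

lemma add_in_hom: "\<langle>f : A \<rightarrow> B\<rangle> \<Longrightarrow> \<langle>g : A \<rightarrow> B\<rangle> \<Longrightarrow> \<langle>f \<oplus> g : A \<rightarrow> B\<rangle>"
  using comm_groupE(1)[OF Hom_comm_group, of A B f g] hom_Ob[of f A B] by (simp add: Hom_group_def)

lemma neg_in_hom: "\<langle>f : A \<rightarrow> B\<rangle> \<Longrightarrow> \<langle>neg f : A \<rightarrow> B\<rangle>"
  using group.inv_closed[OF comm_group.axioms(2)[OF Hom_comm_group], of A B f] hom_Ob[of f A B]
  by (auto simp: Hom_group_def neg_def hom_iff)

lemma sub_in_hom: "\<langle>f : A \<rightarrow> B\<rangle> \<Longrightarrow> \<langle>g : A \<rightarrow> B\<rangle> \<Longrightarrow> \<langle>f \<ominus> g : A \<rightarrow> B\<rangle>"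
  by (simp add: sub_def add_in_hom neg_in_hom)

lemma add_typing [simp]:
  assumes "f \<in> Arr \<A>" "g \<in> Arr \<A>" "Dom \<A> f = Dom \<A> g" "Cod \<A> f = Cod \<A> g"
  shows "f \<oplus> g \<in> Arr \<A>" "Dom \<A> (f \<oplus> g) = Dom \<A> g" "Cod \<A> (f \<oplus> g) = Cod \<A> g"
  using add_in_hom[of f "Dom \<A> g" "Cod \<A> g" g] assms by (auto simp: hom_iff)

lemma sub_typing [simp]:
  assumes "f \<in> Arr \<A>" "g \<in> Arr \<A>" "Dom \<A> f = Dom \<A> g" "Cod \<A> f = Cod \<A> g"
  shows "f \<ominus> g \<in> Arr \<A>" "Dom \<A> (f \<ominus> g) = Dom \<A> g" "Cod \<A> (f \<ominus> g) = Cod \<A> g"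
  using sub_in_hom[of f "Dom \<A> g" "Cod \<A> g" g] assms by (auto simp: hom_iff)

lemma hom_group_laws:
  assumes "\<langle>f : A \<rightarrow> B\<rangle>" "\<langle>g : A \<rightarrow> B\<rangle>" "\<langle>h : A \<rightarrow> B\<rangle>"
  shows add_assoc: "(f \<oplus> g) \<oplus> h = f \<oplus> (g \<oplus> h)"
    and add_commute: "f \<oplus> g = g \<oplus> f"
    and zero_add: "Zero \<A> A B \<oplus> f = f"
    and add_neg: "f \<oplus> neg f = Zero \<A> A B"
    and add_cancel: "f \<oplus> g = f \<oplus> h \<longleftrightarrow> g = h"
proof -
  interpret comm_group "Hom_group \<A> A B" using assms hom_Ob Hom_comm_group by blast
  note [simp] = Hom_group_def
  show "(f \<oplus> g) \<oplus> h = f \<oplus> (g \<oplus> h)" "f \<oplus> g = g \<oplus> f" "Zero \<A> A B \<oplus> f = f"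
      "f \<oplus> g = f \<oplus> h \<longleftrightarrow> g = h"
    using m_assoc[of f g h] m_comm[of f g] l_one[of f] Units_l_cancel[of f g h] assms
    unfolding Units_eq by auto
  show "f \<oplus> neg f = Zero \<A> A B"
    using r_inv[of f] assms by (auto simp: neg_def hom_iff)
qed

lemma add_zero: "\<langle>f : A \<rightarrow> B\<rangle> \<Longrightarrow> f \<oplus> Zero \<A> A B = f"
  using add_commute[of f A B "Zero \<A> A B" f] zero_add[of f A B f f] zero_in_hom[of A B] hom_Ob[of f A B]
  by auto

lemma sub_self: "\<langle>f : A \<rightarrow> B\<rangle> \<Longrightarrow> f \<ominus> f = Zero \<A> A B"
  using add_neg[of f A B f f] by (simp add: sub_def)

lemma sub_zero: "\<langle>f : A \<rightarrow> B\<rangle> \<Longrightarrow> f \<ominus> Zero \<A> A B = f"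
  using add_neg[of "Zero \<A> A B" A B f f] zero_add[of "neg (Zero \<A> A B)" A B f f]
    zero_in_hom[of A B] neg_in_hom[of "Zero \<A> A B" A B] hom_Ob[of f A B] add_zero[of f A B]
  by (simp add: sub_def)

lemma sub_laws:
  assumes "\<langle>f : A \<rightarrow> B\<rangle>" "\<langle>g : A \<rightarrow> B\<rangle>"
  shows sub_add: "(f \<ominus> g) \<oplus> g = f"
    and sub_eq_zero_iff: "f \<ominus> g = Zero \<A> A B \<longleftrightarrow> f = g"
proof -
  note n = neg_in_hom[OF assms(2)]
  have z: "\<langle>Zero \<A> A B : A \<rightarrow> B\<rangle>" using hom_Ob[OF assms(1)] zero_in_hom by blast
  show 1: "(f \<ominus> g) \<oplus> g = f"
    using add_assoc[OF assms(1) n assms(2)] add_commute[OF assms(2) n z]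
      add_neg[OF assms(2,2,2)] add_zero[OF assms(1)] by (simp add: sub_def)
  show "f \<ominus> g = Zero \<A> A B \<longleftrightarrow> f = g"
    using sub_self[OF assms(1)] zero_add[OF assms(2) z z] 1 by force
qed

lemma add_eq_zero_iff:
  assumes "\<langle>f : A \<rightarrow> B\<rangle>" "\<langle>g : A \<rightarrow> B\<rangle>"
  shows "f \<oplus> g = Zero \<A> A B \<longleftrightarrow> g = neg f"
  using add_cancel[OF assms(1,2) neg_in_hom[OF assms(1)]] add_neg[OF assms(1) assms(1) assms(1)] by simp

lemma comp_zero [simp]:
  assumes "f \<in> Arr \<A>" "C \<in> Ob \<A>"
  shows "Dom \<A> f = B \<Longrightarrow> f \<cdot> Zero \<A> C B = Zero \<A> C (Cod \<A> f)"
    and "Cod \<A> f = B \<Longrightarrow> Zero \<A> B C \<cdot> f = Zero \<A> (Dom \<A> f) C"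
proof -
  have f: "\<langle>f : Dom \<A> f \<rightarrow> Cod \<A> f\<rangle>" using assms by (simp add: hom_iff)
  note O = hom_Ob[OF f]
  { assume [simp]: "Dom \<A> f = B"
    let ?z = "Zero \<A> C B" and ?y = "Zero \<A> C (Cod \<A> f)"
    have z: "\<langle>?z : C \<rightarrow> B\<rangle>" and y: "\<langle>?y : C \<rightarrow> Cod \<A> f\<rangle>"
      and fz: "\<langle>f \<cdot> ?z : C \<rightarrow> Cod \<A> f\<rangle>"
      using O assms by (auto simp: hom_iff)
    show "f \<cdot> ?z = ?y"
      using Comp_Plus_right[OF z z, of f] f z zero_add[OF z z z] add_cancel[OF fz fz y]
        add_zero[OF fz] by (simp add: hom_iff) }
  { assume [simp]: "Cod \<A> f = B"
    let ?z = "Zero \<A> B C" and ?y = "Zero \<A> (Dom \<A> f) C"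
    have z: "\<langle>?z : B \<rightarrow> C\<rangle>" and y: "\<langle>?y : Dom \<A> f \<rightarrow> C\<rangle>"
      and fz: "\<langle>?z \<cdot> f : Dom \<A> f \<rightarrow> C\<rangle>"
      using O assms by (auto simp: hom_iff)
    show "?z \<cdot> f = ?y"
      using Comp_Plus_left[OF _ z z, of f "Dom \<A> f"] f z zero_add[OF z z z] add_cancel[OF fz fz y]
        add_zero[OF fz] by (simp add: hom_iff) }
qed

lemma comp_add [simp]:
  assumes "f \<in> Arr \<A>" "g \<in> Arr \<A>" "Dom \<A> f = Dom \<A> g" "Cod \<A> f = Cod \<A> g"
  shows "h \<in> Arr \<A> \<Longrightarrow> Dom \<A> h = Cod \<A> g \<Longrightarrow> h \<cdot> (f \<oplus> g) = h \<cdot> f \<oplus> h \<cdot> g"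
    and "h \<in> Arr \<A> \<Longrightarrow> Cod \<A> h = Dom \<A> g \<Longrightarrow> (f \<oplus> g) \<cdot> h = f \<cdot> h \<oplus> g \<cdot> h"
  using assms Comp_Plus_right[of f "Dom \<A> g" "Cod \<A> g" g h "Cod \<A> h"]
    Comp_Plus_left[of h "Dom \<A> h" "Dom \<A> g" f "Cod \<A> g" g]
  by (auto simp: hom_iff)

lemma comp_neg:
  assumes "f \<in> Arr \<A>" "h \<in> Arr \<A>" "Dom \<A> h = Cod \<A> f"
  shows "h \<cdot> neg f = neg (h \<cdot> f)" "neg h \<cdot> f = neg (h \<cdot> f)"
proof -
  have f: "\<langle>f : Dom \<A> f \<rightarrow> Cod \<A> f\<rangle>" and h: "\<langle>h : Cod \<A> f \<rightarrow> Cod \<A> h\<rangle>"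
    using assms by (simp_all add: hom_iff)
  note n = neg_in_hom[OF f] neg_in_hom[OF h]
  have "h \<cdot> f \<oplus> h \<cdot> neg f = Zero \<A> (Dom \<A> f) (Cod \<A> h)"
    using Comp_Plus_right[OF f n(1) h] add_neg[OF f f f] hom_Ob[OF f] h by (simp add: hom_iff)
  then show "h \<cdot> neg f = neg (h \<cdot> f)"
    using add_eq_zero_iff Comp_closed[OF f h] Comp_closed[OF n(1) h] by blast
  have "h \<cdot> f \<oplus> neg h \<cdot> f = Zero \<A> (Dom \<A> f) (Cod \<A> h)"
    using Comp_Plus_left[OF f h n(2)] add_neg[OF h h h] hom_Ob[OF f] hom_Ob[OF h] f h
    by (simp add: hom_iff)
  then show "neg h \<cdot> f = neg (h \<cdot> f)"
    using add_eq_zero_iff Comp_closed[OF f h] Comp_closed[OF f n(2)] by blast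
qed

lemma comp_sub [simp]:
  assumes "f \<in> Arr \<A>" "g \<in> Arr \<A>" "Dom \<A> f = Dom \<A> g" "Cod \<A> f = Cod \<A> g"
  shows "h \<in> Arr \<A> \<Longrightarrow> Dom \<A> h = Cod \<A> g \<Longrightarrow> h \<cdot> (f \<ominus> g) = h \<cdot> f \<ominus> h \<cdot> g"
    and "h \<in> Arr \<A> \<Longrightarrow> Cod \<A> h = Dom \<A> g \<Longrightarrow> (f \<ominus> g) \<cdot> h = f \<cdot> h \<ominus> g \<cdot> h"
  using assms neg_in_hom[of g "Dom \<A> g" "Cod \<A> g"]
  by (auto simp: sub_def comp_neg hom_iff)

end

section \<open>Chasing elements with projective domain\<close>

locale abelian_category_enough_projectives = abelian_category \<A>
  for \<A> :: "('o, 'm) cat" (structure) +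
  assumes enough: "enough_projectives \<A>"
begin

lemma mono_cancel:
  assumes "is_mono \<A> f" "\<langle>f : A \<rightarrow> B\<rangle>" "\<langle>x : X \<rightarrow> A\<rangle>" "\<langle>y : X \<rightarrow> A\<rangle>" "f \<cdot> x = f \<cdot> y"
  shows "x = y"
  using assms hom_Ob[OF assms(3)] by (auto simp: is_mono_def hom_iff)

lemma mono_zero:
  assumes "is_mono \<A> f" "\<langle>f : A \<rightarrow> B\<rangle>" "\<langle>x : X \<rightarrow> A\<rangle>" "f \<cdot> x = Zero \<A> X B"
  shows "x = Zero \<A> X A"
  using mono_cancel[OF assms(1-3), of "Zero \<A> X A"] assms hom_Ob[OF assms(3)]
  by (auto simp: hom_iff)

lemma epi_cancel:
  assumes "is_epi \<A> f" "\<langle>f : A \<rightarrow> B\<rangle>" "\<langle>x : B \<rightarrow> X\<rangle>" "\<langle>y : B \<rightarrow> X\<rangle>" "x \<cdot> f = y \<cdot> f"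
  shows "x = y"
  using assms hom_Ob[OF assms(3)] by (auto simp: is_epi_def hom_iff)

lemma epi_zero:
  assumes "is_epi \<A> f" "\<langle>f : A \<rightarrow> B\<rangle>" "\<langle>x : B \<rightarrow> X\<rangle>" "x \<cdot> f = Zero \<A> A X"
  shows "x = Zero \<A> B X"
  using epi_cancel[OF assms(1-3), of "Zero \<A> B X"] assms hom_Ob[OF assms(3)]
  by (auto simp: hom_iff)

lemma projective_lift:
  assumes "projective \<A> P" "is_epi \<A> e" "\<langle>e : A \<rightarrow> B\<rangle>" "\<langle>y : P \<rightarrow> B\<rangle>"
  obtains x where "\<langle>x : P \<rightarrow> A\<rangle>" "e \<cdot> x = y"
proof -
  have "Dom \<A> e = A" "Cod \<A> e = B" using assms(3) by (auto simp: hom_iff)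
  moreover have "\<exists>g\<in>Hom \<A> P (Dom \<A> e). e \<cdot> g = f" if "f \<in> Hom \<A> P (Cod \<A> e)" for f
    using assms(1,2) that unfolding projective_def by blast
  ultimately show ?thesis using assms(4) that by metis
qed

lemma projective_presentation:
  assumes "A \<in> Ob \<A>"
  obtains P e where "projective \<A> P" "\<langle>e : P \<rightarrow> A\<rangle>" "is_epi \<A> e"
  using assms enough unfolding enough_projectives_def by blast

text \<open>
  The elements of \<open>A\<close> include an epimorphism.
\<close>

lemma eq_on_elements:
  assumes "\<langle>f : A \<rightarrow> B\<rangle>" "\<langle>g : A \<rightarrow> B\<rangle>"
    and "\<And>P x. projective \<A> P \<Longrightarrow> \<langle>x : P \<rightarrow> A\<rangle> \<Longrightarrow> f \<cdot> x = g \<cdot> x"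
  shows "f = g"
proof -
  obtain P e where "projective \<A> P" "\<langle>e : P \<rightarrow> A\<rangle>" "is_epi \<A> e"
    using projective_presentation hom_Ob[OF assms(1)] by blast
  then show ?thesis using epi_cancel assms by blast
qed

lemma zero_if_zero_on_elements:
  assumes "\<langle>f : A \<rightarrow> B\<rangle>"
    and "\<And>P x. projective \<A> P \<Longrightarrow> \<langle>x : P \<rightarrow> A\<rangle> \<Longrightarrow> f \<cdot> x = Zero \<A> P B"
  shows "f = Zero \<A> A B"
proof (rule eq_on_elements[OF assms(1)])
  show "\<langle>Zero \<A> A B : A \<rightarrow> B\<rangle>" using zero_in_hom hom_Ob[OF assms(1)] by blast
  fix P x assume "projective \<A> P" "\<langle>x : P \<rightarrow> A\<rangle>"
  then show "f \<cdot> x = Zero \<A> A B \<cdot> x"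
    using assms(2) hom_Ob[OF assms(1)] by (auto simp: hom_iff)
qed

lemma monoI:
  assumes f: "\<langle>f : A \<rightarrow> B\<rangle>"
    and inj: "\<And>P x. projective \<A> P \<Longrightarrow> \<langle>x : P \<rightarrow> A\<rangle> \<Longrightarrow> f \<cdot> x = Zero \<A> P B \<Longrightarrow> x = Zero \<A> P A"
  shows "is_mono \<A> f"
proof -
  have "u = v" if u: "\<langle>u : X \<rightarrow> A\<rangle>" and v: "\<langle>v : X \<rightarrow> A\<rangle>" and eq: "f \<cdot> u = f \<cdot> v" for X u v
  proof (rule eq_on_elements[OF u v])
    fix P x assume P: "projective \<A> P" and x: "\<langle>x : P \<rightarrow> X\<rangle>"
    have ux: "\<langle>u \<cdot> x : P \<rightarrow> A\<rangle>" and vx: "\<langle>v \<cdot> x : P \<rightarrow> A\<rangle>" using u v x by (auto simp: hom_iff)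
    have "f \<cdot> (u \<cdot> x) = f \<cdot> (v \<cdot> x)" using comp_assoc[of x u f] comp_assoc[of x v f] eq f u v x
      by (simp add: hom_iff)
    then have "f \<cdot> (u \<cdot> x \<ominus> v \<cdot> x) = Zero \<A> P B"
      using sub_self[of "f \<cdot> (v \<cdot> x)" P B] \<open>f \<cdot> (u \<cdot> x) = _\<close> f ux vx by (simp add: hom_iff)
    then show "u \<cdot> x = v \<cdot> x"
      using inj[OF P sub_in_hom[OF ux vx]] sub_eq_zero_iff[OF ux vx] by blast
  qed
  then show ?thesis using f by (auto simp: is_mono_def hom_iff)
qed

lemma epiI:
  assumes e: "\<langle>e : A \<rightarrow> B\<rangle>"
    and surj: "\<And>P y. projective \<A> P \<Longrightarrow> \<langle>y : P \<rightarrow> B\<rangle> \<Longrightarrow> \<exists>x. \<langle>x : P \<rightarrow> A\<rangle> \<and> e \<cdot> x = y"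
  shows "is_epi \<A> e"
proof -
  have "u = v" if u: "\<langle>u : B \<rightarrow> X\<rangle>" and v: "\<langle>v : B \<rightarrow> X\<rangle>" and eq: "u \<cdot> e = v \<cdot> e" for X u v
  proof (rule eq_on_elements[OF u v])
    fix P y assume P: "projective \<A> P" and y: "\<langle>y : P \<rightarrow> B\<rangle>"
    obtain x where x: "\<langle>x : P \<rightarrow> A\<rangle>" "e \<cdot> x = y" using surj[OF P y] by blast
    show "u \<cdot> y = v \<cdot> y"
      using comp_assoc[of x e u] comp_assoc[of x e v] x eq e u v by (simp add: hom_iff)
  qed
  then show ?thesis using e by (auto simp: is_epi_def hom_iff)
qed

lemma comp_mono:
  assumes "is_mono \<A> f" "is_mono \<A> g" "\<langle>f : A \<rightarrow> B\<rangle>" "\<langle>g : B \<rightarrow> C\<rangle>"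
  shows "is_mono \<A> (g \<cdot> f)"
proof (rule monoI)
  show "\<langle>g \<cdot> f : A \<rightarrow> C\<rangle>" using assms by (simp add: hom_iff)
  fix P x assume x: "\<langle>x : P \<rightarrow> A\<rangle>" and 0: "(g \<cdot> f) \<cdot> x = Zero \<A> P C"
  have "\<langle>f \<cdot> x : P \<rightarrow> B\<rangle>" "g \<cdot> (f \<cdot> x) = Zero \<A> P C" using 0 x assms by (auto simp: hom_iff)
  then show "x = Zero \<A> P A" using mono_zero assms x by blast
qed

lemma kernel_props:
  assumes "is_kernel \<A> k f" "\<langle>f : A \<rightarrow> B\<rangle>"
  shows "\<langle>k : Dom \<A> k \<rightarrow> A\<rangle>" "f \<cdot> k = Zero \<A> (Dom \<A> k) B"
    and "\<langle>u : X \<rightarrow> A\<rangle> \<Longrightarrow> f \<cdot> u = Zero \<A> X B \<Longrightarrow> \<exists>v. \<langle>v : X \<rightarrow> Dom \<A> k\<rangle> \<and> k \<cdot> v = u"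
proof -
  show "\<langle>k : Dom \<A> k \<rightarrow> A\<rangle>" "f \<cdot> k = Zero \<A> (Dom \<A> k) B"
    using assms by (auto simp: is_kernel_def hom_iff)
  assume "\<langle>u : X \<rightarrow> A\<rangle>" "f \<cdot> u = Zero \<A> X B"
  moreover have "Dom \<A> f = A" "Cod \<A> f = B" using assms(2) by (auto simp: hom_iff)
  ultimately show "\<exists>v. \<langle>v : X \<rightarrow> Dom \<A> k\<rangle> \<and> k \<cdot> v = u"
    using assms(1) hom_Ob[of u X A] unfolding is_kernel_def by blast
qed

lemma cokernel_props:
  assumes "is_cokernel \<A> c f" "\<langle>f : A \<rightarrow> B\<rangle>"
  shows "\<langle>c : B \<rightarrow> Cod \<A> c\<rangle>" "c \<cdot> f = Zero \<A> A (Cod \<A> c)"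
    and "\<langle>u : B \<rightarrow> X\<rangle> \<Longrightarrow> u \<cdot> f = Zero \<A> A X \<Longrightarrow> \<exists>v. \<langle>v : Cod \<A> c \<rightarrow> X\<rangle> \<and> v \<cdot> c = u"
proof -
  show "\<langle>c : B \<rightarrow> Cod \<A> c\<rangle>" "c \<cdot> f = Zero \<A> A (Cod \<A> c)"
    using assms by (auto simp: is_cokernel_def hom_iff)
  assume "\<langle>u : B \<rightarrow> X\<rangle>" "u \<cdot> f = Zero \<A> A X"
  moreover have "Dom \<A> f = A" "Cod \<A> f = B" using assms(2) by (auto simp: hom_iff)
  ultimately show "\<exists>v. \<langle>v : Cod \<A> c \<rightarrow> X\<rangle> \<and> v \<cdot> c = u"
    using assms(1) hom_Ob[of u B X] unfolding is_cokernel_def by blast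
qed

lemma kernel_mono:
  assumes "is_kernel \<A> k f" shows "is_mono \<A> k"
proof (rule monoI)
  note k = assms[unfolded is_kernel_def]
  show "\<langle>k : Dom \<A> k \<rightarrow> Cod \<A> k\<rangle>" using k by (simp add: hom_iff)
  fix P x assume x: "\<langle>x : P \<rightarrow> Dom \<A> k\<rangle>" "k \<cdot> x = Zero \<A> P (Cod \<A> k)"
  have ob: "P \<in> Ob \<A>" "Dom \<A> k \<in> Ob \<A>" "Cod \<A> k \<in> Ob \<A>" "Cod \<A> f \<in> Ob \<A>"
    using hom_Ob[OF x(1)] k Dom_closed Cod_closed by auto
  have "\<exists>!v. \<langle>v : P \<rightarrow> Dom \<A> k\<rangle> \<and> k \<cdot> v = Zero \<A> P (Cod \<A> k)"
    using k ob zero_in_hom[of P "Dom \<A> f"] by auto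
  moreover have "k \<cdot> Zero \<A> P (Dom \<A> k) = Zero \<A> P (Cod \<A> k)" using k ob by simp
  ultimately show "x = Zero \<A> P (Dom \<A> k)" using x zero_in_hom[OF ob(1,2)] by blast
qed

lemma cokernel_epi:
  assumes "is_cokernel \<A> c f" shows "is_epi \<A> c"
proof -
  note c = assms[unfolded is_cokernel_def]
  have "u = v" if u: "\<langle>u : Cod \<A> c \<rightarrow> X\<rangle>" and v: "\<langle>v : Cod \<A> c \<rightarrow> X\<rangle>" and eq: "u \<cdot> c = v \<cdot> c" for u v X
  proof -
    have ob: "Dom \<A> f \<in> Ob \<A>" "X \<in> Ob \<A>" using hom_Ob[OF u] c Dom_closed by auto
    have "(u \<cdot> c) \<cdot> f = Zero \<A> (Dom \<A> f) X" "\<langle>u \<cdot> c : Cod \<A> f \<rightarrow> X\<rangle>"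
      using u c ob by (auto simp: hom_iff)
    then have "\<exists>!w. \<langle>w : Cod \<A> c \<rightarrow> X\<rangle> \<and> w \<cdot> c = u \<cdot> c" using c ob by blast
    then show "u = v" using u v eq by auto
  qed
  then show ?thesis using c by (auto simp: is_epi_def hom_iff)
qed

lemma kernelI:
  assumes "is_mono \<A> k" "\<langle>k : K \<rightarrow> A\<rangle>" "\<langle>f : A \<rightarrow> B\<rangle>" "f \<cdot> k = Zero \<A> K B"
    and "\<And>X u. \<langle>u : X \<rightarrow> A\<rangle> \<Longrightarrow> f \<cdot> u = Zero \<A> X B \<Longrightarrow> \<exists>v. \<langle>v : X \<rightarrow> K\<rangle> \<and> k \<cdot> v = u"
  shows "is_kernel \<A> k f"
proof -
  have eq: "Dom \<A> k = K" "Cod \<A> k = A" "Dom \<A> f = A" "Cod \<A> f = B" "k \<in> Arr \<A>" "f \<in> Arr \<A>"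
    using assms by (auto simp: hom_iff)
  have "\<exists>!v. \<langle>v : X \<rightarrow> K\<rangle> \<and> k \<cdot> v = u" if "\<langle>u : X \<rightarrow> A\<rangle>" "f \<cdot> u = Zero \<A> X B" for X u
    using assms(5)[OF that] mono_cancel[OF assms(1,2)] by blast
  then show ?thesis unfolding is_kernel_def eq using eq(5,6) assms(4) by blast
qed

lemma zero_if_zero_on_split_mono:
  assumes "is_mono \<A> m" "\<langle>m : A \<rightarrow> B\<rangle>" "\<langle>s : B \<rightarrow> A\<rangle>" "m \<cdot> s = Id \<A> B"
    "\<langle>u : B \<rightarrow> X\<rangle>" "u \<cdot> m = Zero \<A> A X"
  shows "u = Zero \<A> B X"
proof -
  have "u = u \<cdot> (m \<cdot> s)" using assms by (simp add: hom_iff)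
  also have "\<dots> = (u \<cdot> m) \<cdot> s" using assms comp_assoc[of s m u] by (simp add: hom_iff)
  also have "\<dots> = Zero \<A> B X" using assms hom_Ob[of u B X] by (simp add: hom_iff)
  finally show ?thesis .
qed

text \<open>
  If \<open>u\<close> kills \<open>f'\<close>, then \<open>f'\<close> factors through the kernel \<open>m\<close> of \<open>u\<close>. The monomorphism \<open>k \<cdot> m\<close> is the
  kernel of some \<open>g\<close>; since \<open>g\<close> kills \<open>f\<close>, it factors through the cokernel \<open>c\<close> and kills \<open>k\<close>. Hence \<open>k\<close>
  factors through \<open>k \<cdot> m\<close>, which splits \<open>m\<close> and forces \<open>u = 0\<close>.
\<close>

lemma image_corestriction_epi:
  assumes f: "\<langle>f : A \<rightarrow> B\<rangle>" and c: "is_cokernel \<A> c f" and k: "is_kernel \<A> k c"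
    and f': "\<langle>f' : A \<rightarrow> Dom \<A> k\<rangle>" "k \<cdot> f' = f"
  shows "is_epi \<A> f'"
proof -
  note c' = cokernel_props[OF c f]
  note k' = kernel_props[OF k c'(1)]
  let ?K = "Dom \<A> k"
  have zero: "u = Zero \<A> ?K X" if u: "\<langle>u : ?K \<rightarrow> X\<rangle>" and uf: "u \<cdot> f' = Zero \<A> A X" for u X
  proof -
    obtain m where m: "is_kernel \<A> m u" using u kernels by (auto simp: hom_iff)
    note m' = kernel_props[OF m u]
    let ?L = "Dom \<A> m"
    have obs: "?L \<in> Ob \<A>" "?K \<in> Ob \<A>" "A \<in> Ob \<A>" using hom_Ob m'(1) f u by auto
    obtain f2 where f2: "\<langle>f2 : A \<rightarrow> ?L\<rangle>" "m \<cdot> f2 = f'" using m'(3)[OF f'(1) uf] by blast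
    have kmh: "\<langle>k \<cdot> m : ?L \<rightarrow> B\<rangle>" using k'(1) m'(1) by (simp add: hom_iff)
    have "is_mono \<A> (k \<cdot> m)"
      using comp_mono[OF kernel_mono[OF m] kernel_mono[OF k] m'(1) k'(1)] .
    then obtain g where g: "is_kernel \<A> (k \<cdot> m) g" using mono_normal by blast
    have gg: "\<langle>g : B \<rightarrow> Cod \<A> g\<rangle>" using g kmh by (auto simp: is_kernel_def hom_iff)
    note g' = kernel_props[OF g gg]
    have obg: "Cod \<A> g \<in> Ob \<A>" using hom_Ob[OF gg] by simp
    have gkm: "g \<cdot> (k \<cdot> m) = Zero \<A> ?L (Cod \<A> g)" using g'(2) kmh by (simp add: hom_iff)
    have "g \<cdot> f = (g \<cdot> (k \<cdot> m)) \<cdot> f2"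
      using f2 f'(2) gg m'(1) k'(1) comp_assoc[of f2 "k \<cdot> m" g] comp_assoc[of f2 m k]
      by (simp add: hom_iff)
    also have "\<dots> = Zero \<A> A (Cod \<A> g)"
      unfolding gkm using f2 obg by (simp add: hom_iff)
    finally obtain t where t: "\<langle>t : Cod \<A> c \<rightarrow> Cod \<A> g\<rangle>" "t \<cdot> c = g" using c'(3)[OF gg] by blast
    have "g \<cdot> k = t \<cdot> (c \<cdot> k)" using t c'(1) k'(1) comp_assoc[of k c t] by (simp add: hom_iff)
    also have "\<dots> = Zero \<A> ?K (Cod \<A> g)" unfolding k'(2) using t obs by (simp add: hom_iff)
    finally have gk: "g \<cdot> k = Zero \<A> ?K (Cod \<A> g)" .
    have "Dom \<A> (k \<cdot> m) = ?L" using kmh by (simp add: hom_iff)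
    then obtain s where s: "\<langle>s : ?K \<rightarrow> ?L\<rangle>" "(k \<cdot> m) \<cdot> s = k"
      using g'(3)[OF k'(1) gk] by metis
    have "k \<cdot> (m \<cdot> s) = k \<cdot> Id \<A> ?K" using s m'(1) k'(1) obs by (simp add: hom_iff)
    then have "m \<cdot> s = Id \<A> ?K"
      using mono_cancel[OF kernel_mono[OF k] k'(1), of "m \<cdot> s" ?K "Id \<A> ?K"] s m'(1) obs
      by (simp add: hom_iff)
    then show ?thesis using zero_if_zero_on_split_mono[OF kernel_mono[OF m] m'(1) s(1) _ u] m'(2) by blast
  qed
  have "u = v" if u: "\<langle>u : ?K \<rightarrow> X\<rangle>" and v: "\<langle>v : ?K \<rightarrow> X\<rangle>" and eq: "u \<cdot> f' = v \<cdot> f'" for u v X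
    using zero[OF sub_in_hom[OF u v]] sub_eq_zero_iff[OF u v] sub_self[of "v \<cdot> f'" A X]
      u v f' eq by (simp add: hom_iff)
  then show ?thesis using f' by (auto simp: is_epi_def hom_iff)
qed

text \<open>
  An element killed by \<open>g\<close> first lifts to the image of \<open>f\<close>, and from there to \<open>A\<close> because the
  corestriction of \<open>f\<close> to its image is epic.
\<close>

lemma exact_at_elements:
  assumes ex: "exact_at \<A> f g" and f: "\<langle>f : A \<rightarrow> B\<rangle>" and g: "\<langle>g : B \<rightarrow> C\<rangle>"
  shows exact_zero: "g \<cdot> f = Zero \<A> A C"
    and exact_lift: "projective \<A> P \<Longrightarrow> \<langle>y : P \<rightarrow> B\<rangle> \<Longrightarrow> g \<cdot> y = Zero \<A> P C \<Longrightarrow> \<exists>x. \<langle>x : P \<rightarrow> A\<rangle> \<and> f \<cdot> x = y"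
proof -
  obtain k c where c: "is_cokernel \<A> c f" and k: "is_kernel \<A> k c" and kg: "is_kernel \<A> k g"
    using ex by (auto simp: exact_at_def is_image_def)
  note c' = cokernel_props[OF c f]
  note k' = kernel_props[OF k c'(1)] and g' = kernel_props[OF kg g]
  have ob: "A \<in> Ob \<A>" "C \<in> Ob \<A>" using hom_Ob f g by auto
  obtain f' where f': "\<langle>f' : A \<rightarrow> Dom \<A> k\<rangle>" "k \<cdot> f' = f" using k'(3)[OF f c'(2)] by blast
  have "g \<cdot> f = (g \<cdot> k) \<cdot> f'" using f' k'(1) g by (simp add: hom_iff)
  also have "\<dots> = Zero \<A> A C" unfolding g'(2) using f' ob by (simp add: hom_iff)
  finally show "g \<cdot> f = Zero \<A> A C" .
  assume P: "projective \<A> P" and y: "\<langle>y : P \<rightarrow> B\<rangle>" and gy: "g \<cdot> y = Zero \<A> P C"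
  obtain y' where y': "\<langle>y' : P \<rightarrow> Dom \<A> k\<rangle>" "k \<cdot> y' = y" using g'(3)[OF y gy] by blast
  have "is_epi \<A> f'" using image_corestriction_epi[OF f c k f'] .
  then obtain x where x: "\<langle>x : P \<rightarrow> A\<rangle>" "f' \<cdot> x = y'" using projective_lift[OF P _ f'(1) y'(1)] by blast
  have "f \<cdot> x = y" using x f' y' k'(1) comp_assoc[of x f' k] by (simp add: hom_iff)
  then show "\<exists>x. \<langle>x : P \<rightarrow> A\<rangle> \<and> f \<cdot> x = y" using x by blast
qed

lemma exactI:
  assumes f: "\<langle>f : A \<rightarrow> B\<rangle>" and g: "\<langle>g : B \<rightarrow> C\<rangle>" and gf: "g \<cdot> f = Zero \<A> A C"
    and lift: "\<And>P y. projective \<A> P \<Longrightarrow> \<langle>y : P \<rightarrow> B\<rangle> \<Longrightarrow> g \<cdot> y = Zero \<A> P C \<Longrightarrow>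
      \<exists>x. \<langle>x : P \<rightarrow> A\<rangle> \<and> f \<cdot> x = y"
  shows "exact_at \<A> f g"
proof -
  obtain c where c: "is_cokernel \<A> c f" using f cokernels by (auto simp: hom_iff)
  note c' = cokernel_props[OF c f]
  note cc = c'(1)
  obtain k where k: "is_kernel \<A> k c" using cc kernels by (auto simp: hom_iff)
  note k' = kernel_props[OF k cc]
  note kk = k'(1)
  have ob: "C \<in> Ob \<A>" "Cod \<A> c \<in> Ob \<A>" "Dom \<A> k \<in> Ob \<A>" "A \<in> Ob \<A>" using hom_Ob g cc kk f by auto
  obtain g' where g': "\<langle>g' : Cod \<A> c \<rightarrow> C\<rangle>" "g' \<cdot> c = g" using c'(3)[OF g gf] by blast
  have "g \<cdot> k = g' \<cdot> (c \<cdot> k)" using g' cc kk comp_assoc[of k c g'] by (auto simp: hom_iff)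
  also have "\<dots> = Zero \<A> (Dom \<A> k) C" unfolding k'(2) using g' ob by (simp add: hom_iff)
  finally have gk: "g \<cdot> k = Zero \<A> (Dom \<A> k) C" .
  have "\<exists>v. \<langle>v : X \<rightarrow> Dom \<A> k\<rangle> \<and> k \<cdot> v = u" if u: "\<langle>u : X \<rightarrow> B\<rangle>" and gu: "g \<cdot> u = Zero \<A> X C" for X u
  proof -
    have "c \<cdot> u = Zero \<A> X (Cod \<A> c)"
    proof (rule zero_if_zero_on_elements)
      show "\<langle>c \<cdot> u : X \<rightarrow> Cod \<A> c\<rangle>" using cc u by (auto simp: hom_iff)
      fix P y assume P: "projective \<A> P" and y: "\<langle>y : P \<rightarrow> X\<rangle>"
      have uy: "\<langle>u \<cdot> y : P \<rightarrow> B\<rangle>" using u y by (auto simp: hom_iff)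
      have "g \<cdot> (u \<cdot> y) = Zero \<A> P C"
        using gu u y g ob comp_assoc[of y u g] by (auto simp: hom_iff)
      then obtain x where x: "\<langle>x : P \<rightarrow> A\<rangle>" "f \<cdot> x = u \<cdot> y" using lift[OF P uy] by blast
      have "(c \<cdot> u) \<cdot> y = (c \<cdot> f) \<cdot> x" using x u y cc f by (auto simp: hom_iff)
      also have "\<dots> = Zero \<A> P (Cod \<A> c)" unfolding c'(2) using x ob by (simp add: hom_iff)
      finally show "(c \<cdot> u) \<cdot> y = Zero \<A> P (Cod \<A> c)" .
    qed
    then show ?thesis using k'(3)[OF u] by blast
  qed
  then have "is_kernel \<A> k g" using kernelI[OF kernel_mono[OF k] kk g gk] by blast
  then show ?thesis using c k by (auto simp: exact_at_def is_image_def)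
qed

text \<open>
  Every epimorphism is the cokernel of some \<open>h\<close>, and whether \<open>u\<close> kills \<open>h\<close> can be tested on elements.
\<close>

lemma factor_through_epi:
  assumes g: "\<langle>g : B \<rightarrow> C\<rangle>" "is_epi \<A> g" and u: "\<langle>u : B \<rightarrow> X\<rangle>"
    and van: "\<And>P y. projective \<A> P \<Longrightarrow> \<langle>y : P \<rightarrow> B\<rangle> \<Longrightarrow> g \<cdot> y = Zero \<A> P C \<Longrightarrow> u \<cdot> y = Zero \<A> P X"
  obtains v where "\<langle>v : C \<rightarrow> X\<rangle>" "v \<cdot> g = u"
proof -
  obtain h where h: "is_cokernel \<A> g h" using epi_normal g by blast
  have hh: "\<langle>h : Dom \<A> h \<rightarrow> B\<rangle>" using h g by (auto simp: is_cokernel_def hom_iff)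
  note h' = cokernel_props[OF h hh]
  have ob: "X \<in> Ob \<A>" "C \<in> Ob \<A>" using hom_Ob u g by auto
  have "u \<cdot> h = Zero \<A> (Dom \<A> h) X"
  proof (rule zero_if_zero_on_elements)
    show "\<langle>u \<cdot> h : Dom \<A> h \<rightarrow> X\<rangle>" using u hh by (auto simp: hom_iff)
    fix P y assume P: "projective \<A> P" and y: "\<langle>y : P \<rightarrow> Dom \<A> h\<rangle>"
    have "g \<cdot> (h \<cdot> y) = (g \<cdot> h) \<cdot> y" using g hh y by (auto simp: hom_iff)
    also have "\<dots> = Zero \<A> P C" using h' g y ob by (auto simp: hom_iff)
    finally show "(u \<cdot> h) \<cdot> y = Zero \<A> P X" using van[OF P, of "h \<cdot> y"] u hh y by (auto simp: hom_iff)
  qed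
  then show ?thesis using that h'(3)[OF u] g by (auto simp: hom_iff)
qed

lemma factor_through_mono:
  assumes f: "\<langle>f : A \<rightarrow> B\<rangle>" "is_mono \<A> f" and u: "\<langle>u : X \<rightarrow> B\<rangle>"
    and lift: "\<And>P x. projective \<A> P \<Longrightarrow> \<langle>x : P \<rightarrow> X\<rangle> \<Longrightarrow> \<exists>a. \<langle>a : P \<rightarrow> A\<rangle> \<and> f \<cdot> a = u \<cdot> x"
  obtains v where "\<langle>v : X \<rightarrow> A\<rangle>" "f \<cdot> v = u"
proof -
  obtain h where h: "is_kernel \<A> f h" using mono_normal f by blast
  have hh: "\<langle>h : B \<rightarrow> Cod \<A> h\<rangle>" using h f by (auto simp: is_kernel_def hom_iff)
  note h' = kernel_props[OF h hh]
  have ob: "X \<in> Ob \<A>" "Cod \<A> h \<in> Ob \<A>" using hom_Ob u hh by auto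
  have "h \<cdot> u = Zero \<A> X (Cod \<A> h)"
  proof (rule zero_if_zero_on_elements)
    show "\<langle>h \<cdot> u : X \<rightarrow> Cod \<A> h\<rangle>" using u hh by (auto simp: hom_iff)
    fix P x assume P: "projective \<A> P" and x: "\<langle>x : P \<rightarrow> X\<rangle>"
    obtain a where a: "\<langle>a : P \<rightarrow> A\<rangle>" "f \<cdot> a = u \<cdot> x" using lift[OF P x] by blast
    have "(h \<cdot> u) \<cdot> x = (h \<cdot> f) \<cdot> a" using a u x hh f by (auto simp: hom_iff)
    also have "\<dots> = Zero \<A> P (Cod \<A> h)" using h' a f ob by (auto simp: hom_iff)
    finally show "(h \<cdot> u) \<cdot> x = Zero \<A> P (Cod \<A> h)" .
  qed
  then show ?thesis using that h'(3)[OF u] f by (auto simp: hom_iff)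
qed

end

section \<open>Short exact sequences, direct sums and pushouts\<close>

context preadditive_category
begin

lemma sub_cancel:
  assumes "\<langle>f : A \<rightarrow> B\<rangle>" "\<langle>g : A \<rightarrow> B\<rangle>" "\<langle>h : A \<rightarrow> B\<rangle>"
  shows "f \<ominus> g = f \<ominus> h \<longleftrightarrow> g = h"
proof
  assume "f \<ominus> g = f \<ominus> h"
  note n = neg_in_hom[OF assms(2)] neg_in_hom[OF assms(3)]
  have "neg g = neg h" using \<open>f \<ominus> g = f \<ominus> h\<close> add_cancel[OF assms(1) n] by (simp add: sub_def)
  then have "neg g \<oplus> g = neg g \<oplus> h"
    using add_neg[OF assms(2,2,2)] add_neg[OF assms(3,3,3)] add_commute[OF n(1) assms(2,2)]
      add_commute[OF n(2) assms(3,3)] by simp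
  then show "g = h" using add_cancel[OF n(1) assms(2,3)] by simp
qed simp

lemma finprod_in_hom:
  assumes "A \<in> Ob \<A>" "B \<in> Ob \<A>" "\<And>k. k \<in> I \<Longrightarrow> \<langle>f k : A \<rightarrow> B\<rangle>"
  shows "\<langle>finprod (Hom_group \<A> A B) f I : A \<rightarrow> B\<rangle>"
proof -
  interpret comm_group "Hom_group \<A> A B" using assms Hom_comm_group by blast
  show ?thesis using finprod_closed[of f I] assms by (auto simp: Hom_group_def)
qed

lemma finprod_insert_hom:
  assumes "finite I" "k \<notin> I" "\<And>l. l \<in> insert k I \<Longrightarrow> \<langle>f l : A \<rightarrow> B\<rangle>"
  shows "finprod (Hom_group \<A> A B) f (insert k I) = f k \<oplus> finprod (Hom_group \<A> A B) f I"
proof -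
  interpret comm_group "Hom_group \<A> A B"
    using assms(3)[of k] hom_Ob Hom_comm_group by blast
  show ?thesis using finprod_insert[of I k f] assms by (auto simp: Hom_group_def)
qed

lemma finprod_empty_hom:
  assumes "A \<in> Ob \<A>" "B \<in> Ob \<A>"
  shows "finprod (Hom_group \<A> A B) f {} = Zero \<A> A B"
proof -
  interpret comm_group "Hom_group \<A> A B" using assms Hom_comm_group by blast
  show ?thesis using finprod_empty[of f] by (simp add: Hom_group_def)
qed

lemma comp_finprod:
  assumes "finite I" "A \<in> Ob \<A>" and g: "\<langle>g : B \<rightarrow> C\<rangle>" and "\<And>k. k \<in> I \<Longrightarrow> \<langle>f k : A \<rightarrow> B\<rangle>"
  shows "g \<cdot> finprod (Hom_group \<A> A B) f I = finprod (Hom_group \<A> A C) (\<lambda>k. g \<cdot> f k) I"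
  using assms(1,4)
proof (induction I)
  case empty
  then show ?case using hom_Ob[OF g] g assms(2) by (simp add: finprod_empty_hom hom_iff)
next
  case (insert k I)
  have gf: "\<langle>g \<cdot> f l : A \<rightarrow> C\<rangle>" if "l \<in> insert k I" for l
    using Comp_closed[OF insert.prems[OF that] g] .
  have fk: "\<langle>f k : A \<rightarrow> B\<rangle>" using insert.prems[of k] by simp
  have s: "\<langle>finprod (Hom_group \<A> A B) f I : A \<rightarrow> B\<rangle>"
    using hom_Ob[OF g] assms(2) insert.prems by (intro finprod_in_hom) simp_all
  have "finprod (Hom_group \<A> A C) (\<lambda>k. g \<cdot> f k) (insert k I) =
      g \<cdot> f k \<oplus> finprod (Hom_group \<A> A C) (\<lambda>k. g \<cdot> f k) I"
    by (rule finprod_insert_hom[OF insert.hyps gf])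
  also have "\<dots> = g \<cdot> f k \<oplus> g \<cdot> finprod (Hom_group \<A> A B) f I"
    by (simp add: insert.IH[OF insert.prems])
  also have "\<dots> = g \<cdot> finprod (Hom_group \<A> A B) f (insert k I)"
    using finprod_insert_hom[OF insert(1,2), of f A B] insert.prems
    by (simp add: Comp_Plus_right[OF fk s g])
  finally show ?case by simp
qed

text \<open>
  The lifts \<open>h k\<close> of the components combine to \<open>\<Sum>k. h k \<cdot> \<pi> k\<close>.
\<close>

lemma direct_sum_lift:
  assumes S: "is_direct_sum \<A> I X S \<iota> \<pi>" and g: "\<langle>g : S \<rightarrow> Z\<rangle>" and p: "\<langle>p : Y \<rightarrow> Z\<rangle>"
    and "\<And>k. k \<in> I \<Longrightarrow> \<exists>h. \<langle>h : X k \<rightarrow> Y\<rangle> \<and> p \<cdot> h = g \<cdot> \<iota> k"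
  obtains h where "\<langle>h : S \<rightarrow> Y\<rangle>" "p \<cdot> h = g"
proof -
  obtain h where h: "\<And>k. k \<in> I \<Longrightarrow> \<langle>h k : X k \<rightarrow> Y\<rangle> \<and> p \<cdot> h k = g \<cdot> \<iota> k"
    using assms(4) by metis
  have I: "finite I" and SO: "S \<in> Ob \<A>"
    and \<iota>: "\<And>k. k \<in> I \<Longrightarrow> \<langle>\<iota> k : X k \<rightarrow> S\<rangle>" and \<pi>: "\<And>k. k \<in> I \<Longrightarrow> \<langle>\<pi> k : S \<rightarrow> X k\<rangle>"
    and sum: "finprod (Hom_group \<A> S S) (\<lambda>k. \<iota> k \<cdot> \<pi> k) I = Id \<A> S"
    using S by (auto simp: is_direct_sum_def)
  have hp: "\<langle>h k \<cdot> \<pi> k : S \<rightarrow> Y\<rangle>" "\<langle>\<iota> k \<cdot> \<pi> k : S \<rightarrow> S\<rangle>"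
      "p \<cdot> (h k \<cdot> \<pi> k) = g \<cdot> (\<iota> k \<cdot> \<pi> k)" if "k \<in> I" for k
    using h[OF that] \<pi>[OF that] \<iota>[OF that] comp_assoc[of "\<pi> k" "h k" p] comp_assoc[of "\<pi> k" "\<iota> k" g] p g
    by (auto simp: hom_iff)
  have gip: "\<langle>g \<cdot> (\<iota> k \<cdot> \<pi> k) : S \<rightarrow> Z\<rangle>" if "k \<in> I" for k
    using Comp_closed[OF hp(2)[OF that] g] .
  interpret Z: comm_group "Hom_group \<A> S Z" using SO hom_Ob[OF g] Hom_comm_group by blast
  let ?h = "finprod (Hom_group \<A> S Y) (\<lambda>k. h k \<cdot> \<pi> k) I"
  have "p \<cdot> ?h = finprod (Hom_group \<A> S Z) (\<lambda>k. p \<cdot> (h k \<cdot> \<pi> k)) I"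
    using hp(1) by (intro comp_finprod[OF I SO p])
  also have "\<dots> = finprod (Hom_group \<A> S Z) (\<lambda>k. g \<cdot> (\<iota> k \<cdot> \<pi> k)) I"
    using hp(3) gip by (intro Z.finprod_cong) (simp_all add: Hom_group_def simp_implies_def)
  also have "\<dots> = g \<cdot> Id \<A> S"
    using comp_finprod[OF I SO g, of "\<lambda>k. \<iota> k \<cdot> \<pi> k"] hp(2) sum by simp
  also have "\<dots> = g" using g by (simp add: hom_iff)
  finally have "p \<cdot> ?h = g" .
  moreover have "\<langle>?h : S \<rightarrow> Y\<rangle>" using hp(1) hom_Ob[OF p] SO by (intro finprod_in_hom) auto
  ultimately show ?thesis using that by blast
qed

lemma finprod_pair:
  assumes "\<langle>f 0 : A \<rightarrow> B\<rangle>" "\<langle>f (Suc 0) : A \<rightarrow> B\<rangle>"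
  shows "finprod (Hom_group \<A> A B) f {0, Suc 0} = f 0 \<oplus> f (Suc 0)"
proof -
  have O: "A \<in> Ob \<A>" "B \<in> Ob \<A>" using hom_Ob assms by auto
  have "finprod (Hom_group \<A> A B) f {Suc 0} = f (Suc 0)"
    using finprod_insert_hom[of "{}" "Suc 0" f A B] add_zero[OF assms(2)] assms
    by (simp add: finprod_empty_hom[OF O])
  then show ?thesis using finprod_insert_hom[of "{Suc 0}" 0 f A B] assms by auto
qed

end

context abelian_category
begin

lemma biproduct:
  assumes "A \<in> Ob \<A>" "B \<in> Ob \<A>"
  obtains S i j p q where "\<langle>i : A \<rightarrow> S\<rangle>" "\<langle>j : B \<rightarrow> S\<rangle>" "\<langle>p : S \<rightarrow> A\<rangle>" "\<langle>q : S \<rightarrow> B\<rangle>"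
    "p \<cdot> i = Id \<A> A" "q \<cdot> j = Id \<A> B" "p \<cdot> j = Zero \<A> B A" "q \<cdot> i = Zero \<A> A B"
    "i \<cdot> p \<oplus> j \<cdot> q = Id \<A> S"
proof -
  let ?X = "\<lambda>n::nat. if n = 0 then A else B"
  obtain S \<iota> \<pi> where S: "is_direct_sum \<A> {0, Suc 0} ?X S \<iota> \<pi>"
    using finite_direct_sums[of "{0, Suc 0}" ?X] assms by auto
  have h: "\<langle>\<iota> 0 : A \<rightarrow> S\<rangle>" "\<langle>\<iota> (Suc 0) : B \<rightarrow> S\<rangle>" "\<langle>\<pi> 0 : S \<rightarrow> A\<rangle>" "\<langle>\<pi> (Suc 0) : S \<rightarrow> B\<rangle>"
    "\<pi> 0 \<cdot> \<iota> 0 = Id \<A> A" "\<pi> (Suc 0) \<cdot> \<iota> (Suc 0) = Id \<A> B"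
    "\<pi> 0 \<cdot> \<iota> (Suc 0) = Zero \<A> B A" "\<pi> (Suc 0) \<cdot> \<iota> 0 = Zero \<A> A B"
    "finprod (Hom_group \<A> S S) (\<lambda>k. \<iota> k \<cdot> \<pi> k) {0, Suc 0} = Id \<A> S"
    using S unfolding is_direct_sum_def by auto
  have "\<iota> 0 \<cdot> \<pi> 0 \<oplus> \<iota> (Suc 0) \<cdot> \<pi> (Suc 0) = Id \<A> S"
    using finprod_pair[of "\<lambda>k. \<iota> k \<cdot> \<pi> k" S S] Comp_closed[OF h(3,1)] Comp_closed[OF h(4,2)] h(9) by simp
  then show ?thesis using that[of "\<iota> 0" S "\<iota> (Suc 0)" "\<pi> 0" "\<pi> (Suc 0)"] h by blast
qed

end

context abelian_category_enough_projectives
begin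

lemma sesD:
  assumes "short_exact_seq \<A> A f B g C"
  shows "\<langle>f : A \<rightarrow> B\<rangle>" "\<langle>g : B \<rightarrow> C\<rangle>" "is_mono \<A> f" "is_epi \<A> g" "exact_at \<A> f g" "g \<cdot> f = Zero \<A> A C"
  using assms exact_zero by (auto simp: short_exact_seq_def)

lemma sesI:
  assumes f: "\<langle>f : A \<rightarrow> B\<rangle>" "is_mono \<A> f" and g: "\<langle>g : B \<rightarrow> C\<rangle>" "is_epi \<A> g" and gf: "g \<cdot> f = Zero \<A> A C"
    and "\<And>P y. projective \<A> P \<Longrightarrow> \<langle>y : P \<rightarrow> B\<rangle> \<Longrightarrow> g \<cdot> y = Zero \<A> P C \<Longrightarrow>
      \<exists>x. \<langle>x : P \<rightarrow> A\<rangle> \<and> f \<cdot> x = y"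
  shows "short_exact_seq \<A> A f B g C"
  using assms exactI[OF f(1) g(1) gf] by (auto simp: short_exact_seq_def)

lemma ses_lift:
  assumes s: "short_exact_seq \<A> A f B g C" and u: "\<langle>u : X \<rightarrow> B\<rangle>" and gu: "g \<cdot> u = Zero \<A> X C"
  obtains v where "\<langle>v : X \<rightarrow> A\<rangle>" "f \<cdot> v = u"
proof (rule factor_through_mono[OF sesD(1)[OF s] sesD(3)[OF s] u])
  note s' = sesD[OF s]
  fix P x assume P: "projective \<A> P" and x: "\<langle>x : P \<rightarrow> X\<rangle>"
  have "g \<cdot> (u \<cdot> x) = Zero \<A> P C"
    using comp_through[OF gu u s'(2) x] x hom_Ob[OF s'(2)] by (simp add: hom_iff)
  then show "\<exists>a. \<langle>a : P \<rightarrow> A\<rangle> \<and> f \<cdot> a = u \<cdot> x"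
    using exact_lift[OF s'(5,1,2) P, of "u \<cdot> x"] Comp_closed[OF x u] by blast
qed (rule that)

lemma ses_extend:
  assumes s: "short_exact_seq \<A> A f B g C" and u: "\<langle>u : B \<rightarrow> X\<rangle>" and uf: "u \<cdot> f = Zero \<A> A X"
  obtains v where "\<langle>v : C \<rightarrow> X\<rangle>" "v \<cdot> g = u"
proof (rule factor_through_epi[OF sesD(2)[OF s] sesD(4)[OF s] u])
  note s' = sesD[OF s]
  fix P y assume P: "projective \<A> P" and y: "\<langle>y : P \<rightarrow> B\<rangle>" and gy: "g \<cdot> y = Zero \<A> P C"
  obtain x where x: "\<langle>x : P \<rightarrow> A\<rangle>" "f \<cdot> x = y" using exact_lift[OF s'(5,1,2) P y gy] by blast
  show "u \<cdot> y = Zero \<A> P X"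
    using comp_through[OF uf s'(1) u x(1)] x hom_Ob[OF u] by (simp add: hom_iff)
qed (rule that)

lemma ses_of_epi:
  assumes g: "\<langle>g : B \<rightarrow> C\<rangle>" "is_epi \<A> g"
  obtains A f where "short_exact_seq \<A> A f B g C"
proof -
  obtain k where k: "is_kernel \<A> k g" using g kernels by (auto simp: hom_iff)
  note k' = kernel_props[OF k g(1)]
  show ?thesis using sesI[OF k'(1) kernel_mono[OF k] g k'(2)] k'(3) that by blast
qed

lemma ses_of_mono:
  assumes f: "\<langle>f : A \<rightarrow> B\<rangle>" "is_mono \<A> f"
  obtains C g where "short_exact_seq \<A> A f B g C"
proof -
  obtain c where c: "is_cokernel \<A> c f" using f cokernels by (auto simp: hom_iff)
  note c' = cokernel_props[OF c f(1)]
  obtain k where k: "is_kernel \<A> k c" using c'(1) kernels by (auto simp: hom_iff)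
  have "exact_at \<A> f c" using c k by (auto simp: exact_at_def is_image_def)
  then show ?thesis using f c'(1) cokernel_epi[OF c] that by (auto simp: short_exact_seq_def)
qed

lemma image_factorisation:
  assumes f: "\<langle>f : A \<rightarrow> B\<rangle>"
  obtains I p j where "\<langle>p : A \<rightarrow> I\<rangle>" "is_epi \<A> p" "\<langle>j : I \<rightarrow> B\<rangle>" "is_mono \<A> j" "j \<cdot> p = f"
proof -
  obtain c where c: "is_cokernel \<A> c f" using f cokernels by (auto simp: hom_iff)
  note c' = cokernel_props[OF c f]
  obtain k where k: "is_kernel \<A> k c" using c'(1) kernels by (auto simp: hom_iff)
  note k' = kernel_props[OF k c'(1)]
  obtain p where p: "\<langle>p : A \<rightarrow> Dom \<A> k\<rangle>" "k \<cdot> p = f" using k'(3)[OF f c'(2)] by blast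
  show ?thesis using that[OF p(1) _ k'(1) kernel_mono[OF k] p(2)] image_corestriction_epi[OF f c k p] by blast
qed

lemma isomorphicI:
  assumes "\<langle>f : A \<rightarrow> B\<rangle>" "\<langle>g : B \<rightarrow> A\<rangle>" "g \<cdot> f = Id \<A> A" "f \<cdot> g = Id \<A> B"
  shows "isomorphic \<A> A B"
proof -
  have "is_iso \<A> f" unfolding is_iso_def
    using assms by (intro conjI bexI[of _ g]) (simp_all add: hom_iff)
  then show ?thesis using assms(1) unfolding isomorphic_def by blast
qed

lemma cokernel_ses:
  assumes s: "short_exact_seq \<A> A f B g C" and s': "short_exact_seq \<A> A f B g' C'"
  shows "isomorphic \<A> C C'"
proof -
  note h = sesD[OF s] and h' = sesD[OF s']
  obtain u where u: "\<langle>u : C \<rightarrow> C'\<rangle>" "u \<cdot> g = g'" using ses_extend[OF s h'(2,6)] by blast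
  obtain v where v: "\<langle>v : C' \<rightarrow> C\<rangle>" "v \<cdot> g' = g" using ses_extend[OF s' h(2,6)] by blast
  have "(v \<cdot> u) \<cdot> g = Id \<A> C \<cdot> g" "(u \<cdot> v) \<cdot> g' = Id \<A> C' \<cdot> g'"
    using u v h h' by (auto simp: hom_iff)
  then have "v \<cdot> u = Id \<A> C" "u \<cdot> v = Id \<A> C'"
    using epi_cancel[OF h(4,2), of "v \<cdot> u" C "Id \<A> C"] epi_cancel[OF h'(4,2), of "u \<cdot> v" C' "Id \<A> C'"]
      u v hom_Ob[OF u(1)] by (auto simp: hom_iff)
  then show ?thesis using isomorphicI[OF u(1) v(1)] by blast
qed

lemma isoD:
  assumes "isomorphic \<A> A B"
  obtains f g where "\<langle>f : A \<rightarrow> B\<rangle>" "\<langle>g : B \<rightarrow> A\<rangle>" "g \<cdot> f = Id \<A> A" "f \<cdot> g = Id \<A> B"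
  using assms by (auto simp: isomorphic_def is_iso_def hom_iff)

lemma epi_of_section:
  assumes "\<langle>f : A \<rightarrow> B\<rangle>" "\<langle>g : B \<rightarrow> A\<rangle>" "f \<cdot> g = Id \<A> B"
  shows "is_epi \<A> f"
proof (rule epiI[OF assms(1)])
  fix P y assume "\<langle>y : P \<rightarrow> B\<rangle>"
  then show "\<exists>x. \<langle>x : P \<rightarrow> A\<rangle> \<and> f \<cdot> x = y"
    using assms comp_through[OF assms(3,2,1)] by (intro exI[of _ "g \<cdot> y"]) (auto simp: hom_iff)
qed

lemma comp_epi:
  assumes "is_epi \<A> f" "is_epi \<A> g" "\<langle>f : A \<rightarrow> B\<rangle>" "\<langle>g : B \<rightarrow> C\<rangle>"
  shows "is_epi \<A> (g \<cdot> f)"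
proof (rule epiI)
  show "\<langle>g \<cdot> f : A \<rightarrow> C\<rangle>" using assms by (simp add: hom_iff)
  fix P y assume P: "projective \<A> P" and y: "\<langle>y : P \<rightarrow> C\<rangle>"
  obtain z where z: "\<langle>z : P \<rightarrow> B\<rangle>" "g \<cdot> z = y" using projective_lift[OF P assms(2,4) y] by blast
  obtain x where x: "\<langle>x : P \<rightarrow> A\<rangle>" "f \<cdot> x = z" using projective_lift[OF P assms(1,3) z(1)] by blast
  show "\<exists>x. \<langle>x : P \<rightarrow> A\<rangle> \<and> (g \<cdot> f) \<cdot> x = y"
    using x z assms by (intro exI[of _ x]) (auto simp: hom_iff)
qed

lemma epi_of_comp:
  assumes "is_epi \<A> (g \<cdot> f)" "\<langle>f : A \<rightarrow> B\<rangle>" "\<langle>g : B \<rightarrow> C\<rangle>"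
  shows "is_epi \<A> g"
proof (rule epiI[OF assms(3)])
  fix P y assume P: "projective \<A> P" and y: "\<langle>y : P \<rightarrow> C\<rangle>"
  obtain x where x: "\<langle>x : P \<rightarrow> A\<rangle>" "(g \<cdot> f) \<cdot> x = y"
    using projective_lift[OF P assms(1) Comp_closed[OF assms(2,3)] y] by blast
  show "\<exists>x. \<langle>x : P \<rightarrow> B\<rangle> \<and> g \<cdot> x = y"
    using x assms by (intro exI[of _ "f \<cdot> x"]) (auto simp: hom_iff)
qed

text \<open>
  The projection to \<open>K\<close> is obtained by lifting \<open>Id - t \<cdot> f\<close>, which \<open>f\<close> kills, through \<open>k\<close>.
\<close>

lemma split_ses_direct_sum:
  assumes s: "short_exact_seq \<A> K k S f A" and t: "\<langle>t : A \<rightarrow> S\<rangle>" "f \<cdot> t = Id \<A> A"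
  obtains \<iota> \<pi> where "is_direct_sum \<A> {0, Suc 0} (\<lambda>n. if n = 0 then A else K) S \<iota> \<pi>"
proof -
  note h = sesD[OF s]
  have ob: "K \<in> Ob \<A>" "S \<in> Ob \<A>" "A \<in> Ob \<A>" using hom_Ob h by auto
  have tf: "\<langle>t \<cdot> f : S \<rightarrow> S\<rangle>" and I: "\<langle>Id \<A> S : S \<rightarrow> S\<rangle>" using t h ob by (auto simp: hom_iff)
  have "f \<cdot> (Id \<A> S \<ominus> t \<cdot> f) = f \<ominus> (f \<cdot> t) \<cdot> f"
    using h(2) t(1) tf I by (simp add: hom_iff)
  also have "\<dots> = Zero \<A> S A" unfolding t(2) using sub_self[OF h(2)] h ob by (simp add: hom_iff)
  finally obtain r where r: "\<langle>r : S \<rightarrow> K\<rangle>" "k \<cdot> r = Id \<A> S \<ominus> t \<cdot> f"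
    using ses_lift[OF s sub_in_hom[OF I tf]] by blast
  have rk: "r \<cdot> k = Id \<A> K"
  proof (rule mono_cancel[OF h(3,1), of _ K])
    show "\<langle>r \<cdot> k : K \<rightarrow> K\<rangle>" "\<langle>Id \<A> K : K \<rightarrow> K\<rangle>" using r h ob by (auto simp: hom_iff)
    have "k \<cdot> (r \<cdot> k) = (Id \<A> S \<ominus> t \<cdot> f) \<cdot> k" using r h comp_assoc[of k r k] by (simp add: hom_iff)
    also have "\<dots> = k \<ominus> t \<cdot> (f \<cdot> k)" using h t tf I by (simp add: hom_iff)
    also have "\<dots> = k" unfolding h(6) using sub_zero[OF h(1)] t ob by (simp add: hom_iff)
    finally show "k \<cdot> (r \<cdot> k) = k \<cdot> Id \<A> K" using h by (simp add: hom_iff)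
  qed
  have rt: "r \<cdot> t = Zero \<A> A K"
  proof (rule mono_zero[OF h(3,1)])
    have "k \<cdot> (r \<cdot> t) = (Id \<A> S \<ominus> t \<cdot> f) \<cdot> t" using r h t comp_assoc[of t r k] by (simp add: hom_iff)
    also have "\<dots> = t \<ominus> t \<cdot> (f \<cdot> t)" using h t tf I by (simp add: hom_iff)
    also have "\<dots> = Zero \<A> A S" unfolding t(2) using sub_self[OF t(1)] t by (simp add: hom_iff)
    finally show "k \<cdot> (r \<cdot> t) = Zero \<A> A S" .
  qed (rule Comp_closed[OF t(1) r(1)])
  let ?\<iota> = "\<lambda>n::nat. if n = 0 then t else k" and ?\<pi> = "\<lambda>n::nat. if n = 0 then f else r"
  have kr: "\<langle>k \<cdot> r : S \<rightarrow> S\<rangle>" using Comp_closed[OF r(1) h(1)] .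
  have "finprod (Hom_group \<A> S S) (\<lambda>n. ?\<iota> n \<cdot> ?\<pi> n) {0, Suc 0} = t \<cdot> f \<oplus> k \<cdot> r"
    using finprod_pair[of "\<lambda>n. ?\<iota> n \<cdot> ?\<pi> n" S S] tf kr by simp
  also have "\<dots> = Id \<A> S"
    using r(2) sub_add[OF I tf] add_commute[OF tf kr kr] by simp
  finally have "is_direct_sum \<A> {0, Suc 0} (\<lambda>n. if n = 0 then A else K) S ?\<iota> ?\<pi>"
    unfolding is_direct_sum_def using ob h t r rk rt by auto
  then show ?thesis using that by blast
qed

text \<open>
  The pushout of \<open>k\<close> and \<open>f\<close> is the cokernel of \<open>(k, -f) : K \<rightarrow> X \<oplus> Y\<close>. Exactness of the new row rests on
  the description of its elements: they have the form \<open>e \<cdot> x + i \<cdot> y\<close>, and \<open>e \<cdot> x = i \<cdot> y\<close> only if \<open>x\<close> and \<open>y\<close>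
  come from a common element of \<open>K\<close> (the step \<open>kerE\<close>).
\<close>

lemma pushout_ses:
  assumes s: "short_exact_seq \<A> K k X c A" and f: "\<langle>f : K \<rightarrow> Y\<rangle>"
  obtains E i e c' where "short_exact_seq \<A> Y i E c' A" "\<langle>e : X \<rightarrow> E\<rangle>" "e \<cdot> k = i \<cdot> f" "c' \<cdot> e = c"
proof -
  note h = sesD[OF s]
  have ob: "K \<in> Ob \<A>" "X \<in> Ob \<A>" "A \<in> Ob \<A>" "Y \<in> Ob \<A>" using hom_Ob h f by auto
  obtain S i1 i2 p1 p2 where S: "\<langle>i1 : X \<rightarrow> S\<rangle>" "\<langle>i2 : Y \<rightarrow> S\<rangle>" "\<langle>p1 : S \<rightarrow> X\<rangle>" "\<langle>p2 : S \<rightarrow> Y\<rangle>"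
    "p1 \<cdot> i1 = Id \<A> X" "p2 \<cdot> i2 = Id \<A> Y" "p1 \<cdot> i2 = Zero \<A> Y X" "p2 \<cdot> i1 = Zero \<A> X Y"
    "i1 \<cdot> p1 \<oplus> i2 \<cdot> p2 = Id \<A> S" using biproduct[OF ob(2,4)] by metis
  have P: "p1 \<cdot> (i1 \<cdot> x \<ominus> i2 \<cdot> y) = x" "p2 \<cdot> (i1 \<cdot> x \<ominus> i2 \<cdot> y) = Zero \<A> W Y \<ominus> y"
    "\<langle>i1 \<cdot> x \<ominus> i2 \<cdot> y : W \<rightarrow> S\<rangle>"
    if x: "\<langle>x : W \<rightarrow> X\<rangle>" and y: "\<langle>y : W \<rightarrow> Y\<rangle>" for W x y
    using comp_through[OF S(5,1,3) x] comp_through[OF S(8,1,4) x] comp_through[OF S(7,2,3) y]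
      comp_through[OF S(6,2,4) y] S(1-4) x y ob hom_Ob[OF x] sub_zero[OF x]
    by (auto simp: hom_iff)
  let ?j = "i1 \<cdot> k \<ominus> i2 \<cdot> f"
  note j = P[OF h(1) f]
  have jm: "is_mono \<A> ?j"
  proof (rule monoI[OF j(3)])
    fix Q x assume x: "\<langle>x : Q \<rightarrow> K\<rangle>" and z: "?j \<cdot> x = Zero \<A> Q S"
    have "k \<cdot> x = p1 \<cdot> (?j \<cdot> x)" using comp_through[OF j(1,3) S(3) x] by simp
    also have "\<dots> = Zero \<A> Q X" unfolding z using S(3) hom_Ob[OF x] by (simp add: hom_iff)
    finally show "x = Zero \<A> Q K" using mono_zero[OF h(3,1) x] by blast
  qed
  obtain E q where q: "short_exact_seq \<A> K ?j S q E" using ses_of_mono[OF j(3) jm] by blast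
  note q' = sesD[OF q]
  define e where "e = q \<cdot> i1" define i where "i = q \<cdot> i2"
  have e: "\<langle>e : X \<rightarrow> E\<rangle>" and i: "\<langle>i : Y \<rightarrow> E\<rangle>"
    using q' S unfolding e_def i_def by (auto simp: hom_iff)
  have ob': "E \<in> Ob \<A>" using hom_Ob[OF e] by simp
  have qd: "q \<cdot> (i1 \<cdot> x \<ominus> i2 \<cdot> y) = e \<cdot> x \<ominus> i \<cdot> y"
    if x: "\<langle>x : W \<rightarrow> X\<rangle>" and y: "\<langle>y : W \<rightarrow> Y\<rangle>" for W x y
    using x y S(1,2) q'(2) unfolding e_def i_def by (simp add: hom_iff)
  have kerE: "\<exists>w. \<langle>w : Q \<rightarrow> K\<rangle> \<and> k \<cdot> w = x \<and> f \<cdot> w = y"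
    if x: "\<langle>x : Q \<rightarrow> X\<rangle>" and y: "\<langle>y : Q \<rightarrow> Y\<rangle>" and eq: "e \<cdot> x = i \<cdot> y" for Q x y
  proof -
    have "\<langle>i \<cdot> y : Q \<rightarrow> E\<rangle>" using i y by (auto simp: hom_iff)
    then have "q \<cdot> (i1 \<cdot> x \<ominus> i2 \<cdot> y) = Zero \<A> Q E" using qd[OF x y] eq sub_self by simp
    then obtain w where w: "\<langle>w : Q \<rightarrow> K\<rangle>" "?j \<cdot> w = i1 \<cdot> x \<ominus> i2 \<cdot> y"
      using ses_lift[OF q P(3)[OF x y]] by blast
    have fw: "\<langle>f \<cdot> w : Q \<rightarrow> Y\<rangle>" using f w by (auto simp: hom_iff)
    have z: "\<langle>Zero \<A> Q Y : Q \<rightarrow> Y\<rangle>" using zero_in_hom hom_Ob[OF y] by blast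
    have "k \<cdot> w = x"
      using comp_through[OF j(1,3) S(3) w(1)] P(1)[OF x y] w(2) by simp
    moreover have "Zero \<A> Q Y \<ominus> y = Zero \<A> Q Y \<ominus> f \<cdot> w"
      using comp_through[OF j(2,3) S(4) w(1)] P(2)[OF x y] w f ob by (simp add: hom_iff)
    then have "f \<cdot> w = y" using sub_cancel[OF z y fw] by simp
    ultimately show ?thesis using w by blast
  qed
  have ekif: "e \<cdot> k = i \<cdot> f"
    using qd[OF h(1) f] q'(6) sub_eq_zero_iff[OF Comp_closed[OF h(1) e] Comp_closed[OF f i]] by simp
  have cp: "\<langle>c \<cdot> p1 : S \<rightarrow> A\<rangle>" using h S by (auto simp: hom_iff)
  have "(c \<cdot> p1) \<cdot> ?j = c \<cdot> k"
    using comp_assoc[of ?j p1 c] j(1,3) S(3) h(2) by (simp add: hom_iff)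
  then obtain c' where c': "\<langle>c' : E \<rightarrow> A\<rangle>" "c' \<cdot> q = c \<cdot> p1" using ses_extend[OF q cp] h(6) by metis
  have c'e: "c' \<cdot> e = c"
  proof -
    have "c' \<cdot> e = (c' \<cdot> q) \<cdot> i1" unfolding e_def using c'(1) q'(2) S(1) by (simp add: hom_iff)
    also have "\<dots> = c \<cdot> (p1 \<cdot> i1)" unfolding c'(2) using h(2) S(1,3) by (simp add: hom_iff)
    finally show ?thesis using S(5) h(2) by (simp add: hom_iff)
  qed
  have c'i: "c' \<cdot> i = Zero \<A> Y A"
  proof -
    have "c' \<cdot> i = (c' \<cdot> q) \<cdot> i2" unfolding i_def using c'(1) q'(2) S(2) by (simp add: hom_iff)
    also have "\<dots> = c \<cdot> (p1 \<cdot> i2)" unfolding c'(2) using h(2) S(2,3) by (simp add: hom_iff)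
    finally show ?thesis using S(7) h(2) ob by (simp add: hom_iff)
  qed
  have im: "is_mono \<A> i"
  proof (rule monoI[OF i])
    fix Q y assume y: "\<langle>y : Q \<rightarrow> Y\<rangle>" and iy: "i \<cdot> y = Zero \<A> Q E"
    have Qo: "Q \<in> Ob \<A>" using hom_Ob[OF y] by simp
    have "e \<cdot> Zero \<A> Q X = i \<cdot> y" using iy e Qo by (simp add: hom_iff)
    then obtain w where w: "\<langle>w : Q \<rightarrow> K\<rangle>" "k \<cdot> w = Zero \<A> Q X" "f \<cdot> w = y"
      using kerE[OF zero_in_hom[OF Qo ob(2)] y] by blast
    then show "y = Zero \<A> Q Y" using mono_zero[OF h(3,1) w(1,2)] f Qo by (simp add: hom_iff)
  qed
  have ce: "is_epi \<A> c'" using epi_of_comp[OF _ e c'(1)] c'e h(4) by simp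
  have "short_exact_seq \<A> Y i E c' A"
  proof (rule sesI[OF i im c'(1) ce c'i])
    fix Q z assume Q: "projective \<A> Q" and z: "\<langle>z : Q \<rightarrow> E\<rangle>" and cz: "c' \<cdot> z = Zero \<A> Q A"
    obtain s where s': "\<langle>s : Q \<rightarrow> S\<rangle>" "q \<cdot> s = z" using projective_lift[OF Q q'(4,2) z] by blast
    have x: "\<langle>p1 \<cdot> s : Q \<rightarrow> X\<rangle>" and y: "\<langle>p2 \<cdot> s : Q \<rightarrow> Y\<rangle>" using S s' by (auto simp: hom_iff)
    have "q \<cdot> ((i1 \<cdot> p1 \<oplus> i2 \<cdot> p2) \<cdot> s) = e \<cdot> (p1 \<cdot> s) \<oplus> i \<cdot> (p2 \<cdot> s)"
      using S(1-4) s'(1) q'(2) unfolding e_def i_def by (simp add: hom_iff)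
    then have zd: "z = e \<cdot> (p1 \<cdot> s) \<oplus> i \<cdot> (p2 \<cdot> s)"
      unfolding S(9) using s' by (simp add: hom_iff)
    have "c \<cdot> (p1 \<cdot> s) = (c' \<cdot> q) \<cdot> s" unfolding c'(2) using S(3) s'(1) h(2) by (simp add: hom_iff)
    also have "\<dots> = Zero \<A> Q A" using cz s' c'(1) q'(2) by (simp add: hom_iff)
    finally obtain w where w: "\<langle>w : Q \<rightarrow> K\<rangle>" "k \<cdot> w = p1 \<cdot> s" using ses_lift[OF s x] by blast
    have "e \<cdot> (p1 \<cdot> s) = i \<cdot> (f \<cdot> w)"
      using comp_through[OF ekif h(1) e w(1)] w(2) f i w(1) by (simp add: hom_iff)
    then have "i \<cdot> (f \<cdot> w \<oplus> p2 \<cdot> s) = z" using zd i f w(1) y by (simp add: hom_iff)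
    moreover have "\<langle>f \<cdot> w \<oplus> p2 \<cdot> s : Q \<rightarrow> Y\<rangle>" using f w(1) y by (simp add: hom_iff)
    ultimately show "\<exists>x. \<langle>x : Q \<rightarrow> Y\<rangle> \<and> i \<cdot> x = z" by blast
  qed
  then show ?thesis using that e ekif c'e by blast
qed

end

section \<open>Vanishing of Ext\<close>

context abelian_category_enough_projectives
begin

lemma ex_projective_resolution:
  assumes A: "A \<in> Ob \<A>"
  shows "\<exists>P d. projective_resolution \<A> A P d"
proof -
  obtain P0 e where P0: "projective \<A> P0" "\<langle>e : P0 \<rightarrow> A\<rangle>" "is_epi \<A> e" using projective_presentation[OF A] by blast
  have step: "\<exists>Q' d'. projective \<A> Q' \<and> \<langle>d' : Q' \<rightarrow> Q\<rangle> \<and> exact_at \<A> d' d" if d: "\<langle>d : Q \<rightarrow> C\<rangle>" for Q d C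
  proof -
    obtain k where k: "is_kernel \<A> k d" using d kernels by (auto simp: hom_iff)
    note k' = kernel_props[OF k d]
    obtain Q' q where q: "projective \<A> Q'" "\<langle>q : Q' \<rightarrow> Dom \<A> k\<rangle>" "is_epi \<A> q"
      using projective_presentation hom_Ob[OF k'(1)] by blast
    have kq: "\<langle>k \<cdot> q : Q' \<rightarrow> Q\<rangle>" using Comp_closed[OF q(2) k'(1)] .
    have "exact_at \<A> (k \<cdot> q) d"
    proof (rule exactI[OF kq d])
      show "d \<cdot> (k \<cdot> q) = Zero \<A> Q' C"
        using comp_through[OF k'(2,1) d q(2)] q(2) hom_Ob[OF d] by (simp add: hom_iff)
      fix R y assume R: "projective \<A> R" and y: "\<langle>y : R \<rightarrow> Q\<rangle>" "d \<cdot> y = Zero \<A> R C"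
      obtain v where v: "\<langle>v : R \<rightarrow> Dom \<A> k\<rangle>" "k \<cdot> v = y" using k'(3)[OF y] by blast
      obtain x where x: "\<langle>x : R \<rightarrow> Q'\<rangle>" "q \<cdot> x = v" using projective_lift[OF R q(3,2) v(1)] by blast
      show "\<exists>x. \<langle>x : R \<rightarrow> Q'\<rangle> \<and> (k \<cdot> q) \<cdot> x = y"
        using x v(2) q(2) k'(1) by (intro exI[of _ x]) (simp add: hom_iff)
    qed
    then show ?thesis using q kq by blast
  qed
  let ?P = "\<lambda>(n::nat) x. projective \<A> (fst x) \<and> \<langle>snd x : fst x \<rightarrow> Cod \<A> (snd x)\<rangle> \<and>
    (n = 0 \<longrightarrow> Cod \<A> (snd x) = A \<and> is_epi \<A> (snd x))"
  let ?Q = "\<lambda>n::nat. \<lambda>x y. \<langle>snd y : fst y \<rightarrow> fst x\<rangle> \<and> exact_at \<A> (snd y) (snd x)"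
  have "\<exists>f. \<forall>n. ?P n (f n) \<and> ?Q n (f n) (f (Suc n))"
  proof (rule dependent_nat_choice)
    show "\<exists>x. ?P 0 x" using P0 by (intro exI[of _ "(P0, e)"]) (auto simp: hom_iff)
    fix x n assume "?P n x"
    then obtain Q' d' where Q': "projective \<A> Q'" "\<langle>d' : Q' \<rightarrow> fst x\<rangle>" "exact_at \<A> d' (snd x)"
      using step by blast
    then show "\<exists>y. ?P (Suc n) y \<and> ?Q n x y"
      by (intro exI[of _ "(Q', d')"]) (auto simp: hom_iff)
  qed
  then obtain f where f: "\<And>n. ?P n (f n) \<and> ?Q n (f n) (f (Suc n))" by blast
  have "projective_resolution \<A> A (\<lambda>n. fst (f n)) (\<lambda>n. snd (f n))"
    unfolding projective_resolution_def using f f[of 0] by auto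
  then show ?thesis by blast
qed

lemma resolutionD:
  assumes "projective_resolution \<A> A P d"
  shows "projective \<A> (P n)" "\<langle>d 0 : P 0 \<rightarrow> A\<rangle>" "is_epi \<A> (d 0)"
    "\<langle>d (Suc n) : P (Suc n) \<rightarrow> P n\<rangle>" "exact_at \<A> (d (Suc n)) (d n)"
  using assms unfolding projective_resolution_def by auto

text \<open>
  For \<open>n > 0\<close> this says that the \<open>n\<close>-th cohomology of \<open>Hom (P, B)\<close> vanishes; \<open>d 0\<close> is the augmentation.
\<close>

definition cocycles_extend where
  "cocycles_extend P d n B \<longleftrightarrow> (\<forall>f. \<langle>f : P n \<rightarrow> B\<rangle> \<and> f \<cdot> d (Suc n) = Zero \<A> (P (Suc n)) B \<longrightarrow>
     (\<exists>g. \<langle>g : P (n - 1) \<rightarrow> B\<rangle> \<and> g \<cdot> d n = f))"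

lemma trivial_cohomology_iff:
  assumes r: "projective_resolution \<A> A P d" and B: "B \<in> Ob \<A>"
  shows "trivial_group (Hom_cohomology \<A> P d (Suc n) B) \<longleftrightarrow> cocycles_extend P d (Suc n) B"
proof -
  let ?H = "Hom_group \<A> (P (Suc n)) B"
  let ?Z = "cocycles \<A> P d (Suc n) B" and ?N = "coboundaries \<A> P d (Suc n) B"
  let ?G = "?H\<lparr>carrier := ?Z\<rparr>"
  note d1 = resolutionD(4)[OF r, of n] and d2 = resolutionD(4)[OF r, of "Suc n"]
  have ob: "P n \<in> Ob \<A>" "P (Suc n) \<in> Ob \<A>" "P (Suc (Suc n)) \<in> Ob \<A>" using hom_Ob d1 d2 by auto
  have z: "\<langle>Zero \<A> (P (Suc n)) B : P (Suc n) \<rightarrow> B\<rangle>" using zero_in_hom ob B by blast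
  have zz: "Zero \<A> (P (Suc n)) B \<cdot> d (Suc (Suc n)) = Zero \<A> (P (Suc (Suc n))) B"
    using d2 B by (simp add: hom_iff)
  have zN: "Zero \<A> (P (Suc n)) B \<in> ?N"
  proof -
    have "Zero \<A> (P n) B \<cdot> d (Suc n) = Zero \<A> (P (Suc n)) B" using d1 B by (simp add: hom_iff)
    then show ?thesis using zero_in_hom[OF ob(1) B] unfolding coboundaries_def
      by (simp add: image_iff) metis
  qed
  have NZ: "?N \<subseteq> ?Z"
  proof
    fix f assume "f \<in> ?N"
    then obtain g where g: "\<langle>g : P n \<rightarrow> B\<rangle>" "f = g \<cdot> d (Suc n)" by (auto simp: coboundaries_def)
    have "f \<cdot> d (Suc (Suc n)) = g \<cdot> (d (Suc n) \<cdot> d (Suc (Suc n)))"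
      using g d1 d2 by (simp add: hom_iff)
    also have "\<dots> = Zero \<A> (P (Suc (Suc n))) B"
      unfolding exact_zero[OF resolutionD(5)[OF r] d2 d1] using g ob by (simp add: hom_iff)
    finally show "f \<in> ?Z" using Comp_closed[OF d1 g(1)] g(2) by (simp add: cocycles_def)
  qed
  have ext: "cocycles_extend P d (Suc n) B \<longleftrightarrow> ?Z \<subseteq> ?N"
    unfolding cocycles_extend_def cocycles_def coboundaries_def by auto
  interpret H: comm_group ?H using Hom_comm_group ob B by blast
  have G: "group ?G"
  proof (rule H.subgroup_imp_group, rule H.subgroupI)
    show "?Z \<subseteq> carrier ?H" by (auto simp: cocycles_def Hom_group_def)
    show "?Z \<noteq> {}" using z zz by (auto simp: cocycles_def)
    show "a \<otimes>\<^bsub>?H\<^esub> b \<in> ?Z" if "a \<in> ?Z" "b \<in> ?Z" for a b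
      using that d2 add_zero[OF zero_in_hom[OF ob(3) B]]
      by (simp add: cocycles_def Hom_group_def hom_iff)
    show "inv\<^bsub>?H\<^esub> a \<in> ?Z" if "a \<in> ?Z" for a
    proof -
      have a: "\<langle>a : P (Suc n) \<rightarrow> B\<rangle>" "a \<cdot> d (Suc (Suc n)) = Zero \<A> (P (Suc (Suc n))) B"
        using that by (auto simp: cocycles_def)
      have "neg (Zero \<A> (P (Suc (Suc n))) B) = Zero \<A> (P (Suc (Suc n))) B"
        using add_zero[OF zero_in_hom[OF ob(3) B]] add_eq_zero_iff zero_in_hom[OF ob(3) B] by metis
      then have "neg a \<in> ?Z" using neg_in_hom[OF a(1)] comp_neg(2)[of "d (Suc (Suc n))" a] a d2
        by (simp add: cocycles_def hom_iff)
      then show ?thesis using a(1) by (simp add: neg_def hom_iff)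
    qed
  qed
  have one: "\<one>\<^bsub>?G Mod ?N\<^esub> = ?N" by (simp add: FactGroup_def)
  show ?thesis
  proof
    assume t: "trivial_group (Hom_cohomology \<A> P d (Suc n) B)"
    have "f \<in> ?N" if f: "f \<in> ?Z" for f
    proof -
      have "?N #>\<^bsub>?G\<^esub> f \<in> carrier (?G Mod ?N)" using f by (auto simp: FactGroup_def RCOSETS_def)
      then have "?N #>\<^bsub>?G\<^esub> f = ?N" using t one unfolding Hom_cohomology_def trivial_group_def by auto
      moreover have "Zero \<A> (P (Suc n)) B \<oplus> f = f" using f zero_add[OF _ z z] by (auto simp: cocycles_def)
      then have "f \<in> ?N #>\<^bsub>?G\<^esub> f" using zN unfolding r_coset_def Hom_group_def by force
      ultimately show ?thesis by simp
    qed
    then show "cocycles_extend P d (Suc n) B" using ext by blast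
  next
    assume "cocycles_extend P d (Suc n) B"
    then have N: "?N = carrier ?G" using ext NZ by auto
    interpret G: group ?G by (rule G)
    have grp: "group (?G Mod ?N)" unfolding N using normal.factorgroup_is_group[OF G.normal_self] .
    have "carrier (?G Mod ?N) = {?N}"
      using G.coset_join2[OF _ G.subgroup_self] G.one_closed
      unfolding N FactGroup_def RCOSETS_def by auto
    then show "trivial_group (Hom_cohomology \<A> P d (Suc n) B)"
      using grp one unfolding Hom_cohomology_def trivial_group_def by simp
  qed
qed

lemma Ext_zero_Suc_iff:
  assumes A: "A \<in> Ob \<A>" and B: "B \<in> Ob \<A>"
  obtains P d where "projective_resolution \<A> A P d"
    "\<And>n. Ext_zero \<A> (Suc n) A B \<longleftrightarrow> cocycles_extend P d (Suc n) B"
proof -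
  define R where "R = (SOME R. projective_resolution \<A> A (fst R) (snd R))"
  have R: "projective_resolution \<A> A (fst R) (snd R)"
    unfolding R_def by (rule someI_ex) (use ex_projective_resolution[OF A] in auto)
  show ?thesis
    by (rule that[OF R])
      (use trivial_cohomology_iff[OF R B] in \<open>simp add: Ext_zero_def Ext_def Let_def flip: R_def\<close>)
qed

lemma Ext_zero_0_iff:
  assumes "A \<in> Ob \<A>" "B \<in> Ob \<A>"
  shows "Ext_zero \<A> 0 A B \<longleftrightarrow> (\<forall>f. \<langle>f : A \<rightarrow> B\<rangle> \<longrightarrow> f = Zero \<A> A B)"
  using comm_group.axioms(2)[OF Hom_comm_group[OF assms]] zero_in_hom[OF assms]
  by (auto simp: Ext_zero_def trivial_group_def Hom_group_def)

text \<open>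
  This condition and the next are forms of \<open>Ext\<^sup>1(A, B) = 0\<close> that mention no resolution: the connecting
  maps \<open>Hom(A, Z) \<rightarrow> Ext\<^sup>1(A, B)\<close> and \<open>Hom(X, B) \<rightarrow> Ext\<^sup>1(A, B)\<close> vanish.
\<close>

definition lifts_along where
  "lifts_along A B \<longleftrightarrow> (\<forall>Y Z b p g. short_exact_seq \<A> B b Y p Z \<longrightarrow> \<langle>g : A \<rightarrow> Z\<rangle> \<longrightarrow>
     (\<exists>h. \<langle>h : A \<rightarrow> Y\<rangle> \<and> p \<cdot> h = g))"

definition extends_along where
  "extends_along A B \<longleftrightarrow> (\<forall>X Y i c f. short_exact_seq \<A> X i Y c A \<longrightarrow> \<langle>f : X \<rightarrow> B\<rangle> \<longrightarrow>
     (\<exists>h. \<langle>h : Y \<rightarrow> B\<rangle> \<and> h \<cdot> i = f))"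

lemma lifts_alongD:
  assumes "lifts_along A B" "short_exact_seq \<A> B b Y p Z" "\<langle>g : A \<rightarrow> Z\<rangle>"
  obtains h where "\<langle>h : A \<rightarrow> Y\<rangle>" "p \<cdot> h = g"
  using assms(1)[unfolded lifts_along_def, rule_format, OF assms(2,3)] by (elim exE conjE) (rule that)

lemma extends_alongD:
  assumes "extends_along A B" "short_exact_seq \<A> X i Y c A" "\<langle>f : X \<rightarrow> B\<rangle>"
  obtains h where "\<langle>h : Y \<rightarrow> B\<rangle>" "h \<cdot> i = f"
  using assms(1)[unfolded extends_along_def, rule_format, OF assms(2,3)] by (elim exE conjE) (rule that)

text \<open>
  Lift \<open>g \<cdot> d 0\<close> to \<open>t : P 0 \<rightarrow> Y\<close>. On \<open>P 1\<close> the map \<open>t\<close> takes values in \<open>B\<close> and is a cocycle there, so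
  it equals \<open>s0 \<cdot> d 1\<close>. Then \<open>t - b \<cdot> s0\<close> vanishes on the image of \<open>d 1\<close> and descends to \<open>A\<close>.
\<close>

lemma cocycles_extend_imp_lifts:
  assumes r: "projective_resolution \<A> A P d" and c: "cocycles_extend P d 1 B"
  shows "lifts_along A B"
  unfolding lifts_along_def
proof (intro allI impI)
  fix Y Z b p g assume s: "short_exact_seq \<A> B b Y p Z" and g: "\<langle>g : A \<rightarrow> Z\<rangle>"
  note h = sesD[OF s] and d0 = resolutionD(2,3)[OF r]
  note d1 = resolutionD(4)[OF r, of 0] and d2 = resolutionD(4)[OF r, of 1]
  have ob: "P 0 \<in> Ob \<A>" "P 1 \<in> Ob \<A>" "P (Suc 1) \<in> Ob \<A>" "A \<in> Ob \<A>" "B \<in> Ob \<A>" "Y \<in> Ob \<A>" "Z \<in> Ob \<A>"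
    using hom_Ob d0 d1 d2 h by auto
  have 01: "d 0 \<cdot> d 1 = Zero \<A> (P 1) A" and 12: "d 1 \<cdot> d (Suc 1) = Zero \<A> (P (Suc 1)) (P 0)"
    using exact_zero[OF resolutionD(5)[OF r] d1 d0(1)] exact_zero[OF resolutionD(5)[OF r] d2] d1 by auto
  have gd: "\<langle>g \<cdot> d 0 : P 0 \<rightarrow> Z\<rangle>" using Comp_closed[OF d0(1) g] .
  obtain t where t: "\<langle>t : P 0 \<rightarrow> Y\<rangle>" "p \<cdot> t = g \<cdot> d 0"
    using projective_lift[OF resolutionD(1)[OF r] h(4,2) gd] by blast
  have td: "\<langle>t \<cdot> d 1 : P 1 \<rightarrow> Y\<rangle>" using Comp_closed[OF _ t(1)] d1 by simp
  have "p \<cdot> (t \<cdot> d 1) = g \<cdot> (d 0 \<cdot> d 1)"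
    using comp_through[OF t(2,1) h(2), of "d 1" "P 1"] d1 d0 g by (simp add: hom_iff)
  also have "\<dots> = Zero \<A> (P 1) Z" unfolding 01 using g ob by (simp add: hom_iff)
  finally obtain s1 where s1: "\<langle>s1 : P 1 \<rightarrow> B\<rangle>" "b \<cdot> s1 = t \<cdot> d 1" using ses_lift[OF s td] by blast
  have s1d: "\<langle>s1 \<cdot> d (Suc 1) : P (Suc 1) \<rightarrow> B\<rangle>" using Comp_closed[OF d2 s1(1)] .
  have "b \<cdot> (s1 \<cdot> d (Suc 1)) = t \<cdot> (d 1 \<cdot> d (Suc 1))"
    using comp_through[OF s1(2,1) h(1) d2] d1 d2 t by (simp add: hom_iff)
  also have "\<dots> = Zero \<A> (P (Suc 1)) Y" unfolding 12 using t ob by (simp add: hom_iff)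
  finally have "s1 \<cdot> d (Suc 1) = Zero \<A> (P (Suc 1)) B" using mono_zero[OF h(3,1) s1d] by blast
  then obtain s0 where s0: "\<langle>s0 : P 0 \<rightarrow> B\<rangle>" "s0 \<cdot> d 1 = s1"
    using c s1(1) unfolding cocycles_extend_def by auto
  have bs: "\<langle>b \<cdot> s0 : P 0 \<rightarrow> Y\<rangle>" using Comp_closed[OF s0(1) h(1)] .
  let ?w = "t \<ominus> b \<cdot> s0"
  have w: "\<langle>?w : P 0 \<rightarrow> Y\<rangle>" using sub_in_hom[OF t(1) bs] .
  have wd: "?w \<cdot> d 1 = Zero \<A> (P 1) Y"
    using s0 s1 d1 t(1) bs h(1) sub_self[OF td] by (simp add: hom_iff)
  obtain v where v: "\<langle>v : A \<rightarrow> Y\<rangle>" "v \<cdot> d 0 = ?w"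
  proof (rule factor_through_epi[OF d0 w])
    fix Q y assume Q: "projective \<A> Q" and y: "\<langle>y : Q \<rightarrow> P 0\<rangle>" "d 0 \<cdot> y = Zero \<A> Q A"
    obtain x where x: "\<langle>x : Q \<rightarrow> P 1\<rangle>" "d 1 \<cdot> x = y"
      using exact_lift[OF resolutionD(5)[OF r] d1 d0(1) Q y] by auto
    have "?w \<cdot> (d 1 \<cdot> x) = Zero \<A> (P 1) Y \<cdot> x" using comp_through[OF wd _ w x(1)] d1 by simp
    then show "?w \<cdot> y = Zero \<A> Q Y" using x ob by (simp add: hom_iff)
  qed blast
  have pv: "\<langle>p \<cdot> v : A \<rightarrow> Z\<rangle>" using Comp_closed[OF v(1) h(2)] .
  have "(p \<cdot> v) \<cdot> d 0 = p \<cdot> ?w" using v h(2) d0 by (simp add: hom_iff)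
  also have "\<dots> = p \<cdot> t \<ominus> (p \<cdot> b) \<cdot> s0" using t(1) bs s0(1) h(1,2) by (simp add: hom_iff)
  also have "\<dots> = p \<cdot> t"
    unfolding h(6) using sub_zero[OF Comp_closed[OF t(1) h(2)]] s0(1) ob by (simp add: hom_iff)
  finally have "(p \<cdot> v) \<cdot> d 0 = g \<cdot> d 0" using t(2) by simp
  then have "p \<cdot> v = g" using epi_cancel[OF d0(2,1) pv g] by blast
  then show "\<exists>h. \<langle>h : A \<rightarrow> Y\<rangle> \<and> p \<cdot> h = g" using v by blast
qed

text \<open>
  Push the sequence out along \<open>f\<close>. A section \<open>t\<close> of the new sequence gives the extension of \<open>f\<close>,
  namely the map that \<open>e - t \<cdot> c\<close> induces into the kernel \<open>B\<close>.
\<close>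

lemma lifts_imp_extends:
  assumes l: "lifts_along A B"
  shows "extends_along A B"
  unfolding extends_along_def
proof (intro allI impI)
  fix X Y i c f assume s: "short_exact_seq \<A> X i Y c A" and f: "\<langle>f : X \<rightarrow> B\<rangle>"
  obtain E j e c' where E: "short_exact_seq \<A> B j E c' A" "\<langle>e : Y \<rightarrow> E\<rangle>" "e \<cdot> i = j \<cdot> f" "c' \<cdot> e = c"
    by (rule pushout_ses[OF s f])
  note h = sesD[OF s] and k = sesD[OF E(1)]
  have ob: "A \<in> Ob \<A>" "Y \<in> Ob \<A>" "E \<in> Ob \<A>" "X \<in> Ob \<A>" using hom_Ob h k by auto
  obtain t where t: "\<langle>t : A \<rightarrow> E\<rangle>" "c' \<cdot> t = Id \<A> A"
    using lifts_alongD[OF l E(1) Id_closed[OF ob(1)]] .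
  have tc: "\<langle>t \<cdot> c : Y \<rightarrow> E\<rangle>" using Comp_closed[OF h(2) t(1)] .
  have "c' \<cdot> (e \<ominus> t \<cdot> c) = c \<ominus> (c' \<cdot> t) \<cdot> c" using E(2,4) tc t(1) h(2) k(2) by (simp add: hom_iff)
  also have "\<dots> = Zero \<A> Y A" unfolding t(2) using sub_self[OF h(2)] h(2) by (simp add: hom_iff)
  finally obtain v where v: "\<langle>v : Y \<rightarrow> B\<rangle>" "j \<cdot> v = e \<ominus> t \<cdot> c"
    using ses_lift[OF E(1) sub_in_hom[OF E(2) tc]] by blast
  have "j \<cdot> (v \<cdot> i) = (e \<ominus> t \<cdot> c) \<cdot> i" using comp_through[OF v(2,1) k(1) h(1)] .
  also have "\<dots> = e \<cdot> i \<ominus> t \<cdot> (c \<cdot> i)" using E(2) tc t(1) h(1,2) by (simp add: hom_iff)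
  also have "\<dots> = j \<cdot> f"
    unfolding h(6) E(3) using sub_zero[OF Comp_closed[OF f k(1)]] t(1) ob by (simp add: hom_iff)
  finally have "v \<cdot> i = f" using mono_cancel[OF k(3,1) Comp_closed[OF h(1) v(1)] f] by blast
  then show "\<exists>h. \<langle>h : Y \<rightarrow> B\<rangle> \<and> h \<cdot> i = f" using v by blast
qed

text \<open>
  A cocycle on \<open>P 1\<close> factors through the kernel \<open>K\<close> of the augmentation, and the factor extends from \<open>K\<close>
  to \<open>P 0\<close>.
\<close>

lemma extends_imp_cocycles_extend:
  assumes r: "projective_resolution \<A> A P d" and e: "extends_along A B"
  shows "cocycles_extend P d 1 B"
  unfolding cocycles_extend_def
proof (intro allI impI, elim conjE)
  fix f assume f: "\<langle>f : P 1 \<rightarrow> B\<rangle>" and fd: "f \<cdot> d (Suc 1) = Zero \<A> (P (Suc 1)) B"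
  note d0 = resolutionD(2,3)[OF r]
  have d1: "\<langle>d 1 : P 1 \<rightarrow> P 0\<rangle>" and ex1: "exact_at \<A> (d 1) (d 0)"
    using resolutionD(4,5)[OF r, of 0] by auto
  note d2 = resolutionD(4)[OF r, of 1] and ex2 = resolutionD(5)[OF r, of 1]
  obtain K k where k: "short_exact_seq \<A> K k (P 0) (d 0) A" using ses_of_epi[OF d0] by blast
  note h = sesD[OF k]
  obtain p where p: "\<langle>p : P 1 \<rightarrow> K\<rangle>" "k \<cdot> p = d 1"
    using ses_lift[OF k d1 exact_zero[OF ex1 d1 d0(1)]] by blast
  have pe: "is_epi \<A> p"
  proof (rule epiI[OF p(1)])
    fix Q y assume Q: "projective \<A> Q" and y: "\<langle>y : Q \<rightarrow> K\<rangle>"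
    have "d 0 \<cdot> (k \<cdot> y) = Zero \<A> Q A"
      using comp_through[OF h(6,1,2) y] y hom_Ob[OF h(2)] by (simp add: hom_iff)
    then obtain x where x: "\<langle>x : Q \<rightarrow> P 1\<rangle>" "d 1 \<cdot> x = k \<cdot> y"
      using exact_lift[OF ex1 d1 d0(1) Q Comp_closed[OF y h(1)]] by blast
    have "k \<cdot> (p \<cdot> x) = k \<cdot> y" using comp_through[OF p(2,1) h(1) x(1)] x(2) by simp
    then have "p \<cdot> x = y" using mono_cancel[OF h(3,1) Comp_closed[OF x(1) p(1)] y] by blast
    then show "\<exists>x. \<langle>x : Q \<rightarrow> P 1\<rangle> \<and> p \<cdot> x = y" using x by blast
  qed
  obtain f' where f': "\<langle>f' : K \<rightarrow> B\<rangle>" "f' \<cdot> p = f"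
  proof (rule factor_through_epi[OF p(1) pe f])
    fix Q y assume Q: "projective \<A> Q" and y: "\<langle>y : Q \<rightarrow> P 1\<rangle>" and py: "p \<cdot> y = Zero \<A> Q K"
    have "d 1 \<cdot> y = Zero \<A> Q (P 0)"
      using comp_through[OF p(2,1) h(1) y] py h(1) hom_Ob[OF y] by (simp add: hom_iff)
    then obtain x where x: "\<langle>x : Q \<rightarrow> P (Suc 1)\<rangle>" "d (Suc 1) \<cdot> x = y"
      using exact_lift[OF ex2 d2 d1 Q y] by blast
    show "f \<cdot> y = Zero \<A> Q B"
      using comp_through[OF fd d2 f x(1)] x hom_Ob[OF f] by (simp add: hom_iff)
  qed blast
  obtain g where g: "\<langle>g : P 0 \<rightarrow> B\<rangle>" "g \<cdot> k = f'" using extends_alongD[OF e k f'(1)] .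
  have "g \<cdot> d 1 = f" using comp_through[OF g(2) h(1) g(1) p(1)] p(2) f'(2) by simp
  then show "\<exists>g. \<langle>g : P (1 - 1) \<rightarrow> B\<rangle> \<and> g \<cdot> d 1 = f" using g by auto
qed

text \<open>
  As the lifting and extension forms mention no resolution, the cocycle condition does not depend on the
  resolution chosen in the definition of Ext.
\<close>

lemma Ext_zero_1_iff:
  assumes "A \<in> Ob \<A>" "B \<in> Ob \<A>"
  shows Ext_zero_1_iff_extends: "Ext_zero \<A> 1 A B \<longleftrightarrow> extends_along A B"
    and Ext_zero_1_iff_lifts: "Ext_zero \<A> 1 A B \<longleftrightarrow> lifts_along A B"
    and Ext_zero_1_iff_cocycles: "projective_resolution \<A> A Q e \<Longrightarrow> Ext_zero \<A> 1 A B \<longleftrightarrow> cocycles_extend Q e 1 B"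
proof -
  obtain P d where P: "projective_resolution \<A> A P d"
    "\<And>n. Ext_zero \<A> (Suc n) A B \<longleftrightarrow> cocycles_extend P d (Suc n) B"
    using Ext_zero_Suc_iff[OF assms] by blast
  note imps = cocycles_extend_imp_lifts lifts_imp_extends extends_imp_cocycles_extend
  have E: "Ext_zero \<A> 1 A B \<longleftrightarrow> cocycles_extend P d 1 B" using P(2)[of 0] by simp
  show "Ext_zero \<A> 1 A B \<longleftrightarrow> extends_along A B" "Ext_zero \<A> 1 A B \<longleftrightarrow> lifts_along A B"
    unfolding E using imps P(1) by blast+
  show "Ext_zero \<A> 1 A B \<longleftrightarrow> cocycles_extend Q e 1 B" if "projective_resolution \<A> A Q e"
    unfolding E using imps P(1) that by blast
qed

end

section \<open>Closure properties of orthogonal classes and torsion classes\<close>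

context abelian_category_enough_projectives
begin

lemma ext1_extend:
  assumes "Ext_zero \<A> 1 A B" "short_exact_seq \<A> X i Y c A" "\<langle>f : X \<rightarrow> B\<rangle>"
  obtains h where "\<langle>h : Y \<rightarrow> B\<rangle>" "h \<cdot> i = f"
proof -
  have "A \<in> Ob \<A>" "B \<in> Ob \<A>" using hom_Ob sesD(2)[OF assms(2)] assms(3) by auto
  then have "extends_along A B" using Ext_zero_1_iff_extends assms(1) by simp
  then show ?thesis by (rule extends_alongD[OF _ assms(2,3)]) (rule that)
qed

lemma ext1_lift:
  assumes "Ext_zero \<A> 1 A B" "short_exact_seq \<A> B b Y p Z" "\<langle>g : A \<rightarrow> Z\<rangle>"
  obtains h where "\<langle>h : A \<rightarrow> Y\<rangle>" "p \<cdot> h = g"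
proof -
  have "A \<in> Ob \<A>" "B \<in> Ob \<A>" using hom_Ob sesD(1)[OF assms(2)] assms(3) by auto
  then have "lifts_along A B" using Ext_zero_1_iff_lifts assms(1) by simp
  then show ?thesis by (rule lifts_alongD[OF _ assms(2,3)]) (rule that)
qed

lemma ext1I_extend:
  assumes "A \<in> Ob \<A>" "B \<in> Ob \<A>"
    and "\<And>X Y i c f. short_exact_seq \<A> X i Y c A \<Longrightarrow> \<langle>f : X \<rightarrow> B\<rangle> \<Longrightarrow> \<exists>h. \<langle>h : Y \<rightarrow> B\<rangle> \<and> h \<cdot> i = f"
  shows "Ext_zero \<A> 1 A B"
  unfolding Ext_zero_1_iff_extends[OF assms(1,2)] extends_along_def by (intro allI impI) (rule assms(3))

lemma ext1I_lift:
  assumes "A \<in> Ob \<A>" "B \<in> Ob \<A>"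
    and "\<And>Y Z b p g. short_exact_seq \<A> B b Y p Z \<Longrightarrow> \<langle>g : A \<rightarrow> Z\<rangle> \<Longrightarrow> \<exists>h. \<langle>h : A \<rightarrow> Y\<rangle> \<and> p \<cdot> h = g"
  shows "Ext_zero \<A> 1 A B"
  unfolding Ext_zero_1_iff_lifts[OF assms(1,2)] lifts_along_def by (intro allI impI) (rule assms(3))

lemma ext1_projective:
  assumes "projective \<A> P" "B \<in> Ob \<A>"
  shows "Ext_zero \<A> 1 P B"
proof (rule ext1I_lift[OF _ assms(2)])
  show "P \<in> Ob \<A>" using assms by (simp add: projective_def)
  fix Y Z b p g assume s: "short_exact_seq \<A> B b Y p Z" and g: "\<langle>g : P \<rightarrow> Z\<rangle>"
  obtain x where "\<langle>x : P \<rightarrow> Y\<rangle>" "p \<cdot> x = g"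
    by (rule projective_lift[OF assms(1) sesD(4)[OF s] sesD(2)[OF s] g])
  then show "\<exists>h. \<langle>h : P \<rightarrow> Y\<rangle> \<and> p \<cdot> h = g" by blast
qed

lemma ext1_retract:
  assumes i: "\<langle>i : A' \<rightarrow> A\<rangle>" and r: "\<langle>r : A \<rightarrow> A'\<rangle>" and ri: "r \<cdot> i = Id \<A> A'"
    and E: "Ext_zero \<A> 1 A B" and B: "B \<in> Ob \<A>"
  shows "Ext_zero \<A> 1 A' B"
proof (rule ext1I_lift[OF _ B])
  show "A' \<in> Ob \<A>" using hom_Ob[OF i] by simp
  fix Y Z b p g assume s: "short_exact_seq \<A> B b Y p Z" and g: "\<langle>g : A' \<rightarrow> Z\<rangle>"
  obtain h where h: "\<langle>h : A \<rightarrow> Y\<rangle>" "p \<cdot> h = g \<cdot> r"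
    by (rule ext1_lift[OF E s Comp_closed[OF r g]])
  have "p \<cdot> (h \<cdot> i) = g \<cdot> (r \<cdot> i)"
    using comp_through[OF h(2,1) sesD(2)[OF s] i] g r i by (simp add: hom_iff)
  then have "p \<cdot> (h \<cdot> i) = g" using ri g by (simp add: hom_iff)
  then show "\<exists>h. \<langle>h : A' \<rightarrow> Y\<rangle> \<and> p \<cdot> h = g" using Comp_closed[OF i h(1)] by blast
qed

lemma ext1_direct_sum:
  assumes S: "is_direct_sum \<A> I X S \<iota> \<pi>" and B: "B \<in> Ob \<A>"
    and E: "\<And>k. k \<in> I \<Longrightarrow> Ext_zero \<A> 1 (X k) B"
  shows "Ext_zero \<A> 1 S B"
proof (rule ext1I_lift[OF _ B])
  show "S \<in> Ob \<A>" using S by (simp add: is_direct_sum_def)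
  fix Y Z b p g assume s: "short_exact_seq \<A> B b Y p Z" and g: "\<langle>g : S \<rightarrow> Z\<rangle>"
  have "\<exists>h. \<langle>h : X k \<rightarrow> Y\<rangle> \<and> p \<cdot> h = g \<cdot> \<iota> k" if k: "k \<in> I" for k
  proof -
    have i: "\<langle>\<iota> k : X k \<rightarrow> S\<rangle>" using S k by (simp add: is_direct_sum_def)
    obtain h where "\<langle>h : X k \<rightarrow> Y\<rangle>" "p \<cdot> h = g \<cdot> \<iota> k"
      by (rule ext1_lift[OF E[OF k] s Comp_closed[OF i g]])
    then show ?thesis by blast
  qed
  then obtain h where "\<langle>h : S \<rightarrow> Y\<rangle>" "p \<cdot> h = g"
    using direct_sum_lift[OF S g sesD(2)[OF s]] by metis
  then show "\<exists>h. \<langle>h : S \<rightarrow> Y\<rangle> \<and> p \<cdot> h = g" by blast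
qed

text \<open>
  Extend \<open>f\<close> first to the preimage \<open>Y'\<close> of \<open>A'\<close> in \<open>Y\<close>, where the obstruction lies in \<open>Ext\<^sup>1(A', B)\<close>, and
  then to \<open>Y\<close>, where it lies in \<open>Ext\<^sup>1(A'', B)\<close>.
\<close>

lemma ext1_extension:
  assumes s: "short_exact_seq \<A> A' a A b A''"
    and E': "Ext_zero \<A> 1 A' B" and E'': "Ext_zero \<A> 1 A'' B" and B: "B \<in> Ob \<A>"
  shows "Ext_zero \<A> 1 A B"
proof (rule ext1I_extend[OF _ B])
  note h = sesD[OF s]
  show A: "A \<in> Ob \<A>" using hom_Ob[OF h(1)] by simp
  fix X Y i c f assume t: "short_exact_seq \<A> X i Y c A" and f: "\<langle>f : X \<rightarrow> B\<rangle>"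
  note k = sesD[OF t]
  have ob: "A' \<in> Ob \<A>" "A'' \<in> Ob \<A>" "X \<in> Ob \<A>" "Y \<in> Ob \<A>" using hom_Ob h k by auto
  have bc: "\<langle>b \<cdot> c : Y \<rightarrow> A''\<rangle>" using Comp_closed[OF k(2) h(2)] .
  obtain Y' y where y: "short_exact_seq \<A> Y' y Y (b \<cdot> c) A''"
    by (rule ses_of_epi[OF bc comp_epi[OF k(4) h(4) k(2) h(2)]])
  note l = sesD[OF y]
  have "(b \<cdot> c) \<cdot> i = b \<cdot> (c \<cdot> i)" using h(2) k(1,2) by (simp add: hom_iff)
  also have "\<dots> = Zero \<A> X A''" unfolding k(6) using h(2) ob by (simp add: hom_iff)
  finally obtain i' where i': "\<langle>i' : X \<rightarrow> Y'\<rangle>" "y \<cdot> i' = i" using ses_lift[OF y k(1)] by metis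
  have cy: "\<langle>c \<cdot> y : Y' \<rightarrow> A\<rangle>" using Comp_closed[OF l(1) k(2)] .
  have "b \<cdot> (c \<cdot> y) = Zero \<A> Y' A''" using l(6,1) k(2) h(2) by (simp add: hom_iff)
  then obtain c' where c': "\<langle>c' : Y' \<rightarrow> A'\<rangle>" "a \<cdot> c' = c \<cdot> y" using ses_lift[OF s cy] by metis
  have i'm: "is_mono \<A> i'"
  proof (rule monoI[OF i'(1)])
    fix Q x assume x: "\<langle>x : Q \<rightarrow> X\<rangle>" and z: "i' \<cdot> x = Zero \<A> Q Y'"
    have "i \<cdot> x = Zero \<A> Q Y"
      using comp_through[OF i'(2,1) l(1) x] z l(1) hom_Ob[OF x] by (simp add: hom_iff)
    then show "x = Zero \<A> Q X" using mono_zero[OF k(3,1) x] by simp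
  qed
  have c'e: "is_epi \<A> c'"
  proof (rule epiI[OF c'(1)])
    fix Q z assume Q: "projective \<A> Q" and z: "\<langle>z : Q \<rightarrow> A'\<rangle>"
    obtain w where w: "\<langle>w : Q \<rightarrow> Y\<rangle>" "c \<cdot> w = a \<cdot> z"
      by (rule projective_lift[OF Q k(4,2) Comp_closed[OF z h(1)]])
    have "(b \<cdot> c) \<cdot> w = (b \<cdot> a) \<cdot> z" using w z h(1,2) k(2) by (simp add: hom_iff)
    also have "\<dots> = Zero \<A> Q A''" unfolding h(6) using z ob by (simp add: hom_iff)
    finally obtain x where x: "\<langle>x : Q \<rightarrow> Y'\<rangle>" "y \<cdot> x = w" using ses_lift[OF y w(1)] by metis
    have "a \<cdot> (c' \<cdot> x) = a \<cdot> z"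
      using comp_through[OF c'(2,1) h(1) x(1)] x w k(2) l(1) by (simp add: hom_iff)
    then have "c' \<cdot> x = z" using mono_cancel[OF h(3,1) Comp_closed[OF x(1) c'(1)] z] by simp
    then show "\<exists>x. \<langle>x : Q \<rightarrow> Y'\<rangle> \<and> c' \<cdot> x = z" using x by blast
  qed
  have "short_exact_seq \<A> X i' Y' c' A'"
  proof (rule sesI[OF i'(1) i'm c'(1) c'e])
    have "a \<cdot> (c' \<cdot> i') = c \<cdot> (y \<cdot> i')"
      using comp_through[OF c'(2,1) h(1) i'(1)] k(2) l(1) i'(1) by (simp add: hom_iff)
    then have "a \<cdot> (c' \<cdot> i') = Zero \<A> X A" using i'(2) k(6) by simp
    then show "c' \<cdot> i' = Zero \<A> X A'" using mono_zero[OF h(3,1) Comp_closed[OF i'(1) c'(1)]] by simp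
    fix Q z assume z: "\<langle>z : Q \<rightarrow> Y'\<rangle>" "c' \<cdot> z = Zero \<A> Q A'"
    have yz: "\<langle>y \<cdot> z : Q \<rightarrow> Y\<rangle>" using Comp_closed[OF z(1) l(1)] .
    have "c \<cdot> (y \<cdot> z) = a \<cdot> (c' \<cdot> z)"
      using comp_through[OF c'(2,1) h(1) z(1)] k(2) l(1) z(1) by (simp add: hom_iff)
    also have "\<dots> = Zero \<A> Q A" unfolding z(2) using h(1) hom_Ob[OF z(1)] by (simp add: hom_iff)
    finally obtain x where x: "\<langle>x : Q \<rightarrow> X\<rangle>" "i \<cdot> x = y \<cdot> z" using ses_lift[OF t yz] by metis
    have "y \<cdot> (i' \<cdot> x) = y \<cdot> z" using comp_through[OF i'(2,1) l(1) x(1)] x(2) by simp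
    then have "i' \<cdot> x = z" using mono_cancel[OF l(3,1) Comp_closed[OF x(1) i'(1)] z(1)] by simp
    then show "\<exists>x. \<langle>x : Q \<rightarrow> X\<rangle> \<and> i' \<cdot> x = z" using x by blast
  qed
  then obtain f' where f': "\<langle>f' : Y' \<rightarrow> B\<rangle>" "f' \<cdot> i' = f" by (rule ext1_extend[OF E' _ f])
  obtain g where g: "\<langle>g : Y \<rightarrow> B\<rangle>" "g \<cdot> y = f'" by (rule ext1_extend[OF E'' y f'(1)])
  have "g \<cdot> i = f" using comp_through[OF g(2) l(1) g(1) i'(1)] i'(2) f'(2) by simp
  then show "\<exists>h. \<langle>h : Y \<rightarrow> B\<rangle> \<and> h \<cdot> i = f" using g by blast
qed

lemma left_perp_subcategory:
  assumes "\<D> \<subseteq> Ob \<A>"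
  shows "subcategory \<A> (left_perp \<A> 1 \<D>)"
  unfolding subcategory_def
proof (intro conjI ballI impI)
  show "left_perp \<A> 1 \<D> \<subseteq> Ob \<A>" by (auto simp: left_perp_def)
  fix A B assume A: "A \<in> left_perp \<A> 1 \<D>" and B: "B \<in> Ob \<A>" and iso: "isomorphic \<A> A B"
  obtain f g where fg: "\<langle>f : A \<rightarrow> B\<rangle>" "\<langle>g : B \<rightarrow> A\<rangle>" "g \<cdot> f = Id \<A> A" "f \<cdot> g = Id \<A> B" by (rule isoD[OF iso])
  have "Ext_zero \<A> 1 B X" if "X \<in> \<D>" for X
    using ext1_retract[OF fg(2,1,4)] A that assms by (auto simp: left_perp_def)
  then show "B \<in> left_perp \<A> 1 \<D>" using B by (simp add: left_perp_def)
qed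

lemma left_perp_direct_sum:
  assumes "\<D> \<subseteq> Ob \<A>" "is_direct_sum \<A> I X S \<iota> \<pi>" "X ` I \<subseteq> left_perp \<A> 1 \<D>"
  shows "S \<in> left_perp \<A> 1 \<D>"
proof -
  have "Ext_zero \<A> 1 S B" if "B \<in> \<D>" for B
    using that assms(1,3) by (intro ext1_direct_sum[OF assms(2)]) (auto simp: left_perp_def)
  then show ?thesis using assms(2) by (auto simp: left_perp_def is_direct_sum_def)
qed

lemma left_perp_direct_summand:
  assumes "\<D> \<subseteq> Ob \<A>" "is_direct_sum \<A> I X S \<iota> \<pi>" "S \<in> left_perp \<A> 1 \<D>" "k \<in> I"
  shows "X k \<in> left_perp \<A> 1 \<D>"
proof -
  have k: "X k \<in> Ob \<A>" "\<langle>\<iota> k : X k \<rightarrow> S\<rangle>" "\<langle>\<pi> k : S \<rightarrow> X k\<rangle>" "\<pi> k \<cdot> \<iota> k = Id \<A> (X k)"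
    using assms(2,4) by (auto simp: is_direct_sum_def)
  have "Ext_zero \<A> 1 (X k) B" if "B \<in> \<D>" for B
    using ext1_retract[OF k(2-4)] that assms(1,3) by (auto simp: left_perp_def)
  then show ?thesis using k(1) by (simp add: left_perp_def)
qed

lemma left_perp_extension:
  assumes "\<D> \<subseteq> Ob \<A>" "short_exact_seq \<A> A' a A b A''" "A' \<in> left_perp \<A> 1 \<D>" "A'' \<in> left_perp \<A> 1 \<D>"
  shows "A \<in> left_perp \<A> 1 \<D>"
  using ext1_extension[OF assms(2)] assms(1,3,4) hom_Ob[OF sesD(1)[OF assms(2)]]
  by (auto simp: left_perp_def)

lemma projective_in_left_perp:
  assumes "\<D> \<subseteq> Ob \<A>" "projective \<A> P"
  shows "P \<in> left_perp \<A> 1 \<D>"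
  using ext1_projective[OF assms(2)] assms by (auto simp: left_perp_def projective_def)

lemma torsion_pairD:
  assumes "torsion_pair \<A> \<D> \<F>"
  shows "\<D> \<subseteq> Ob \<A>" "\<F> \<subseteq> Ob \<A>" "subcategory \<A> \<D>" "subcategory \<A> \<F>"
    and "X \<in> \<D> \<Longrightarrow> Y \<in> \<F> \<Longrightarrow> \<langle>u : X \<rightarrow> Y\<rangle> \<Longrightarrow> u = Zero \<A> X Y"
proof -
  show 1: "subcategory \<A> \<D>" "subcategory \<A> \<F>" using assms by (auto simp: torsion_pair_def)
  then show 2: "\<D> \<subseteq> Ob \<A>" "\<F> \<subseteq> Ob \<A>" by (auto simp: subcategory_def)
  assume "X \<in> \<D>" "Y \<in> \<F>" "\<langle>u : X \<rightarrow> Y\<rangle>"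
  moreover then have "Ext_zero \<A> 0 X Y" using assms by (auto simp: torsion_pair_def)
  ultimately show "u = Zero \<A> X Y" using Ext_zero_0_iff 2 by blast
qed

lemma torsion_sequence:
  assumes "torsion_pair \<A> \<D> \<F>" "A \<in> Ob \<A>"
  obtains D F f g where "D \<in> \<D>" "F \<in> \<F>" "short_exact_seq \<A> D f A g F"
  using assms by (auto simp: torsion_pair_def)

lemma subcategory_iso:
  "subcategory \<A> \<X> \<Longrightarrow> A \<in> \<X> \<Longrightarrow> isomorphic \<A> A B \<Longrightarrow> B \<in> \<X>"
  using hom_Ob unfolding subcategory_def isomorphic_def by blast

text \<open>
  The map from \<open>A\<close> to its torsion-free quotient vanishes, so the torsion part is all of \<open>A\<close>.
\<close>

lemma torsion_classI:
  assumes t: "torsion_pair \<A> \<D> \<F>" and A: "A \<in> Ob \<A>"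
    and z: "\<And>Y u. Y \<in> \<F> \<Longrightarrow> \<langle>u : A \<rightarrow> Y\<rangle> \<Longrightarrow> u = Zero \<A> A Y"
  shows "A \<in> \<D>"
proof -
  obtain D F f g where D: "D \<in> \<D>" "F \<in> \<F>" and s: "short_exact_seq \<A> D f A g F"
    by (rule torsion_sequence[OF t A])
  note h = sesD[OF s]
  have ob: "D \<in> Ob \<A>" "F \<in> Ob \<A>" using hom_Ob h by auto
  have "g \<cdot> Id \<A> A = Zero \<A> A F" using z[OF D(2) h(2)] h(2) by (simp add: hom_iff)
  then obtain v where v: "\<langle>v : A \<rightarrow> D\<rangle>" "f \<cdot> v = Id \<A> A" using ses_lift[OF s Id_closed[OF A]] by metis
  have "f \<cdot> (v \<cdot> f) = f \<cdot> Id \<A> D" using comp_through[OF v(2,1) h(1,1)] h(1) by (simp add: hom_iff)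
  then have "v \<cdot> f = Id \<A> D"
    using mono_cancel[OF h(3,1) Comp_closed[OF h(1) v(1)] Id_closed[OF ob(1)]] by simp
  then show ?thesis using isomorphicI[OF h(1) v(1) _ v(2)] subcategory_iso torsion_pairD(3)[OF t] D(1) by metis
qed

lemma torsion_free_classI:
  assumes t: "torsion_pair \<A> \<D> \<F>" and A: "A \<in> Ob \<A>"
    and z: "\<And>X u. X \<in> \<D> \<Longrightarrow> \<langle>u : X \<rightarrow> A\<rangle> \<Longrightarrow> u = Zero \<A> X A"
  shows "A \<in> \<F>"
proof -
  obtain D F f g where D: "D \<in> \<D>" "F \<in> \<F>" and s: "short_exact_seq \<A> D f A g F"
    by (rule torsion_sequence[OF t A])
  note h = sesD[OF s]
  have ob: "D \<in> Ob \<A>" "F \<in> Ob \<A>" using hom_Ob h by auto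
  have "Id \<A> A \<cdot> f = Zero \<A> D A" using z[OF D(1) h(1)] h(1) by (simp add: hom_iff)
  then obtain v where v: "\<langle>v : F \<rightarrow> A\<rangle>" "v \<cdot> g = Id \<A> A" using ses_extend[OF s Id_closed[OF A]] by metis
  have "(g \<cdot> v) \<cdot> g = Id \<A> F \<cdot> g" using v h(2) by (simp add: hom_iff)
  then have "g \<cdot> v = Id \<A> F"
    using epi_cancel[OF h(4,2) Comp_closed[OF v(1) h(2)] Id_closed[OF ob(2)]] by simp
  then show ?thesis using isomorphicI[OF v(1) h(2) _ v(2)] subcategory_iso torsion_pairD(4)[OF t] D(2) by metis
qed

lemma torsion_class_quotient:
  assumes t: "torsion_pair \<A> \<D> \<F>" and D: "D \<in> \<D>" and e: "\<langle>e : D \<rightarrow> A\<rangle>" "is_epi \<A> e"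
  shows "A \<in> \<D>"
proof (rule torsion_classI[OF t])
  show "A \<in> Ob \<A>" using hom_Ob[OF e(1)] by simp
  fix Y u assume Y: "Y \<in> \<F>" and u: "\<langle>u : A \<rightarrow> Y\<rangle>"
  have "u \<cdot> e = Zero \<A> D Y" using torsion_pairD(5)[OF t D Y Comp_closed[OF e(1) u]] .
  then show "u = Zero \<A> A Y" using epi_zero[OF e(2,1) u] by simp
qed

lemma torsion_class_extension:
  assumes t: "torsion_pair \<A> \<D> \<F>" and s: "short_exact_seq \<A> D' a A b D''" and D: "D' \<in> \<D>" "D'' \<in> \<D>"
  shows "A \<in> \<D>"
proof (rule torsion_classI[OF t])
  note h = sesD[OF s]
  show A: "A \<in> Ob \<A>" using hom_Ob[OF h(1)] by simp
  fix Y u assume Y: "Y \<in> \<F>" and u: "\<langle>u : A \<rightarrow> Y\<rangle>"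
  have "u \<cdot> a = Zero \<A> D' Y" using torsion_pairD(5)[OF t D(1) Y Comp_closed[OF h(1) u]] .
  then obtain v where v: "\<langle>v : D'' \<rightarrow> Y\<rangle>" "v \<cdot> b = u" by (rule ses_extend[OF s u])
  have "v = Zero \<A> D'' Y" using torsion_pairD(5)[OF t D(2) Y v(1)] .
  then show "u = Zero \<A> A Y" using v(2) h(2) hom_Ob[OF u] by (auto simp: hom_iff)
qed

lemma torsion_class_direct_sum:
  assumes t: "torsion_pair \<A> \<D> \<F>" and S: "is_direct_sum \<A> I X S \<iota> \<pi>" and X: "X ` I \<subseteq> \<D>"
  shows "S \<in> \<D>"
proof (rule torsion_classI[OF t])
  show SO: "S \<in> Ob \<A>" using S by (simp add: is_direct_sum_def)
  fix Y u assume Y: "Y \<in> \<F>" and u: "\<langle>u : S \<rightarrow> Y\<rangle>"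
  have ob: "Y \<in> Ob \<A>" using hom_Ob[OF u] by simp
  \<comment> \<open>A map out of \<open>S\<close> that lifts through a zero arrow vanishes.\<close>
  have lift: "\<exists>h. \<langle>h : X k \<rightarrow> S\<rangle> \<and> Zero \<A> S Y \<cdot> h = u \<cdot> \<iota> k" if k: "k \<in> I" for k
  proof -
    have i: "\<langle>\<iota> k : X k \<rightarrow> S\<rangle>" and Xk: "X k \<in> \<D>" using S X k by (auto simp: is_direct_sum_def)
    have "u \<cdot> \<iota> k = Zero \<A> (X k) Y" using torsion_pairD(5)[OF t Xk Y Comp_closed[OF i u]] .
    then show ?thesis using i ob by (intro exI[of _ "\<iota> k"]) (simp add: hom_iff)
  qed
  obtain h where "\<langle>h : S \<rightarrow> S\<rangle>" "Zero \<A> S Y \<cdot> h = u"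
    using direct_sum_lift[OF S u zero_in_hom[OF SO ob] lift] by metis
  then show "u = Zero \<A> S Y" using ob by (auto simp: hom_iff)
qed

end

section \<open>Support tau-tilting subcategories and their torsion triples\<close>

context abelian_category_enough_projectives
begin

lemma left_approximationD:
  assumes "left_approximation \<A> \<X> A f" "\<langle>f : A \<rightarrow> X\<rangle>" "X' \<in> \<X>" "\<langle>g : A \<rightarrow> X'\<rangle>"
  obtains h where "\<langle>h : X \<rightarrow> X'\<rangle>" "h \<cdot> f = g"
proof -
  have "Cod \<A> f = X" using assms(2) by (simp add: hom_iff)
  moreover have "\<exists>h\<in>Hom \<A> (Cod \<A> f) X'. h \<cdot> f = g"
    using assms(1,3,4) unfolding left_approximation_def by blast
  ultimately show ?thesis using that by blast
qed

lemma left_approximationI: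
  assumes "\<langle>f : A \<rightarrow> X\<rangle>" "X \<in> \<X>"
    and "\<And>X' g. X' \<in> \<X> \<Longrightarrow> \<langle>g : A \<rightarrow> X'\<rangle> \<Longrightarrow> \<exists>h. \<langle>h : X \<rightarrow> X'\<rangle> \<and> h \<cdot> f = g"
  shows "left_approximation \<A> \<X> A f"
proof -
  have "f \<in> Arr \<A>" "Dom \<A> f = A" "Cod \<A> f = X" using assms(1) by (auto simp: hom_iff)
  then show ?thesis unfolding left_approximation_def Bex_def using assms(2,3) by simp
qed

lemma right_approximation_obtain:
  assumes "contravariantly_finite \<A> \<X>" "A \<in> Ob \<A>"
  obtains X f where "X \<in> \<X>" "\<langle>f : X \<rightarrow> A\<rangle>"
    "\<And>X' g. X' \<in> \<X> \<Longrightarrow> \<langle>g : X' \<rightarrow> A\<rangle> \<Longrightarrow> \<exists>h. \<langle>h : X' \<rightarrow> X\<rangle> \<and> f \<cdot> h = g"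
proof -
  obtain f where f: "right_approximation \<A> \<X> A f" using assms unfolding contravariantly_finite_def by blast
  show ?thesis
    using f that[of "Dom \<A> f" f] unfolding right_approximation_def Bex_def by (simp add: hom_iff)
qed

lemma right_approximationI:
  assumes "\<langle>f : X \<rightarrow> A\<rangle>" "X \<in> \<X>"
    and "\<And>X' g. X' \<in> \<X> \<Longrightarrow> \<langle>g : X' \<rightarrow> A\<rangle> \<Longrightarrow> \<exists>h. \<langle>h : X' \<rightarrow> X\<rangle> \<and> f \<cdot> h = g"
  shows "right_approximation \<A> \<X> A f"
proof -
  have "f \<in> Arr \<A>" "Dom \<A> f = X" "Cod \<A> f = A" using assms(1) by (auto simp: hom_iff)
  then show ?thesis unfolding right_approximation_def Bex_def using assms(2,3) by simp
qed

lemma id_epi: "A \<in> Ob \<A> \<Longrightarrow> is_epi \<A> (Id \<A> A)"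
  using epi_of_section[of "Id \<A> A" A A "Id \<A> A"] Id_closed by (simp add: hom_iff)

lemma FacI: "X \<in> \<X> \<Longrightarrow> \<langle>e : X \<rightarrow> A\<rangle> \<Longrightarrow> is_epi \<A> e \<Longrightarrow> A \<in> Fac \<A> \<X>"
  using hom_Ob unfolding Fac_def by blast

lemma FacE:
  assumes "A \<in> Fac \<A> \<X>"
  obtains X e where "X \<in> \<X>" "\<langle>e : X \<rightarrow> A\<rangle>" "is_epi \<A> e"
  using assms unfolding Fac_def by blast

lemma Fac_sub_Ob: "Fac \<A> \<X> \<subseteq> Ob \<A>"
  by (auto simp: Fac_def)

lemma sub_Fac: "\<X> \<subseteq> Ob \<A> \<Longrightarrow> \<X> \<subseteq> Fac \<A> \<X>"
  using FacI Id_closed id_epi by blast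

lemma Fac_quotient:
  assumes "D \<in> Fac \<A> \<X>" "\<langle>e : D \<rightarrow> A\<rangle>" "is_epi \<A> e"
  shows "A \<in> Fac \<A> \<X>"
proof -
  obtain X e' where X: "X \<in> \<X>" "\<langle>e' : X \<rightarrow> D\<rangle>" "is_epi \<A> e'" by (rule FacE[OF assms(1)])
  show ?thesis using FacI[OF X(1) Comp_closed[OF X(2) assms(2)] comp_epi[OF X(3) assms(3) X(2) assms(2)]] .
qed

lemma Fac_subcategory: "subcategory \<A> (Fac \<A> \<X>)"
  unfolding subcategory_def
proof (intro conjI ballI impI Fac_sub_Ob)
  fix A B assume A: "A \<in> Fac \<A> \<X>" and iso: "isomorphic \<A> A B"
  obtain f g where fg: "\<langle>f : A \<rightarrow> B\<rangle>" "\<langle>g : B \<rightarrow> A\<rangle>" "g \<cdot> f = Id \<A> A" "f \<cdot> g = Id \<A> B" by (rule isoD[OF iso])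
  show "B \<in> Fac \<A> \<X>" using Fac_quotient[OF A fg(1) epi_of_section[OF fg(1,2,4)]] .
qed

lemma right_perp_0_iff:
  assumes "\<X> \<subseteq> Ob \<A>"
  shows "A \<in> right_perp \<A> 0 \<X> \<longleftrightarrow> A \<in> Ob \<A> \<and> (\<forall>X\<in>\<X>. \<forall>u. \<langle>u : X \<rightarrow> A\<rangle> \<longrightarrow> u = Zero \<A> X A)"
  using assms Ext_zero_0_iff[of _ A] by (auto simp: right_perp_def)

lemma right_perp_0_subcategory:
  assumes "\<X> \<subseteq> Ob \<A>"
  shows "subcategory \<A> (right_perp \<A> 0 \<X>)"
  unfolding subcategory_def
proof (intro conjI ballI impI)
  show "right_perp \<A> 0 \<X> \<subseteq> Ob \<A>" by (auto simp: right_perp_def)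
  fix A B assume A: "A \<in> right_perp \<A> 0 \<X>" and B: "B \<in> Ob \<A>" and iso: "isomorphic \<A> A B"
  obtain f g where fg: "\<langle>f : A \<rightarrow> B\<rangle>" "\<langle>g : B \<rightarrow> A\<rangle>" "g \<cdot> f = Id \<A> A" "f \<cdot> g = Id \<A> B" by (rule isoD[OF iso])
  have "u = Zero \<A> X B" if X: "X \<in> \<X>" and u: "\<langle>u : X \<rightarrow> B\<rangle>" for X u
  proof -
    have "g \<cdot> u = Zero \<A> X A" using A X Comp_closed[OF u fg(2)] right_perp_0_iff[OF assms] by blast
    then have "f \<cdot> (g \<cdot> u) = Zero \<A> X B" using fg(1) hom_Ob[OF u] by (simp add: hom_iff)
    then show ?thesis using comp_through[OF fg(4,2,1) u] u by (simp add: hom_iff)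
  qed
  then show "B \<in> right_perp \<A> 0 \<X>" using B right_perp_0_iff[OF assms] by blast
qed

lemma object_in_sums_of_copies:
  assumes "T \<in> Ob \<A>"
  shows "T \<in> sums_of_copies \<A> T"
proof -
  have "finprod (Hom_group \<A> T T) (\<lambda>_. Id \<A> T) {0::nat} = Id \<A> T"
    using finprod_insert_hom[of "{}" "0::nat" "\<lambda>_. Id \<A> T" T T] add_zero[OF Id_closed[OF assms]] Id_closed[OF assms]
    by (simp add: finprod_empty_hom[OF assms assms])
  then have "is_direct_sum \<A> {0} (\<lambda>_. T) T (\<lambda>_. Id \<A> T) (\<lambda>_. Id \<A> T)"
    using assms by (simp add: is_direct_sum_def hom_iff)
  then show ?thesis unfolding sums_of_copies_def by blast
qed

lemma stt_props:
  assumes "support_tau_tilting \<A> \<T>"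
  shows "\<T> \<subseteq> Ob \<A>" "subcategory \<A> \<T>" "closed_direct_sums \<A> \<T>" "closed_direct_summands \<A> \<T>"
    "contravariantly_finite \<A> \<T>"
    "T \<in> \<T> \<Longrightarrow> Y \<in> Fac \<A> \<T> \<Longrightarrow> Ext_zero \<A> 1 T Y"
proof -
  show 1: "\<T> \<subseteq> Ob \<A>" "subcategory \<A> \<T>" "closed_direct_sums \<A> \<T>" "closed_direct_summands \<A> \<T>"
    "contravariantly_finite \<A> \<T>"
    using assms by (auto simp: support_tau_tilting_def subcategory_def)
  assume T: "T \<in> \<T>" "Y \<in> Fac \<A> \<T>"
  obtain X e where X: "X \<in> \<T>" "\<langle>e : X \<rightarrow> Y\<rangle>" "is_epi \<A> e" by (rule FacE[OF T(2)])
  have "Y \<in> Fac_object \<A> X" unfolding Fac_object_def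
    using FacI[OF object_in_sums_of_copies X(2,3)] X(1) 1(1) by blast
  then show "Ext_zero \<A> 1 T Y" using assms T(1) X(1) unfolding support_tau_tilting_def by blast
qed

lemma stt_sequence:
  assumes "support_tau_tilting \<A> \<T>" "projective \<A> P"
  obtains T0 T1 f g where "T0 \<in> \<T>" "T1 \<in> \<T>" "right_exact_seq \<A> P f T0 g T1" "left_approximation \<A> \<T> P f"
  using assms unfolding support_tau_tilting_def by blast

text \<open>
  The torsion part of \<open>A\<close> is the image \<open>I\<close> of a right approximation \<open>X \<rightarrow> A\<close>: a map \<open>T \<rightarrow> A/I\<close> lifts to \<open>A\<close>
  because \<open>Ext\<^sup>1(T, I) = 0\<close>, and then factors through \<open>X\<close>, hence through \<open>I\<close>.
\<close>

lemma torsion_pair_Fac: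
  assumes sub: "\<T> \<subseteq> Ob \<A>" and cf: "contravariantly_finite \<A> \<T>"
    and E: "\<And>T Y. T \<in> \<T> \<Longrightarrow> Y \<in> Fac \<A> \<T> \<Longrightarrow> Ext_zero \<A> 1 T Y"
  shows "torsion_pair \<A> (Fac \<A> \<T>) (right_perp \<A> 0 \<T>)"
  unfolding torsion_pair_def
proof (intro conjI ballI Fac_subcategory right_perp_0_subcategory[OF sub])
  fix D F assume D: "D \<in> Fac \<A> \<T>" and F: "F \<in> right_perp \<A> 0 \<T>"
  obtain X e where X: "X \<in> \<T>" "\<langle>e : X \<rightarrow> D\<rangle>" "is_epi \<A> e" by (rule FacE[OF D])
  have ob: "D \<in> Ob \<A>" "F \<in> Ob \<A>" using D F Fac_sub_Ob by (auto simp: right_perp_def)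
  have "u = Zero \<A> D F" if u: "\<langle>u : D \<rightarrow> F\<rangle>" for u
  proof -
    have "u \<cdot> e = Zero \<A> X F" using F right_perp_0_iff[OF sub] X(1) Comp_closed[OF X(2) u] by blast
    then show ?thesis using epi_zero[OF X(3,2) u] by simp
  qed
  then show "Ext_zero \<A> 0 D F" using Ext_zero_0_iff[OF ob] by blast
next
  fix A assume A: "A \<in> Ob \<A>"
  obtain X f where X: "X \<in> \<T>" and f: "\<langle>f : X \<rightarrow> A\<rangle>"
    and ap: "\<And>X' g. X' \<in> \<T> \<Longrightarrow> \<langle>g : X' \<rightarrow> A\<rangle> \<Longrightarrow> \<exists>h. \<langle>h : X' \<rightarrow> X\<rangle> \<and> f \<cdot> h = g"
    using right_approximation_obtain[OF cf A] by metis
  obtain I p j where p: "\<langle>p : X \<rightarrow> I\<rangle>" "is_epi \<A> p" and j: "\<langle>j : I \<rightarrow> A\<rangle>" "is_mono \<A> j" and jp: "j \<cdot> p = f"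
    by (rule image_factorisation[OF f])
  have I: "I \<in> Fac \<A> \<T>" using FacI[OF X p] .
  obtain F g where s: "short_exact_seq \<A> I j A g F" by (rule ses_of_mono[OF j])
  note h = sesD[OF s]
  have "u = Zero \<A> T F" if T: "T \<in> \<T>" and u: "\<langle>u : T \<rightarrow> F\<rangle>" for T u
  proof -
    obtain u' where u': "\<langle>u' : T \<rightarrow> A\<rangle>" "g \<cdot> u' = u" by (rule ext1_lift[OF E[OF T I] s u])
    obtain v where v: "\<langle>v : T \<rightarrow> X\<rangle>" "f \<cdot> v = u'" using ap[OF T u'(1)] by blast
    have "u' = j \<cdot> (p \<cdot> v)" using comp_through[OF jp p(1) j(1) v(1)] v(2) by simp
    then have "u = (g \<cdot> j) \<cdot> (p \<cdot> v)" using u'(2) h(2) j(1) p(1) v(1) by (simp add: hom_iff)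
    then show ?thesis unfolding h(6) using p(1) v(1) hom_Ob[OF h(2)] by (simp add: hom_iff)
  qed
  then have "F \<in> right_perp \<A> 0 \<T>" using right_perp_0_iff[OF sub] hom_Ob[OF h(2)] by blast
  then show "\<exists>D\<in>Fac \<A> \<T>. \<exists>F\<in>right_perp \<A> 0 \<T>. \<exists>f g. short_exact_seq \<A> D f A g F" using I s by blast
qed

text \<open>
  The approximation property gives \<open>Ext\<^sup>1(\<T>, K) = 0\<close>. For a support tau-tilting subcategory this alone
  does not put \<open>K\<close> into \<open>Fac \<T>\<close>, but \<open>K\<close> is also a subobject of \<open>X \<in> \<T>\<close>. Take an epimorphism \<open>r : P \<rightarrow> K\<close>
  and \<open>P \<rightarrow> T0 \<rightarrow> T1 \<rightarrow> 0\<close>. The composite \<open>P \<rightarrow> K \<rightarrow> X\<close> factors through \<open>P \<rightarrow> T0\<close>, so \<open>r\<close> vanishes on the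
  kernel of \<open>P \<rightarrow> T0\<close> and factors through the image \<open>J\<close> of \<open>P\<close> in \<open>T0\<close>. As \<open>Ext\<^sup>1(T1, K) = 0\<close>, the map
  \<open>J \<rightarrow> K\<close> extends to an epimorphism \<open>T0 \<rightarrow> K\<close>.
\<close>

lemma kernel_of_approximation_in_Fac:
  assumes t: "support_tau_tilting \<A> \<T>" and s: "short_exact_seq \<A> K k X f A" and X: "X \<in> \<T>"
    and ap: "\<And>X' g. X' \<in> \<T> \<Longrightarrow> \<langle>g : X' \<rightarrow> A\<rangle> \<Longrightarrow> \<exists>h. \<langle>h : X' \<rightarrow> X\<rangle> \<and> f \<cdot> h = g"
  shows "K \<in> Fac \<A> \<T>"
proof -
  note T = stt_props[OF t] and h = sesD[OF s]
  have ob: "K \<in> Ob \<A>" "X \<in> Ob \<A>" "A \<in> Ob \<A>" using hom_Ob h by auto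
  have EK: "Ext_zero \<A> 1 T K" if TT: "T \<in> \<T>" for T
  proof (rule ext1I_extend)
    show "T \<in> Ob \<A>" "K \<in> Ob \<A>" using TT T(1) ob by auto
    fix U V i c u assume w: "short_exact_seq \<A> U i V c T" and u: "\<langle>u : U \<rightarrow> K\<rangle>"
    note l = sesD[OF w]
    \<comment> \<open>Correct an extension \<open>m\<close> of \<open>k \<cdot> u\<close> by a map through \<open>c\<close> so that it lands in \<open>K\<close>.\<close>
    have XF: "X \<in> Fac \<A> \<T>" using sub_Fac[OF T(1)] X by blast
    obtain m where m: "\<langle>m : V \<rightarrow> X\<rangle>" "m \<cdot> i = k \<cdot> u"
      by (rule ext1_extend[OF T(6)[OF TT XF] w Comp_closed[OF u h(1)]])
    have fm: "\<langle>f \<cdot> m : V \<rightarrow> A\<rangle>" using Comp_closed[OF m(1) h(2)] .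
    have "(f \<cdot> m) \<cdot> i = (f \<cdot> k) \<cdot> u" using m h(1,2) l(1) u by (simp add: hom_iff)
    also have "\<dots> = Zero \<A> U A" unfolding h(6) using u ob by (simp add: hom_iff)
    finally obtain g where g: "\<langle>g : T \<rightarrow> A\<rangle>" "g \<cdot> c = f \<cdot> m" by (rule ses_extend[OF w fm])
    obtain g' where g': "\<langle>g' : T \<rightarrow> X\<rangle>" "f \<cdot> g' = g" using ap[OF TT g(1)] by blast
    have gc: "\<langle>g' \<cdot> c : V \<rightarrow> X\<rangle>" using Comp_closed[OF l(2) g'(1)] .
    have "f \<cdot> (g' \<cdot> c) = f \<cdot> m" using comp_through[OF g'(2,1) h(2) l(2)] g(2) by simp
    then have "f \<cdot> (m \<ominus> g' \<cdot> c) = Zero \<A> V A"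
      using m(1) gc h(2) sub_self[OF fm] by (simp add: hom_iff)
    then obtain v where v: "\<langle>v : V \<rightarrow> K\<rangle>" "k \<cdot> v = m \<ominus> g' \<cdot> c" by (rule ses_lift[OF s sub_in_hom[OF m(1) gc]])
    have "k \<cdot> (v \<cdot> i) = (m \<ominus> g' \<cdot> c) \<cdot> i" using comp_through[OF v(2,1) h(1) l(1)] .
    also have "\<dots> = k \<cdot> u \<ominus> g' \<cdot> (c \<cdot> i)" using m gc g'(1) l(1,2) by (simp add: hom_iff)
    also have "\<dots> = k \<cdot> u"
      unfolding l(6) using sub_zero[OF Comp_closed[OF u h(1)]] g'(1) hom_Ob[OF u] by (simp add: hom_iff)
    finally have "v \<cdot> i = u" using mono_cancel[OF h(3,1) Comp_closed[OF l(1) v(1)] u] by simp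
    then show "\<exists>v. \<langle>v : V \<rightarrow> K\<rangle> \<and> v \<cdot> i = u" using v by blast
  qed
  obtain P r where P: "projective \<A> P" and r: "\<langle>r : P \<rightarrow> K\<rangle>" "is_epi \<A> r" by (rule projective_presentation[OF ob(1)])
  obtain T0 T1 f0 g0 where T0: "T0 \<in> \<T>" "T1 \<in> \<T>" and e: "right_exact_seq \<A> P f0 T0 g0 T1"
    and la: "left_approximation \<A> \<T> P f0" by (rule stt_sequence[OF t P])
  have f0: "\<langle>f0 : P \<rightarrow> T0\<rangle>" and g0: "\<langle>g0 : T0 \<rightarrow> T1\<rangle>" "is_epi \<A> g0" and ex: "exact_at \<A> f0 g0"
    using e by (auto simp: right_exact_seq_def)
  obtain s0 where s0: "\<langle>s0 : T0 \<rightarrow> X\<rangle>" "s0 \<cdot> f0 = k \<cdot> r"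
    by (rule left_approximationD[OF la f0 X Comp_closed[OF r(1) h(1)]])
  obtain J p j where p: "\<langle>p : P \<rightarrow> J\<rangle>" "is_epi \<A> p" and j: "\<langle>j : J \<rightarrow> T0\<rangle>" "is_mono \<A> j" and jp: "j \<cdot> p = f0"
    by (rule image_factorisation[OF f0])
  have w: "short_exact_seq \<A> J j T0 g0 T1"
  proof (rule sesI[OF j g0])
    have "(g0 \<cdot> j) \<cdot> p = Zero \<A> P T1" using exact_zero[OF ex f0 g0(1)] jp j p g0 by (simp add: hom_iff)
    then show "g0 \<cdot> j = Zero \<A> J T1" using epi_zero[OF p(2,1) Comp_closed[OF j(1) g0(1)]] by simp
    fix Q y assume Q: "projective \<A> Q" and y: "\<langle>y : Q \<rightarrow> T0\<rangle>" "g0 \<cdot> y = Zero \<A> Q T1"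
    obtain x where x: "\<langle>x : Q \<rightarrow> P\<rangle>" "f0 \<cdot> x = y" using exact_lift[OF ex f0 g0(1) Q y] by blast
    show "\<exists>x. \<langle>x : Q \<rightarrow> J\<rangle> \<and> j \<cdot> x = y"
      using comp_through[OF jp p(1) j(1) x(1)] x(2) Comp_closed[OF x(1) p(1)] by blast
  qed
  obtain r' where r': "\<langle>r' : J \<rightarrow> K\<rangle>" "r' \<cdot> p = r"
  proof (rule factor_through_epi[OF p r(1)])
    fix Q y assume y: "\<langle>y : Q \<rightarrow> P\<rangle>" and py: "p \<cdot> y = Zero \<A> Q J"
    have Q: "Q \<in> Ob \<A>" using hom_Ob[OF y] by simp
    have "f0 \<cdot> y = Zero \<A> Q T0" using comp_through[OF jp p(1) j(1) y] py j(1) Q by (simp add: hom_iff)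
    then have "(k \<cdot> r) \<cdot> y = Zero \<A> Q X" using comp_through[OF s0(2) f0 s0(1) y] s0(1) Q by (simp add: hom_iff)
    then have "k \<cdot> (r \<cdot> y) = Zero \<A> Q X" using h(1) r(1) y by (simp add: hom_iff)
    then show "r \<cdot> y = Zero \<A> Q K" using mono_zero[OF h(3,1) Comp_closed[OF y r(1)]] by simp
  qed
  obtain r'' where r'': "\<langle>r'' : T0 \<rightarrow> K\<rangle>" "r'' \<cdot> j = r'" by (rule ext1_extend[OF EK[OF T0(2)] w r'(1)])
  have "r'' \<cdot> f0 = r" using comp_through[OF r''(2) j(1) r''(1) p(1)] jp r'(2) by simp
  then have "is_epi \<A> r''" using epi_of_comp[OF _ f0 r''(1)] r(2) by simp
  then show ?thesis using FacI[OF T0(1) r''(1)] by simp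
qed

text \<open>
  Objects of the left-hand side split off from their right \<open>\<T>\<close>-approximation.
\<close>

lemma stt_left_perp_inter_Fac:
  assumes t: "support_tau_tilting \<A> \<T>"
  shows "left_perp \<A> 1 (Fac \<A> \<T>) \<inter> Fac \<A> \<T> = \<T>"
proof
  note T = stt_props[OF t]
  show "\<T> \<subseteq> left_perp \<A> 1 (Fac \<A> \<T>) \<inter> Fac \<A> \<T>"
    using sub_Fac[OF T(1)] T(1,6) by (auto simp: left_perp_def)
  show "left_perp \<A> 1 (Fac \<A> \<T>) \<inter> Fac \<A> \<T> \<subseteq> \<T>"
  proof
    fix A assume "A \<in> left_perp \<A> 1 (Fac \<A> \<T>) \<inter> Fac \<A> \<T>"
    then have A: "A \<in> Ob \<A>" "A \<in> Fac \<A> \<T>" and E: "\<And>Y. Y \<in> Fac \<A> \<T> \<Longrightarrow> Ext_zero \<A> 1 A Y"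
      by (auto simp: left_perp_def)
    obtain X f where X: "X \<in> \<T>" and f: "\<langle>f : X \<rightarrow> A\<rangle>"
      and ap: "\<And>X' g. X' \<in> \<T> \<Longrightarrow> \<langle>g : X' \<rightarrow> A\<rangle> \<Longrightarrow> \<exists>h. \<langle>h : X' \<rightarrow> X\<rangle> \<and> f \<cdot> h = g"
      using right_approximation_obtain[OF T(5) A(1)] by metis
    obtain Y e where Y: "Y \<in> \<T>" "\<langle>e : Y \<rightarrow> A\<rangle>" "is_epi \<A> e" by (rule FacE[OF A(2)])
    obtain h where "\<langle>h : Y \<rightarrow> X\<rangle>" "f \<cdot> h = e" using ap[OF Y(1,2)] by blast
    then have fe: "is_epi \<A> f" using epi_of_comp f Y(3) by metis
    obtain K k where s: "short_exact_seq \<A> K k X f A" by (rule ses_of_epi[OF f fe])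
    have "K \<in> Fac \<A> \<T>" using kernel_of_approximation_in_Fac[OF t s X ap] .
    then obtain v where v: "\<langle>v : A \<rightarrow> X\<rangle>" "f \<cdot> v = Id \<A> A" by (rule ext1_lift[OF E s Id_closed[OF A(1)]])
    obtain \<iota> \<pi> where "is_direct_sum \<A> {0, Suc 0} (\<lambda>n. if n = 0 then A else K) X \<iota> \<pi>"
      by (rule split_ses_direct_sum[OF s v])
    then have "(\<lambda>n. if n = 0 then A else K) ` {0, Suc 0} \<subseteq> \<T>"
      using T(4) X unfolding closed_direct_summands_def by blast
    then show "A \<in> \<T>" by auto
  qed
qed

lemma stt_imp_tau_cotorsion_torsion:
  assumes t: "support_tau_tilting \<A> \<T>"
  shows "tau_cotorsion_torsion_triple \<A> (left_perp \<A> 1 (Fac \<A> \<T>)) (Fac \<A> \<T>) (right_perp \<A> 0 \<T>)"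
proof -
  note T = stt_props[OF t] and eq = stt_left_perp_inter_Fac[OF t]
  have "\<exists>D\<in>\<T>. \<exists>C\<in>left_perp \<A> 1 (Fac \<A> \<T>). \<exists>f g.
      right_exact_seq \<A> P f D g C \<and> left_approximation \<A> (Fac \<A> \<T>) P f" if P: "projective \<A> P" for P
  proof -
    obtain T0 T1 f g where T0: "T0 \<in> \<T>" "T1 \<in> \<T>" and e: "right_exact_seq \<A> P f T0 g T1"
      and la: "left_approximation \<A> \<T> P f" by (rule stt_sequence[OF t P])
    have f: "\<langle>f : P \<rightarrow> T0\<rangle>" using e by (simp add: right_exact_seq_def)
    have "left_approximation \<A> (Fac \<A> \<T>) P f"
    proof (rule left_approximationI[OF f])
      show "T0 \<in> Fac \<A> \<T>" using sub_Fac[OF T(1)] T0(1) by blast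
      fix Y u assume Y: "Y \<in> Fac \<A> \<T>" and u: "\<langle>u : P \<rightarrow> Y\<rangle>"
      obtain X e where X: "X \<in> \<T>" "\<langle>e : X \<rightarrow> Y\<rangle>" "is_epi \<A> e" by (rule FacE[OF Y])
      obtain x where x: "\<langle>x : P \<rightarrow> X\<rangle>" "e \<cdot> x = u" by (rule projective_lift[OF P X(3,2) u])
      obtain h where h: "\<langle>h : T0 \<rightarrow> X\<rangle>" "h \<cdot> f = x" by (rule left_approximationD[OF la f X(1) x(1)])
      have "(e \<cdot> h) \<cdot> f = u" using h x(2) X(2) f by (simp add: hom_iff)
      then show "\<exists>h. \<langle>h : T0 \<rightarrow> Y\<rangle> \<and> h \<cdot> f = u" using Comp_closed[OF h(1) X(2)] by blast
    qed
    moreover have "T1 \<in> left_perp \<A> 1 (Fac \<A> \<T>)" using eq T0(2) by blast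
    ultimately show ?thesis using T0(1) e by blast
  qed
  then show ?thesis
    unfolding tau_cotorsion_torsion_triple_def eq
    using left_perp_subcategory[OF Fac_sub_Ob] Fac_subcategory right_perp_0_subcategory[OF T(1)] T(5)
      torsion_pair_Fac[OF T(1,5,6)] by simp
qed

lemma tau_cotorsion_torsion_props:
  assumes "tau_cotorsion_torsion_triple \<A> \<C> \<D> \<F>"
  shows "torsion_pair \<A> \<D> \<F>" "\<C> = left_perp \<A> 1 \<D>" "\<D> \<subseteq> Ob \<A>" "\<C> \<inter> \<D> \<subseteq> Ob \<A>"
    "contravariantly_finite \<A> (\<C> \<inter> \<D>)"
    "C \<in> \<C> \<Longrightarrow> Y \<in> \<D> \<Longrightarrow> Ext_zero \<A> 1 C Y"
  using assms by (auto simp: tau_cotorsion_torsion_triple_def subcategory_def left_perp_def)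

lemma tau_sequence:
  assumes c: "tau_cotorsion_torsion_triple \<A> \<C> \<D> \<F>" and P: "projective \<A> P"
  obtains D C f g where "D \<in> \<C> \<inter> \<D>" "C \<in> \<C>" "right_exact_seq \<A> P f D g C" "left_approximation \<A> \<D> P f"
  using assms unfolding tau_cotorsion_torsion_triple_def by blast

lemma left_perp_inter_torsion_class_closed:
  assumes t: "torsion_pair \<A> \<D> \<F>"
  shows "subcategory \<A> (left_perp \<A> 1 \<D> \<inter> \<D>)" "closed_direct_sums \<A> (left_perp \<A> 1 \<D> \<inter> \<D>)"
    "closed_direct_summands \<A> (left_perp \<A> 1 \<D> \<inter> \<D>)"
proof -
  note T = torsion_pairD[OF t]
  show "subcategory \<A> (left_perp \<A> 1 \<D> \<inter> \<D>)"
    using left_perp_subcategory[OF T(1)] T(3) unfolding subcategory_def by blast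
  show "closed_direct_sums \<A> (left_perp \<A> 1 \<D> \<inter> \<D>)"
    unfolding closed_direct_sums_def
    using left_perp_direct_sum[OF T(1)] torsion_class_direct_sum[OF t] by (auto 4 3)
  show "closed_direct_summands \<A> (left_perp \<A> 1 \<D> \<inter> \<D>)"
    unfolding closed_direct_summands_def
  proof (intro allI impI subsetI, elim conjE imageE IntE)
    fix I X S \<iota> \<pi> Y k
    assume S: "is_direct_sum \<A> I X S \<iota> \<pi>" and SC: "S \<in> left_perp \<A> 1 \<D>" and SD: "S \<in> \<D>" and Y: "Y = X k" "k \<in> I"
    have k: "\<langle>\<iota> k : X k \<rightarrow> S\<rangle>" "\<langle>\<pi> k : S \<rightarrow> X k\<rangle>" "\<pi> k \<cdot> \<iota> k = Id \<A> (X k)"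
      using S Y(2) by (auto simp: is_direct_sum_def)
    show "Y \<in> left_perp \<A> 1 \<D> \<inter> \<D>"
      using left_perp_direct_summand[OF T(1) S SC Y(2)]
        torsion_class_quotient[OF t SD k(2) epi_of_section[OF k(2,1,3)]] Y(1) by simp
  qed
qed

text \<open>
  In \<open>P \<rightarrow> D \<rightarrow> C \<rightarrow> 0\<close> the term \<open>C\<close> lies in \<open>\<D>\<close> as a quotient of \<open>D\<close>, so both terms lie in \<open>\<C> \<inter> \<D>\<close>.
\<close>

lemma tau_cotorsion_torsion_imp_stt:
  assumes c: "tau_cotorsion_torsion_triple \<A> \<C> \<D> \<F>"
  shows "support_tau_tilting \<A> (\<C> \<inter> \<D>)"
proof -
  note p = tau_cotorsion_torsion_props[OF c]
  have "Ext_zero \<A> 1 T1 Y" if T: "T1 \<in> \<C> \<inter> \<D>" "T2 \<in> \<C> \<inter> \<D>" and Y: "Y \<in> Fac_object \<A> T2" for T1 T2 Y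
  proof -
    obtain S e where S: "S \<in> sums_of_copies \<A> T2" "\<langle>e : S \<rightarrow> Y\<rangle>" "is_epi \<A> e"
      using FacE Y unfolding Fac_object_def by metis
    obtain I \<iota> \<pi> where s: "is_direct_sum \<A> I (\<lambda>_. T2) S \<iota> \<pi>" using S(1) unfolding sums_of_copies_def by blast
    have "S \<in> \<D>" using torsion_class_direct_sum[OF p(1) s] T(2) by auto
    then have "Y \<in> \<D>" using torsion_class_quotient[OF p(1) _ S(2,3)] by simp
    then show ?thesis using p(6) T(1) by blast
  qed
  moreover have "\<exists>T0\<in>\<C> \<inter> \<D>. \<exists>T1\<in>\<C> \<inter> \<D>. \<exists>f g. right_exact_seq \<A> P f T0 g T1 \<and> left_approximation \<A> (\<C> \<inter> \<D>) P f"
    if P: "projective \<A> P" for P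
  proof -
    obtain D C f g where D: "D \<in> \<C> \<inter> \<D>" "C \<in> \<C>" and s: "right_exact_seq \<A> P f D g C"
      and la: "left_approximation \<A> \<D> P f" by (rule tau_sequence[OF c P])
    have g: "\<langle>g : D \<rightarrow> C\<rangle>" "is_epi \<A> g" using s by (auto simp: right_exact_seq_def)
    have "C \<in> \<D>" using torsion_class_quotient[OF p(1) _ g] D(1) by blast
    moreover have "left_approximation \<A> (\<C> \<inter> \<D>) P f"
      using la D(1) s unfolding left_approximation_def right_exact_seq_def hom_iff by blast
    ultimately show ?thesis using D s by blast
  qed
  ultimately show ?thesis
    unfolding support_tau_tilting_def
    using left_perp_inter_torsion_class_closed[OF p(1), folded p(2)] p(5) by blast
qed

text \<open>
  Each \<open>D \<in> \<D>\<close> is a quotient of the left \<open>\<D>\<close>-approximation of a projective mapping onto it. This gives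
  \<open>Fac (\<C> \<inter> \<D>) = \<D>\<close>, and the torsion-free class is then determined.
\<close>

lemma tau_cotorsion_torsion_Phi_Psi:
  assumes c: "tau_cotorsion_torsion_triple \<A> \<C> \<D> \<F>"
  shows "Phi \<A> (\<C> \<inter> \<D>) = (\<C>, \<D>, \<F>)"
proof -
  note p = tau_cotorsion_torsion_props[OF c] and q = torsion_pairD[OF tau_cotorsion_torsion_props(1)[OF c]]
  have D: "Fac \<A> (\<C> \<inter> \<D>) = \<D>"
  proof
    show "Fac \<A> (\<C> \<inter> \<D>) \<subseteq> \<D>" using FacE torsion_class_quotient[OF p(1)] by (metis IntE subsetI)
    show "\<D> \<subseteq> Fac \<A> (\<C> \<inter> \<D>)"
    proof
      fix D assume D: "D \<in> \<D>"
      obtain P e where P: "projective \<A> P" "\<langle>e : P \<rightarrow> D\<rangle>" "is_epi \<A> e"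
        using projective_presentation p(3) D by blast
      obtain D0 C f g where D0: "D0 \<in> \<C> \<inter> \<D>" and s: "right_exact_seq \<A> P f D0 g C"
        and la: "left_approximation \<A> \<D> P f" by (rule tau_sequence[OF c P(1)])
      have f: "\<langle>f : P \<rightarrow> D0\<rangle>" using s by (simp add: right_exact_seq_def)
      obtain h where h: "\<langle>h : D0 \<rightarrow> D\<rangle>" "h \<cdot> f = e" by (rule left_approximationD[OF la f D P(2)])
      show "D \<in> Fac \<A> (\<C> \<inter> \<D>)" using FacI[OF D0 h(1)] epi_of_comp[OF _ f h(1)] h(2) P(3) by simp
    qed
  qed
  have F: "right_perp \<A> 0 (\<C> \<inter> \<D>) = \<F>"
  proof (intro equalityI subsetI)
    fix A assume A: "A \<in> right_perp \<A> 0 (\<C> \<inter> \<D>)"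
    show "A \<in> \<F>"
    proof (rule torsion_free_classI[OF p(1)])
      show "A \<in> Ob \<A>" using A by (simp add: right_perp_def)
      fix X u assume X: "X \<in> \<D>" and u: "\<langle>u : X \<rightarrow> A\<rangle>"
      obtain T e where T: "T \<in> \<C> \<inter> \<D>" "\<langle>e : T \<rightarrow> X\<rangle>" "is_epi \<A> e" using FacE X D by metis
      have "u \<cdot> e = Zero \<A> T A" using A right_perp_0_iff[OF p(4)] T(1) Comp_closed[OF T(2) u] by blast
      then show "u = Zero \<A> X A" using epi_zero[OF T(3,2) u] by simp
    qed
  next
    fix A assume A: "A \<in> \<F>"
    then have "u = Zero \<A> X A" if "X \<in> \<C> \<inter> \<D>" "\<langle>u : X \<rightarrow> A\<rangle>" for X u using that q(5) by blast
    then show "A \<in> right_perp \<A> 0 (\<C> \<inter> \<D>)" using right_perp_0_iff[OF p(4)] A q(2) by blast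
  qed
  show ?thesis unfolding Phi_def D F using p(2) by simp
qed

end

section \<open>Tilting subcategories and cotorsion torsion triples\<close>

context abelian_category_enough_projectives
begin

text \<open>
  With \<open>P 2 = 0\<close> every map on \<open>P 1\<close> is a cocycle, so cocycles with values in \<open>B'\<close> lift to cocycles with
  values in \<open>B\<close>.
\<close>

lemma ext1_quotient_of_pd_le_1:
  assumes pd: "proj_dim_le \<A> 1 A" and E: "Ext_zero \<A> 1 A B" and e: "\<langle>e : B \<rightarrow> B'\<rangle>" "is_epi \<A> e"
    and A: "A \<in> Ob \<A>"
  shows "Ext_zero \<A> 1 A B'"
proof -
  obtain P d where r: "projective_resolution \<A> A P d" and z: "\<And>i. i > 1 \<Longrightarrow> is_zero_object \<A> (P i)"
    using pd unfolding proj_dim_le_def by blast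
  have d1: "\<langle>d 1 : P 1 \<rightarrow> P 0\<rangle>" using resolutionD(4)[OF r, of 0] by simp
  note d2 = resolutionD(4)[OF r, of 1]
  have ob: "B \<in> Ob \<A>" "B' \<in> Ob \<A>" using hom_Ob[OF e(1)] by auto
  have c: "cocycles_extend P d 1 B" using E Ext_zero_1_iff_cocycles[OF A ob(1) r] by simp
  have "cocycles_extend P d 1 B'"
    unfolding cocycles_extend_def
  proof (intro allI impI, elim conjE)
    fix f assume f: "\<langle>f : P 1 \<rightarrow> B'\<rangle>"
    obtain f' where f': "\<langle>f' : P 1 \<rightarrow> B\<rangle>" "e \<cdot> f' = f" by (rule projective_lift[OF resolutionD(1)[OF r] e(2,1) f])
    have "\<exists>!h. \<langle>h : P (Suc 1) \<rightarrow> B\<rangle>" using z[of "Suc 1"] ob(1) unfolding is_zero_object_def by simp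
    then have "f' \<cdot> d (Suc 1) = Zero \<A> (P (Suc 1)) B"
      using Comp_closed[OF d2 f'(1)] zero_in_hom hom_Ob[OF d2] ob(1) by blast
    then obtain g where g: "\<langle>g : P 0 \<rightarrow> B\<rangle>" "g \<cdot> d 1 = f'"
      using c f'(1) unfolding cocycles_extend_def by auto
    have "(e \<cdot> g) \<cdot> d 1 = f" using g e(1) d1 f'(2) by (simp add: hom_iff)
    then show "\<exists>g. \<langle>g : P (1 - 1) \<rightarrow> B'\<rangle> \<and> g \<cdot> d 1 = f" using Comp_closed[OF g(1) e(1)] by auto
  qed
  then show ?thesis using Ext_zero_1_iff_cocycles[OF A ob(2) r] by simp
qed

lemma ex_zero_object: obtains Z where "is_zero_object \<A> Z"
proof -
  obtain S \<iota> \<pi> where S: "is_direct_sum \<A> {} (\<lambda>_::nat. undefined) S \<iota> \<pi>"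
    using finite_direct_sums[of "{}" "\<lambda>_::nat. undefined"] by auto
  have ob: "S \<in> Ob \<A>" using S by (simp add: is_direct_sum_def)
  have id0: "Zero \<A> S S = Id \<A> S"
    using S finprod_empty_hom[OF ob ob, of "\<lambda>k. \<iota> k \<cdot> \<pi> k"] by (simp add: is_direct_sum_def)
  have to0: "f = Zero \<A> A S" if "\<langle>f : A \<rightarrow> S\<rangle>" for f A
    using that id0 ob comp_id(2)[of f S] comp_zero(2)[of f S S] by (simp add: hom_iff)
  have from0: "f = Zero \<A> S A" if "\<langle>f : S \<rightarrow> A\<rangle>" for f A
    using that id0 ob comp_id(1)[of f S] comp_zero(1)[of f S S] by (simp add: hom_iff)
  have "is_zero_object \<A> S"
    unfolding is_zero_object_def using ob to0 from0 zero_in_hom by (metis (no_types, lifting))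
  then show ?thesis using that by blast
qed

lemma zero_objectD:
  assumes "is_zero_object \<A> Z"
  shows "Z \<in> Ob \<A>" "\<langle>f : A \<rightarrow> Z\<rangle> \<Longrightarrow> f = Zero \<A> A Z" "\<langle>f : Z \<rightarrow> A\<rangle> \<Longrightarrow> f = Zero \<A> Z A"
proof -
  show Z: "Z \<in> Ob \<A>" using assms by (simp add: is_zero_object_def)
  show "f = Zero \<A> A Z" if "\<langle>f : A \<rightarrow> Z\<rangle>"
    using that assms hom_Ob[OF that] zero_in_hom[OF _ Z] unfolding is_zero_object_def by blast
  show "f = Zero \<A> Z A" if "\<langle>f : Z \<rightarrow> A\<rangle>"
    using that assms hom_Ob[OF that] zero_in_hom[OF Z] unfolding is_zero_object_def by blast
qed

lemma zero_object_projective: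
  assumes z: "is_zero_object \<A> Z"
  shows "projective \<A> Z"
  unfolding projective_def
proof (intro conjI allI impI ballI)
  note Z = zero_objectD[OF z]
  show "Z \<in> Ob \<A>" by (rule Z(1))
  fix e f assume e: "is_epi \<A> e" and f: "\<langle>f : Z \<rightarrow> Cod \<A> e\<rangle>"
  have ea: "e \<in> Arr \<A>" using e by (simp add: is_epi_def)
  show "\<exists>g\<in>Hom \<A> Z (Dom \<A> e). e \<cdot> g = f"
    using Z(3)[OF f] Z(1) ea Dom_closed zero_in_hom by (intro bexI[of _ "Zero \<A> Z (Dom \<A> e)"]) auto
qed

lemma exact_from_zero_object:
  assumes z: "is_zero_object \<A> Z" and k: "\<langle>k : K \<rightarrow> A\<rangle>"
    and inj: "\<And>P y. projective \<A> P \<Longrightarrow> \<langle>y : P \<rightarrow> K\<rangle> \<Longrightarrow> k \<cdot> y = Zero \<A> P A \<Longrightarrow> y = Zero \<A> P K"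
  shows "exact_at \<A> (Zero \<A> Z K) k"
proof -
  have ob: "Z \<in> Ob \<A>" "K \<in> Ob \<A>" using zero_objectD(1)[OF z] hom_Ob[OF k] by auto
  show ?thesis
  proof (rule exactI[OF zero_in_hom[OF ob] k])
    show "k \<cdot> Zero \<A> Z K = Zero \<A> Z A" using k ob by (simp add: hom_iff)
    fix P y assume P: "projective \<A> P" and y: "\<langle>y : P \<rightarrow> K\<rangle>" "k \<cdot> y = Zero \<A> P A"
    have Po: "P \<in> Ob \<A>" using hom_Ob[OF y(1)] by simp
    show "\<exists>x. \<langle>x : P \<rightarrow> Z\<rangle> \<and> Zero \<A> Z K \<cdot> x = y"
      using inj[OF P y] zero_in_hom[OF Po ob(1)] ob Po by (intro exI[of _ "Zero \<A> P Z"]) simp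
  qed
qed

lemma proj_dim_le_1I:
  assumes s: "short_exact_seq \<A> K k P q A" and P: "projective \<A> P" and K: "projective \<A> K"
  shows "proj_dim_le \<A> 1 A"
proof -
  note h = sesD[OF s]
  obtain Z where z: "is_zero_object \<A> Z" by (rule ex_zero_object)
  note Z = zero_objectD[OF z]
  have ob: "K \<in> Ob \<A>" using hom_Ob[OF h(1)] by simp
  define Q where "Q n = (if n = 0 then P else if n = 1 then K else Z)" for n :: nat
  define d where "d n = (if n = 0 then q else if n = 1 then k else if n = 2 then Zero \<A> Z K else Zero \<A> Z Z)" for n :: nat
  have "\<langle>d (Suc n) : Q (Suc n) \<rightarrow> Q n\<rangle> \<and> exact_at \<A> (d (Suc n)) (d n)" for n
  proof -
    consider "n = 0" | "n = 1" | "n = 2" | "n > 2" by linarith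
    then show ?thesis
    proof cases
      case 1
      then show ?thesis using h by (simp add: d_def Q_def)
    next
      case 2
      have "exact_at \<A> (Zero \<A> Z K) k"
        using exact_from_zero_object[OF z h(1)] mono_zero[OF h(3,1)] by blast
      then show ?thesis using 2 zero_in_hom[OF Z(1) ob] by (simp add: d_def Q_def)
    next
      case 3
      have "exact_at \<A> (Zero \<A> Z Z) (Zero \<A> Z K)"
        using exact_from_zero_object[OF z zero_in_hom[OF Z(1) ob]] Z(2) by blast
      then show ?thesis using 3 zero_in_hom[OF Z(1) Z(1)] by (simp add: d_def Q_def)
    next
      case 4
      have "exact_at \<A> (Zero \<A> Z Z) (Zero \<A> Z Z)"
        using exact_from_zero_object[OF z zero_in_hom[OF Z(1) Z(1)]] Z(2) by blast
      then show ?thesis using 4 zero_in_hom[OF Z(1) Z(1)] by (simp add: d_def Q_def)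
    qed
  qed
  moreover have "projective \<A> (Q n)" for n using P K zero_object_projective[OF z] by (simp add: Q_def)
  moreover have "\<langle>d 0 : Q 0 \<rightarrow> A\<rangle>" "is_epi \<A> (d 0)" using h by (simp_all add: d_def Q_def)
  ultimately have "projective_resolution \<A> A Q d" unfolding projective_resolution_def by blast
  moreover have "is_zero_object \<A> (Q i)" if "i > 1" for i using z that by (simp add: Q_def)
  ultimately show ?thesis unfolding proj_dim_le_def by blast
qed

text \<open>
  Projectivity of the kernel of \<open>d 0\<close> splits the resolution from degree one on. What is needed of the
  splitting is that every \<open>d (n + 2)\<close> has a quasi-inverse \<open>h\<close>, that is, \<open>d \<cdot> h \<cdot> d = d\<close>: then a cocycle
  \<open>f\<close> in degree \<open>n + 2\<close> kills \<open>Id - h \<cdot> d (n + 2)\<close> and is therefore the coboundary of \<open>f \<cdot> h\<close>.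
\<close>

lemma ext_ge_2_zero_of_projective_kernel:
  assumes A: "A \<in> Ob \<A>" and B: "B \<in> Ob \<A>"
    and ker: "\<And>K k P q. short_exact_seq \<A> K k P q A \<Longrightarrow> projective \<A> P \<Longrightarrow> projective \<A> K"
  shows "Ext_zero \<A> (Suc (Suc n)) A B"
proof -
  obtain P d where r: "projective_resolution \<A> A P d"
    and E: "\<And>n. Ext_zero \<A> (Suc n) A B \<longleftrightarrow> cocycles_extend P d (Suc n) B"
    using Ext_zero_Suc_iff[OF A B] by metis
  note dd = resolutionD(4)[OF r] and ex = resolutionD(5)[OF r] and pr = resolutionD(1)[OF r]
  have ob: "P n \<in> Ob \<A>" for n using pr by (simp add: projective_def)
  have zero: "d (Suc n) \<cdot> d (Suc (Suc n)) = Zero \<A> (P (Suc (Suc n))) (P n)" for n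
    using exact_zero[OF ex dd dd] .
  \<comment> \<open>\<open>Id - h \<cdot> d (n + 2)\<close> is killed by \<open>d (n + 2)\<close>, hence a multiple of \<open>d (n + 3)\<close>.\<close>
  have corr: "\<exists>h'. \<langle>h' : P (Suc (Suc n)) \<rightarrow> P (Suc (Suc (Suc n)))\<rangle> \<and>
      d (Suc (Suc (Suc n))) \<cdot> h' = Id \<A> (P (Suc (Suc n))) \<ominus> h \<cdot> d (Suc (Suc n))"
    if h: "\<langle>h : P (Suc n) \<rightarrow> P (Suc (Suc n))\<rangle>" "d (Suc (Suc n)) \<cdot> (h \<cdot> d (Suc (Suc n))) = d (Suc (Suc n))" for n h
  proof -
    have hd: "\<langle>h \<cdot> d (Suc (Suc n)) : P (Suc (Suc n)) \<rightarrow> P (Suc (Suc n))\<rangle>" using Comp_closed[OF dd h(1)] .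
    have i: "\<langle>Id \<A> (P (Suc (Suc n))) : P (Suc (Suc n)) \<rightarrow> P (Suc (Suc n))\<rangle>" using Id_closed[OF ob] .
    have "d (Suc (Suc n)) \<cdot> (Id \<A> (P (Suc (Suc n))) \<ominus> h \<cdot> d (Suc (Suc n))) =
        d (Suc (Suc n)) \<ominus> d (Suc (Suc n)) \<cdot> (h \<cdot> d (Suc (Suc n)))"
      using hd i dd[of "Suc n"] by (simp add: hom_iff)
    also have "\<dots> = Zero \<A> (P (Suc (Suc n))) (P (Suc n))" unfolding h(2) using sub_self[OF dd] .
    finally show ?thesis using exact_lift[OF ex dd dd pr sub_in_hom[OF i hd]] by blast
  qed
  have reg: "\<exists>h. \<langle>h : P (Suc n) \<rightarrow> P (Suc (Suc n))\<rangle> \<and> d (Suc (Suc n)) \<cdot> (h \<cdot> d (Suc (Suc n))) = d (Suc (Suc n))" for n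
  proof (induction n)
    case 0
    obtain K k where s: "short_exact_seq \<A> K k (P 0) (d 0) A" by (rule ses_of_epi[OF resolutionD(2,3)[OF r]])
    note h = sesD[OF s]
    have K: "projective \<A> K" using ker[OF s pr] .
    have d1: "\<langle>d (Suc 0) : P (Suc 0) \<rightarrow> P 0\<rangle>" and d2: "\<langle>d (Suc (Suc 0)) : P (Suc (Suc 0)) \<rightarrow> P (Suc 0)\<rangle>"
      by (rule dd)+
    obtain p where p: "\<langle>p : P (Suc 0) \<rightarrow> K\<rangle>" "k \<cdot> p = d (Suc 0)"
      by (rule ses_lift[OF s d1 exact_zero[OF ex d1 h(2)]])
    obtain x where x: "\<langle>x : K \<rightarrow> P (Suc 0)\<rangle>" "d (Suc 0) \<cdot> x = k"
      using exact_lift[OF ex d1 h(2) K h(1,6)] by blast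
    have "k \<cdot> (p \<cdot> x) = k \<cdot> Id \<A> K" using comp_through[OF p(2,1) h(1) x(1)] x(2) h(1) by (simp add: hom_iff)
    then have px: "p \<cdot> x = Id \<A> K"
      using mono_cancel[OF h(3,1) Comp_closed[OF x(1) p(1)] Id_closed] hom_Ob[OF h(1)] by simp
    have xp: "\<langle>x \<cdot> p : P (Suc 0) \<rightarrow> P (Suc 0)\<rangle>" using Comp_closed[OF p(1) x(1)] .
    have i: "\<langle>Id \<A> (P (Suc 0)) : P (Suc 0) \<rightarrow> P (Suc 0)\<rangle>" using Id_closed[OF ob] .
    let ?w = "Id \<A> (P (Suc 0)) \<ominus> x \<cdot> p"
    have "d (Suc 0) \<cdot> (x \<cdot> p) = d (Suc 0)" using comp_through[OF x(2,1) d1 p(1)] p(2) by simp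
    then have "d (Suc 0) \<cdot> ?w = Zero \<A> (P (Suc 0)) (P 0)"
      using d1 i xp sub_self[OF d1] by (simp add: hom_iff)
    then obtain h' where h': "\<langle>h' : P (Suc 0) \<rightarrow> P (Suc (Suc 0))\<rangle>" "d (Suc (Suc 0)) \<cdot> h' = ?w"
      using exact_lift[OF ex d2 d1 pr sub_in_hom[OF i xp]] by blast
    have "k \<cdot> (p \<cdot> d (Suc (Suc 0))) = Zero \<A> (P (Suc (Suc 0))) (P 0)"
      using comp_through[OF p(2,1) h(1) d2] zero by simp
    then have pd: "p \<cdot> d (Suc (Suc 0)) = Zero \<A> (P (Suc (Suc 0))) K"
      using mono_zero[OF h(3,1) Comp_closed[OF d2 p(1)]] by simp
    have "d (Suc (Suc 0)) \<cdot> (h' \<cdot> d (Suc (Suc 0))) = ?w \<cdot> d (Suc (Suc 0))"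
      using comp_through[OF h'(2,1) d2 d2] .
    also have "\<dots> = d (Suc (Suc 0)) \<ominus> x \<cdot> (p \<cdot> d (Suc (Suc 0)))"
      using i xp d2 x(1) p(1) by (simp add: hom_iff)
    also have "\<dots> = d (Suc (Suc 0))"
      unfolding pd using x(1) ob sub_zero[OF d2] by (simp add: hom_iff)
    finally show ?case using h'(1) by blast
  next
    case (Suc n)
    then obtain h where h: "\<langle>h : P (Suc n) \<rightarrow> P (Suc (Suc n))\<rangle>"
      "d (Suc (Suc n)) \<cdot> (h \<cdot> d (Suc (Suc n))) = d (Suc (Suc n))" by blast
    let ?m = "Suc (Suc n)"
    have dm: "\<langle>d ?m : P ?m \<rightarrow> P (Suc n)\<rangle>" and dm1: "\<langle>d (Suc ?m) : P (Suc ?m) \<rightarrow> P ?m\<rangle>" by (rule dd)+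
    have hd: "\<langle>h \<cdot> d ?m : P ?m \<rightarrow> P ?m\<rangle>" using Comp_closed[OF dm h(1)] .
    have i: "\<langle>Id \<A> (P ?m) : P ?m \<rightarrow> P ?m\<rangle>" using Id_closed[OF ob] .
    obtain h' where h': "\<langle>h' : P ?m \<rightarrow> P (Suc ?m)\<rangle>" "d (Suc ?m) \<cdot> h' = Id \<A> (P ?m) \<ominus> h \<cdot> d ?m"
      using corr[OF h] by blast
    have "d (Suc ?m) \<cdot> (h' \<cdot> d (Suc ?m)) = (Id \<A> (P ?m) \<ominus> h \<cdot> d ?m) \<cdot> d (Suc ?m)"
      using comp_through[OF h'(2,1) dm1 dm1] .
    also have "\<dots> = d (Suc ?m) \<ominus> h \<cdot> (d ?m \<cdot> d (Suc ?m))"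
      using i hd dm1 h(1) dm by (simp add: hom_iff)
    also have "\<dots> = d (Suc ?m)"
      unfolding zero using h(1) ob sub_zero[OF dm1] by (simp add: hom_iff)
    finally show ?case using h'(1) by blast
  qed
  have "cocycles_extend P d (Suc (Suc n)) B"
    unfolding cocycles_extend_def
  proof (intro allI impI, elim conjE)
    let ?m = "Suc (Suc n)"
    fix f assume f: "\<langle>f : P ?m \<rightarrow> B\<rangle>" and fd: "f \<cdot> d (Suc ?m) = Zero \<A> (P (Suc ?m)) B"
    obtain h where h: "\<langle>h : P (Suc n) \<rightarrow> P ?m\<rangle>" "d ?m \<cdot> (h \<cdot> d ?m) = d ?m" using reg by blast
    obtain h' where h': "\<langle>h' : P ?m \<rightarrow> P (Suc ?m)\<rangle>" "d (Suc ?m) \<cdot> h' = Id \<A> (P ?m) \<ominus> h \<cdot> d ?m"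
      using corr[OF h] by blast
    have dm: "\<langle>d ?m : P ?m \<rightarrow> P (Suc n)\<rangle>" and dm1: "\<langle>d (Suc ?m) : P (Suc ?m) \<rightarrow> P ?m\<rangle>" by (rule dd)+
    have hd: "\<langle>h \<cdot> d ?m : P ?m \<rightarrow> P ?m\<rangle>" using Comp_closed[OF dm h(1)] .
    have i: "\<langle>Id \<A> (P ?m) : P ?m \<rightarrow> P ?m\<rangle>" using Id_closed[OF ob] .
    have "f \<ominus> f \<cdot> (h \<cdot> d ?m) = f \<cdot> (Id \<A> (P ?m) \<ominus> h \<cdot> d ?m)" using f i hd by (simp add: hom_iff)
    also have "\<dots> = Zero \<A> (P (Suc ?m)) B \<cdot> h'" using comp_through[OF fd dm1 f h'(1)] h'(2) by simp
    also have "\<dots> = Zero \<A> (P ?m) B" using h'(1) B by (simp add: hom_iff)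
    finally have "f \<cdot> (h \<cdot> d ?m) = f" using sub_eq_zero_iff[OF f Comp_closed[OF hd f]] by simp
    then have "(f \<cdot> h) \<cdot> d ?m = f" using f h(1) dm by (simp add: hom_iff)
    then show "\<exists>g. \<langle>g : P (?m - 1) \<rightarrow> B\<rangle> \<and> g \<cdot> d ?m = f" using Comp_closed[OF h(1) f] by auto
  qed
  then show ?thesis using E by simp
qed

lemma pushout_of_epi:
  assumes s: "short_exact_seq \<A> K k X c A" and t: "short_exact_seq \<A> Y i E c' A"
    and f: "\<langle>f : K \<rightarrow> Y\<rangle>" "is_epi \<A> f" and e: "\<langle>e : X \<rightarrow> E\<rangle>" "e \<cdot> k = i \<cdot> f" "c' \<cdot> e = c"
  shows "is_epi \<A> e"
proof (rule epiI[OF e(1)])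
  note h = sesD[OF s] and l = sesD[OF t]
  fix Q z assume Q: "projective \<A> Q" and z: "\<langle>z : Q \<rightarrow> E\<rangle>"
  have cz: "\<langle>c' \<cdot> z : Q \<rightarrow> A\<rangle>" using Comp_closed[OF z l(2)] .
  obtain x where x: "\<langle>x : Q \<rightarrow> X\<rangle>" "c \<cdot> x = c' \<cdot> z" by (rule projective_lift[OF Q h(4,2) cz])
  have ex: "\<langle>e \<cdot> x : Q \<rightarrow> E\<rangle>" using Comp_closed[OF x(1) e(1)] .
  have "c' \<cdot> (e \<cdot> x) = c' \<cdot> z" using comp_through[OF e(3,1) l(2) x(1)] x(2) by simp
  then have "c' \<cdot> (z \<ominus> e \<cdot> x) = Zero \<A> Q A" using z ex l(2) sub_self[OF cz] by (simp add: hom_iff)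
  then obtain y where y: "\<langle>y : Q \<rightarrow> Y\<rangle>" "i \<cdot> y = z \<ominus> e \<cdot> x" by (rule ses_lift[OF t sub_in_hom[OF z ex]])
  obtain w where w: "\<langle>w : Q \<rightarrow> K\<rangle>" "f \<cdot> w = y" by (rule projective_lift[OF Q f(2,1) y(1)])
  have kw: "\<langle>k \<cdot> w : Q \<rightarrow> X\<rangle>" using Comp_closed[OF w(1) h(1)] .
  have "e \<cdot> (k \<cdot> w) = z \<ominus> e \<cdot> x"
    using comp_through[OF e(2) h(1) e(1) w(1)] w y(2) l(1) f(1) by (simp add: hom_iff)
  then have "e \<cdot> (k \<cdot> w \<oplus> x) = z" using kw x(1) e(1) sub_add[OF z ex] by (simp add: hom_iff)
  then show "\<exists>x. \<langle>x : Q \<rightarrow> X\<rangle> \<and> e \<cdot> x = z" using add_in_hom[OF kw x(1)] by blast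
qed

text \<open>
  The composite \<open>Y \<rightarrow> E \<rightarrow> E/X\<close> is a cokernel of \<open>f\<close>.
\<close>

lemma pushout_of_mono:
  assumes s: "short_exact_seq \<A> K k X c A" and t: "short_exact_seq \<A> Y i E c' A"
    and u: "short_exact_seq \<A> K f Y g C" and e: "\<langle>e : X \<rightarrow> E\<rangle>" "e \<cdot> k = i \<cdot> f" "c' \<cdot> e = c"
  obtains C' g' where "short_exact_seq \<A> X e E g' C'" "isomorphic \<A> C C'"
proof -
  note h = sesD[OF s] and l = sesD[OF t] and m = sesD[OF u]
  have em: "is_mono \<A> e"
  proof (rule monoI[OF e(1)])
    fix Q x assume x: "\<langle>x : Q \<rightarrow> X\<rangle>" and ex: "e \<cdot> x = Zero \<A> Q E"
    have Q: "Q \<in> Ob \<A>" using hom_Ob[OF x] by simp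
    have "c \<cdot> x = Zero \<A> Q A" using comp_through[OF e(3,1) l(2) x] ex l(2) Q by (simp add: hom_iff)
    then obtain w where w: "\<langle>w : Q \<rightarrow> K\<rangle>" "k \<cdot> w = x" by (rule ses_lift[OF s x])
    have "i \<cdot> (f \<cdot> w) = Zero \<A> Q E"
      using comp_through[OF e(2) h(1) e(1) w(1)] w ex l(1) m(1) by (simp add: hom_iff)
    then have "f \<cdot> w = Zero \<A> Q Y" using mono_zero[OF l(3,1) Comp_closed[OF w(1) m(1)]] by simp
    then have "w = Zero \<A> Q K" using mono_zero[OF m(3,1) w(1)] by simp
    then show "x = Zero \<A> Q X" using w(2) h(1) Q by (auto simp: hom_iff)
  qed
  obtain C' q where q: "short_exact_seq \<A> X e E q C'" by (rule ses_of_mono[OF e(1) em])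
  note n = sesD[OF q]
  have qi: "\<langle>q \<cdot> i : Y \<rightarrow> C'\<rangle>" using Comp_closed[OF l(1) n(2)] .
  have qie: "is_epi \<A> (q \<cdot> i)"
  proof (rule epiI[OF qi])
    fix Q z assume Q: "projective \<A> Q" and z: "\<langle>z : Q \<rightarrow> C'\<rangle>"
    obtain z' where z': "\<langle>z' : Q \<rightarrow> E\<rangle>" "q \<cdot> z' = z" by (rule projective_lift[OF Q n(4,2) z])
    have cz: "\<langle>c' \<cdot> z' : Q \<rightarrow> A\<rangle>" using Comp_closed[OF z'(1) l(2)] .
    obtain x where x: "\<langle>x : Q \<rightarrow> X\<rangle>" "c \<cdot> x = c' \<cdot> z'" by (rule projective_lift[OF Q h(4,2) cz])
    have ex: "\<langle>e \<cdot> x : Q \<rightarrow> E\<rangle>" using Comp_closed[OF x(1) e(1)] .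
    have "c' \<cdot> (e \<cdot> x) = c' \<cdot> z'" using comp_through[OF e(3,1) l(2) x(1)] x(2) by simp
    then have "c' \<cdot> (z' \<ominus> e \<cdot> x) = Zero \<A> Q A" using z'(1) ex l(2) sub_self[OF cz] by (simp add: hom_iff)
    then obtain y where y: "\<langle>y : Q \<rightarrow> Y\<rangle>" "i \<cdot> y = z' \<ominus> e \<cdot> x" by (rule ses_lift[OF t sub_in_hom[OF z'(1) ex]])
    have qex: "q \<cdot> (e \<cdot> x) = Zero \<A> Q C'"
      using comp_through[OF n(6,1,2) x(1)] x(1) hom_Ob[OF n(2)] by (simp add: hom_iff)
    have "(q \<cdot> i) \<cdot> y = q \<cdot> (z' \<ominus> e \<cdot> x)" using y l(1) n(2) by (simp add: hom_iff)
    also have "\<dots> = q \<cdot> z' \<ominus> q \<cdot> (e \<cdot> x)" using z'(1) ex n(2) by (simp add: hom_iff)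
    also have "\<dots> = z" unfolding qex z'(2) using sub_zero[OF z] .
    finally show "\<exists>y. \<langle>y : Q \<rightarrow> Y\<rangle> \<and> (q \<cdot> i) \<cdot> y = z" using y(1) by blast
  qed
  have "short_exact_seq \<A> K f Y (q \<cdot> i) C'"
  proof (rule sesI[OF m(1,3) qi qie])
    have "(q \<cdot> i) \<cdot> f = (q \<cdot> e) \<cdot> k" using l(1) n(1,2) m(1) h(1) e(2) by (simp add: hom_iff)
    also have "\<dots> = Zero \<A> K C'" unfolding n(6) using h(1) hom_Ob[OF n(2)] by (simp add: hom_iff)
    finally show "(q \<cdot> i) \<cdot> f = Zero \<A> K C'" .
    fix Q y assume y: "\<langle>y : Q \<rightarrow> Y\<rangle>" "(q \<cdot> i) \<cdot> y = Zero \<A> Q C'"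
    have Q: "Q \<in> Ob \<A>" using hom_Ob[OF y(1)] by simp
    have iy: "\<langle>i \<cdot> y : Q \<rightarrow> E\<rangle>" using Comp_closed[OF y(1) l(1)] .
    have "q \<cdot> (i \<cdot> y) = Zero \<A> Q C'" using y l(1) n(2) by (simp add: hom_iff)
    then obtain x where x: "\<langle>x : Q \<rightarrow> X\<rangle>" "e \<cdot> x = i \<cdot> y" by (rule ses_lift[OF q iy])
    have "c \<cdot> x = c' \<cdot> (i \<cdot> y)" using comp_through[OF e(3,1) l(2) x(1)] x(2) by simp
    also have "\<dots> = Zero \<A> Q A"
      using comp_through[OF l(6,1,2) y(1)] y(1) hom_Ob[OF l(2)] by (simp add: hom_iff)
    finally obtain w where w: "\<langle>w : Q \<rightarrow> K\<rangle>" "k \<cdot> w = x" by (rule ses_lift[OF s x(1)])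
    have "i \<cdot> (f \<cdot> w) = i \<cdot> y"
      using comp_through[OF e(2) h(1) e(1) w(1)] w x(2) l(1) m(1) by (simp add: hom_iff)
    then have "f \<cdot> w = y" using mono_cancel[OF l(3,1) Comp_closed[OF w(1) m(1)] y(1)] by simp
    then show "\<exists>x. \<langle>x : Q \<rightarrow> K\<rangle> \<and> f \<cdot> x = y" using w(1) by blast
  qed
  then have "isomorphic \<A> C C'" by (rule cokernel_ses[OF u])
  then show ?thesis using that q by blast
qed

lemma cotorsion_pairD:
  assumes "cotorsion_pair \<A> \<C> \<D>"
  shows "\<C> \<subseteq> Ob \<A>" "\<D> \<subseteq> Ob \<A>" "\<C> = left_perp \<A> 1 \<D>" "C \<in> \<C> \<Longrightarrow> Y \<in> \<D> \<Longrightarrow> Ext_zero \<A> 1 C Y"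
proof -
  show "\<C> \<subseteq> Ob \<A>" "\<D> \<subseteq> Ob \<A>" and C: "\<C> = left_perp \<A> 1 \<D>"
    using assms unfolding cotorsion_pair_def subcategory_def by blast+
  assume "C \<in> \<C>" "Y \<in> \<D>"
  then show "Ext_zero \<A> 1 C Y" unfolding C left_perp_def by blast
qed

lemma cotorsion_sequences:
  assumes "cotorsion_pair \<A> \<C> \<D>" "A \<in> Ob \<A>"
  obtains D C f g D' C' f' g' where "D \<in> \<D>" "C \<in> \<C>" "short_exact_seq \<A> D f C g A"
    "D' \<in> \<D>" "C' \<in> \<C>" "short_exact_seq \<A> A f' D' g' C'"
  using assms unfolding cotorsion_pair_def by metis

text \<open>
  Both terms acquire the membership that the cotorsion pair does not provide: \<open>D\<close> is an extension of \<open>C\<close>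
  by \<open>P\<close>, and \<open>C\<close> is a quotient of \<open>D\<close>.
\<close>

lemma cotorsion_preenvelope_of_projective:
  assumes c: "cotorsion_torsion_triple \<A> \<C> \<D> \<F>" and P: "projective \<A> P"
  obtains D C f g where "D \<in> \<C> \<inter> \<D>" "C \<in> \<C> \<inter> \<D>" "short_exact_seq \<A> P f D g C"
proof -
  have cp: "cotorsion_pair \<A> \<C> \<D>" and tp: "torsion_pair \<A> \<D> \<F>"
    using c by (auto simp: cotorsion_torsion_triple_def)
  note p = cotorsion_pairD[OF cp]
  have Po: "P \<in> Ob \<A>" using P by (simp add: projective_def)
  obtain D C f g where D: "D \<in> \<D>" "C \<in> \<C>" and s: "short_exact_seq \<A> P f D g C"
    using cotorsion_sequences[OF cp Po] by metis
  have "D \<in> \<C>" using left_perp_extension[OF p(2) s] projective_in_left_perp[OF p(2) P] D(2) p(3) by simp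
  moreover have "C \<in> \<D>" using torsion_class_quotient[OF tp D(1) sesD(2,4)[OF s]] .
  ultimately show ?thesis using that D s by blast
qed

text \<open>
  A right \<open>\<C> \<inter> \<D>\<close>-approximation of \<open>A\<close> is obtained from \<open>0 \<rightarrow> K \<rightarrow> C \<rightarrow> D \<rightarrow> 0\<close> for the torsion part \<open>D\<close> of
  \<open>A\<close>, with \<open>K \<in> \<D>\<close> and \<open>C \<in> \<C>\<close>; here \<open>C \<in> \<D>\<close> as an extension of \<open>D\<close> by \<open>K\<close>.
\<close>

lemma cotorsion_torsion_imp_tau:
  assumes c: "cotorsion_torsion_triple \<A> \<C> \<D> \<F>"
  shows "tau_cotorsion_torsion_triple \<A> \<C> \<D> \<F>"
proof -
  have cp: "cotorsion_pair \<A> \<C> \<D>" and tp: "torsion_pair \<A> \<D> \<F>"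
    using c by (auto simp: cotorsion_torsion_triple_def)
  note p = cotorsion_pairD[OF cp] and q = torsion_pairD[OF tp]
  have "\<exists>D\<in>\<C> \<inter> \<D>. \<exists>C\<in>\<C>. \<exists>f g. right_exact_seq \<A> P f D g C \<and> left_approximation \<A> \<D> P f"
    if P: "projective \<A> P" for P
  proof -
    obtain D C f g where D: "D \<in> \<C> \<inter> \<D>" "C \<in> \<C> \<inter> \<D>" and s: "short_exact_seq \<A> P f D g C"
      by (rule cotorsion_preenvelope_of_projective[OF c P])
    have "left_approximation \<A> \<D> P f"
    proof (rule left_approximationI[OF sesD(1)[OF s]])
      show "D \<in> \<D>" using D by simp
      fix Y u assume Y: "Y \<in> \<D>" and u: "\<langle>u : P \<rightarrow> Y\<rangle>"
      have "Ext_zero \<A> 1 C Y" using p(4) D(2) Y by blast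
      then obtain h where "\<langle>h : D \<rightarrow> Y\<rangle>" "h \<cdot> f = u" by (rule ext1_extend[OF _ s u])
      then show "\<exists>h. \<langle>h : D \<rightarrow> Y\<rangle> \<and> h \<cdot> f = u" by blast
    qed
    moreover have "right_exact_seq \<A> P f D g C"
      using s by (simp add: short_exact_seq_def right_exact_seq_def)
    ultimately show ?thesis using D by blast
  qed
  moreover have "contravariantly_finite \<A> (\<C> \<inter> \<D>)"
    unfolding contravariantly_finite_def
  proof
    fix A assume A: "A \<in> Ob \<A>"
    obtain D F i g where D: "D \<in> \<D>" "F \<in> \<F>" and s: "short_exact_seq \<A> D i A g F"
      by (rule torsion_sequence[OF tp A])
    have Do: "D \<in> Ob \<A>" using D p(2) by blast
    obtain K C k f where K: "K \<in> \<D>" "C \<in> \<C>" and t: "short_exact_seq \<A> K k C f D"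
      using cotorsion_sequences[OF cp Do] by metis
    note h = sesD[OF s] and l = sesD[OF t]
    have CD: "C \<in> \<C> \<inter> \<D>" using torsion_class_extension[OF tp t K(1) D(1)] K(2) by simp
    have "right_approximation \<A> (\<C> \<inter> \<D>) A (i \<cdot> f)"
    proof (rule right_approximationI[OF Comp_closed[OF l(2) h(1)] CD])
      fix X u assume X: "X \<in> \<C> \<inter> \<D>" and u: "\<langle>u : X \<rightarrow> A\<rangle>"
      have "g \<cdot> u = Zero \<A> X F" using q(5) X D(2) Comp_closed[OF u h(2)] by blast
      then obtain v where v: "\<langle>v : X \<rightarrow> D\<rangle>" "i \<cdot> v = u" by (rule ses_lift[OF s u])
      have "Ext_zero \<A> 1 X K" using p(4) X K(1) by blast
      then obtain w where w: "\<langle>w : X \<rightarrow> C\<rangle>" "f \<cdot> w = v" by (rule ext1_lift[OF _ t v(1)])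
      have "(i \<cdot> f) \<cdot> w = u" using w v(2) h(1) l(2) by (simp add: hom_iff)
      then show "\<exists>w. \<langle>w : X \<rightarrow> C\<rangle> \<and> (i \<cdot> f) \<cdot> w = u" using w(1) by blast
    qed
    then show "\<exists>f. right_approximation \<A> (\<C> \<inter> \<D>) A f" by blast
  qed
  moreover have "subcategory \<A> \<C>" using cp unfolding cotorsion_pair_def by blast
  ultimately show ?thesis unfolding tau_cotorsion_torsion_triple_def using q(3,4) p(3) tp by blast
qed

text \<open>
  To lift \<open>f : K \<rightarrow> Z\<close> along \<open>e : E \<rightarrow> Z\<close> with kernel \<open>B\<close>, embed \<open>E\<close> into some \<open>D' \<in> \<D>\<close> with cokernel in \<open>\<C>\<close>.
  Then \<open>Z = E/B\<close> embeds into \<open>Q = D'/B\<close>, which lies in \<open>\<D>\<close> because \<open>\<D>\<close> is closed under quotients. So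
  \<open>Ext\<^sup>1(C, Q) = 0\<close>, and \<open>K \<rightarrow> Z \<rightarrow> Q\<close> extends to \<open>P\<close>. Lift the extension to \<open>D'\<close> and restrict it to \<open>K\<close>; the
  result takes values in \<open>E\<close>, the preimage of \<open>Z\<close>.
\<close>

lemma kernel_of_projective_presentation_projective:
  assumes c: "cotorsion_torsion_triple \<A> \<C> \<D> \<F>" and C: "C \<in> \<C>"
    and s: "short_exact_seq \<A> K k P q C" and P: "projective \<A> P"
  shows "projective \<A> K"
  unfolding projective_def
proof (intro conjI allI impI ballI)
  have cp: "cotorsion_pair \<A> \<C> \<D>" and tp: "torsion_pair \<A> \<D> \<F>"
    using c by (auto simp: cotorsion_torsion_triple_def)
  note p = cotorsion_pairD[OF cp] and h = sesD[OF s]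
  show "K \<in> Ob \<A>" using hom_Ob[OF h(1)] by simp
  fix e f assume ee: "is_epi \<A> e" and f: "\<langle>f : K \<rightarrow> Cod \<A> e\<rangle>"
  let ?E = "Dom \<A> e" and ?Z = "Cod \<A> e"
  have e: "\<langle>e : ?E \<rightarrow> ?Z\<rangle>" using ee by (simp add: is_epi_def hom_iff)
  obtain B b where u: "short_exact_seq \<A> B b ?E e ?Z" by (rule ses_of_epi[OF e ee])
  note m = sesD[OF u]
  have ob: "?E \<in> Ob \<A>" "?Z \<in> Ob \<A>" "B \<in> Ob \<A>" using hom_Ob m by auto
  obtain D' C' j c1 where D': "D' \<in> \<D>" "C' \<in> \<C>" and t: "short_exact_seq \<A> ?E j D' c1 C'"
    using cotorsion_sequences[OF cp ob(1)] by metis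
  note l = sesD[OF t]
  have jb: "\<langle>j \<cdot> b : B \<rightarrow> D'\<rangle>" using Comp_closed[OF m(1) l(1)] .
  obtain Q r where v: "short_exact_seq \<A> B (j \<cdot> b) D' r Q"
    by (rule ses_of_mono[OF jb comp_mono[OF m(3) l(3) m(1) l(1)]])
  note n = sesD[OF v]
  have Q: "Q \<in> \<D>" "Q \<in> Ob \<A>" using torsion_class_quotient[OF tp D'(1) n(2,4)] hom_Ob[OF n(2)] by auto
  have rj: "\<langle>r \<cdot> j : ?E \<rightarrow> Q\<rangle>" using Comp_closed[OF l(1) n(2)] .
  have "(r \<cdot> j) \<cdot> b = Zero \<A> B Q" using n(6,2) l(1) m(1) by (simp add: hom_iff)
  then obtain w where w: "\<langle>w : ?Z \<rightarrow> Q\<rangle>" "w \<cdot> e = r \<cdot> j" by (rule ses_extend[OF u rj])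
  have wm: "is_mono \<A> w"
  proof (rule monoI[OF w(1)])
    fix R z assume R: "projective \<A> R" and z: "\<langle>z : R \<rightarrow> ?Z\<rangle>" and wz: "w \<cdot> z = Zero \<A> R Q"
    have Ro: "R \<in> Ob \<A>" using hom_Ob[OF z] by simp
    obtain x where x: "\<langle>x : R \<rightarrow> ?E\<rangle>" "e \<cdot> x = z" by (rule projective_lift[OF R ee e z])
    have jx: "\<langle>j \<cdot> x : R \<rightarrow> D'\<rangle>" using Comp_closed[OF x(1) l(1)] .
    have "r \<cdot> (j \<cdot> x) = Zero \<A> R Q"
      using comp_through[OF w(2) e w(1) x(1)] x wz n(2) l(1) by (simp add: hom_iff)
    then obtain y where y: "\<langle>y : R \<rightarrow> B\<rangle>" "(j \<cdot> b) \<cdot> y = j \<cdot> x" by (rule ses_lift[OF v jx])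
    have "j \<cdot> (b \<cdot> y) = j \<cdot> x" using y m(1) l(1) by (simp add: hom_iff)
    then have "b \<cdot> y = x" using mono_cancel[OF l(3,1) Comp_closed[OF y(1) m(1)] x(1)] by simp
    then have "z = (e \<cdot> b) \<cdot> y" using x(2) m(1,2) y(1) by (auto simp: hom_iff)
    then show "z = Zero \<A> R ?Z" unfolding m(6) using y(1) ob by (simp add: hom_iff)
  qed
  have "Ext_zero \<A> 1 C Q" using p(4) C Q(1) by blast
  then obtain x where x: "\<langle>x : P \<rightarrow> Q\<rangle>" "x \<cdot> k = w \<cdot> f" by (rule ext1_extend[OF _ s Comp_closed[OF f w(1)]])
  obtain y where y: "\<langle>y : P \<rightarrow> D'\<rangle>" "r \<cdot> y = x" by (rule projective_lift[OF P n(4,2) x(1)])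
  have "c1 \<cdot> (j \<cdot> b) = Zero \<A> B C'"
    using comp_through[OF l(6,1,2) m(1)] m(1) hom_Ob[OF l(2)] by (simp add: hom_iff)
  then obtain a where a: "\<langle>a : Q \<rightarrow> C'\<rangle>" "a \<cdot> r = c1" by (rule ses_extend[OF v l(2)])
  have "(a \<cdot> w) \<cdot> e = a \<cdot> (r \<cdot> j)" using a(1) w e by (simp add: hom_iff)
  also have "\<dots> = Zero \<A> ?E C'" using comp_through[OF a(2) n(2) a(1) l(1)] l(6) by simp
  finally have aw: "a \<cdot> w = Zero \<A> ?Z C'" using epi_zero[OF ee e Comp_closed[OF w(1) a(1)]] by simp
  have yk: "\<langle>y \<cdot> k : K \<rightarrow> D'\<rangle>" using Comp_closed[OF h(1) y(1)] .
  have ryk: "r \<cdot> (y \<cdot> k) = w \<cdot> f" using comp_through[OF y(2,1) n(2) h(1)] x(2) by simp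
  have "c1 \<cdot> (y \<cdot> k) = a \<cdot> (r \<cdot> (y \<cdot> k))" using comp_through[OF a(2) n(2) a(1) yk] by simp
  also have "\<dots> = Zero \<A> K C'"
    unfolding ryk using comp_through[OF aw w(1) a(1) f] f hom_Ob[OF a(1)] by (simp add: hom_iff)
  finally obtain g where g: "\<langle>g : K \<rightarrow> ?E\<rangle>" "j \<cdot> g = y \<cdot> k" by (rule ses_lift[OF t yk])
  have "w \<cdot> (e \<cdot> g) = r \<cdot> (j \<cdot> g)" using comp_through[OF w(2) e w(1) g(1)] n(2) l(1) g(1) by (simp add: hom_iff)
  then have "w \<cdot> (e \<cdot> g) = w \<cdot> f" using g(2) ryk by simp
  then have "e \<cdot> g = f" using mono_cancel[OF wm w(1) Comp_closed[OF g(1) e] f] by simp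
  then show "\<exists>g\<in>Hom \<A> K ?E. e \<cdot> g = f" using g(1) by blast
qed

lemma cotorsion_torsion_imp_tilting:
  assumes c: "cotorsion_torsion_triple \<A> \<C> \<D> \<F>"
  shows "tilting \<A> (\<C> \<inter> \<D>)"
proof -
  have cp: "cotorsion_pair \<A> \<C> \<D>" and tp: "torsion_pair \<A> \<D> \<F>"
    using c by (auto simp: cotorsion_torsion_triple_def)
  note p = cotorsion_pairD[OF cp]
  note st = stt_props[OF tau_cotorsion_torsion_imp_stt[OF cotorsion_torsion_imp_tau[OF c]]]
  have "Ext_zero \<A> i T1 T2" if T: "T1 \<in> \<C> \<inter> \<D>" "T2 \<in> \<C> \<inter> \<D>" and i: "i \<ge> 1" for T1 T2 i
  proof -
    have ob: "T1 \<in> Ob \<A>" "T2 \<in> Ob \<A>" using T p(1) by auto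
    show ?thesis
    proof (cases "i = 1")
      case True
      then show ?thesis using p(4) T by blast
    next
      case False
      then obtain n where "i = Suc (Suc n)" using i by (metis One_nat_def Suc_le_D not0_implies_Suc)
      then show ?thesis
        using ext_ge_2_zero_of_projective_kernel[OF ob] kernel_of_projective_presentation_projective[OF c] T(1) by blast
    qed
  qed
  moreover have "proj_dim_le \<A> 1 T" if T: "T \<in> \<C> \<inter> \<D>" for T
  proof -
    have "T \<in> Ob \<A>" using T p(1) by auto
    then obtain P e where P: "projective \<A> P" "\<langle>e : P \<rightarrow> T\<rangle>" "is_epi \<A> e" by (rule projective_presentation)
    obtain K k where s: "short_exact_seq \<A> K k P e T" by (rule ses_of_epi[OF P(2,3)])
    have "projective \<A> K" using kernel_of_projective_presentation_projective[OF c _ s P(1)] T by blast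
    then show ?thesis by (rule proj_dim_le_1I[OF s P(1)])
  qed
  moreover have "\<exists>T0\<in>\<C> \<inter> \<D>. \<exists>T1\<in>\<C> \<inter> \<D>. \<exists>f g. short_exact_seq \<A> P f T0 g T1" if P: "projective \<A> P" for P
  proof -
    obtain D C f g where "D \<in> \<C> \<inter> \<D>" "C \<in> \<C> \<inter> \<D>" "short_exact_seq \<A> P f D g C"
      by (rule cotorsion_preenvelope_of_projective[OF c P])
    then show ?thesis by blast
  qed
  ultimately show ?thesis unfolding tilting_def using st(2-5) by blast
qed

lemma tiltingD:
  assumes "tilting \<A> \<T>"
  shows "\<T> \<subseteq> Ob \<A>" "subcategory \<A> \<T>" "closed_direct_sums \<A> \<T>" "closed_direct_summands \<A> \<T>"
    "contravariantly_finite \<A> \<T>" "T1 \<in> \<T> \<Longrightarrow> T2 \<in> \<T> \<Longrightarrow> Ext_zero \<A> 1 T1 T2"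
    "T1 \<in> \<T> \<Longrightarrow> proj_dim_le \<A> 1 T1"
  using assms by (auto simp: tilting_def subcategory_def)

lemma tilting_sequence:
  assumes "tilting \<A> \<T>" "projective \<A> P"
  obtains T0 T1 f g where "T0 \<in> \<T>" "T1 \<in> \<T>" "short_exact_seq \<A> P f T0 g T1"
  using assms unfolding tilting_def by blast

lemma tilting_imp_stt:
  assumes t: "tilting \<A> \<T>"
  shows "support_tau_tilting \<A> \<T>"
proof -
  note T = tiltingD[OF t]
  have "Ext_zero \<A> 1 T1 Y" if TT: "T1 \<in> \<T>" "T2 \<in> \<T>" and Y: "Y \<in> Fac_object \<A> T2" for T1 T2 Y
  proof -
    obtain S e where S: "S \<in> sums_of_copies \<A> T2" "\<langle>e : S \<rightarrow> Y\<rangle>" "is_epi \<A> e"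
      using FacE Y unfolding Fac_object_def by metis
    obtain I \<iota> \<pi> where s: "is_direct_sum \<A> I (\<lambda>_. T2) S \<iota> \<pi>" using S(1) unfolding sums_of_copies_def by blast
    have "(\<lambda>_::nat. T2) ` I \<subseteq> \<T>" using TT(2) by auto
    then have "S \<in> \<T>" using T(3) s unfolding closed_direct_sums_def by blast
    then show ?thesis using ext1_quotient_of_pd_le_1[OF T(7)[OF TT(1)] T(6)[OF TT(1)] S(2,3)] T(1) TT(1) by blast
  qed
  moreover have "\<exists>T0\<in>\<T>. \<exists>T1\<in>\<T>. \<exists>f g. right_exact_seq \<A> P f T0 g T1 \<and> left_approximation \<A> \<T> P f"
    if P: "projective \<A> P" for P
  proof -
    obtain T0 T1 f g where T0: "T0 \<in> \<T>" "T1 \<in> \<T>" and s: "short_exact_seq \<A> P f T0 g T1"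
      by (rule tilting_sequence[OF t P])
    have "left_approximation \<A> \<T> P f"
    proof (rule left_approximationI[OF sesD(1)[OF s] T0(1)])
      fix Y u assume Y: "Y \<in> \<T>" and u: "\<langle>u : P \<rightarrow> Y\<rangle>"
      obtain h where "\<langle>h : T0 \<rightarrow> Y\<rangle>" "h \<cdot> f = u" by (rule ext1_extend[OF T(6)[OF T0(2) Y] s u])
      then show "\<exists>h. \<langle>h : T0 \<rightarrow> Y\<rangle> \<and> h \<cdot> f = u" by blast
    qed
    moreover have "right_exact_seq \<A> P f T0 g T1"
      using s by (simp add: short_exact_seq_def right_exact_seq_def)
    ultimately show ?thesis using T0 by blast
  qed
  ultimately show ?thesis unfolding support_tau_tilting_def using T(2-5) by blast
qed

text \<open>
  If \<open>Ext\<^sup>1(T1, A) = 0\<close>, then an epimorphism \<open>P \<rightarrow> A\<close> extends along \<open>P \<rightarrow> T0\<close>; hence \<open>\<D> = \<C>\<^sup>\<bottom>\<close>. Pushing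
  \<open>0 \<rightarrow> P \<rightarrow> T0 \<rightarrow> T1 \<rightarrow> 0\<close> out along \<open>P \<rightarrow> A\<close> gives \<open>0 \<rightarrow> A \<rightarrow> E \<rightarrow> T1 \<rightarrow> 0\<close> with \<open>E\<close> a quotient of \<open>T0\<close>. For the
  other sequence, push \<open>0 \<rightarrow> K \<rightarrow> P \<rightarrow> A \<rightarrow> 0\<close> out along such an embedding \<open>K \<rightarrow> D'\<close>; the middle term is an
  extension of an object of \<open>\<C>\<close> by \<open>P\<close>.
\<close>

lemma tilting_imp_cotorsion_torsion:
  assumes t: "tilting \<A> \<T>"
  shows "cotorsion_torsion_triple \<A> (left_perp \<A> 1 (Fac \<A> \<T>)) (Fac \<A> \<T>) (right_perp \<A> 0 \<T>)"
proof -
  let ?D = "Fac \<A> \<T>" and ?C = "left_perp \<A> 1 (Fac \<A> \<T>)"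
  note T = tiltingD[OF t] and st = stt_props[OF tilting_imp_stt[OF t]]
  have TC: "\<T> \<subseteq> ?C" using stt_left_perp_inter_Fac[OF tilting_imp_stt[OF t]] by blast
  note sub = left_perp_subcategory[OF Fac_sub_Ob]
  have perp: "?D = right_perp \<A> 1 ?C"
  proof (intro equalityI subsetI)
    fix A assume "A \<in> ?D"
    then show "A \<in> right_perp \<A> 1 ?C" using Fac_sub_Ob by (auto simp: right_perp_def left_perp_def)
  next
    fix A assume "A \<in> right_perp \<A> 1 ?C"
    then have A: "A \<in> Ob \<A>" and E: "\<And>X. X \<in> ?C \<Longrightarrow> Ext_zero \<A> 1 X A" by (auto simp: right_perp_def)
    obtain P e where P: "projective \<A> P" "\<langle>e : P \<rightarrow> A\<rangle>" "is_epi \<A> e" by (rule projective_presentation[OF A])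
    obtain T0 T1 f g where T0: "T0 \<in> \<T>" "T1 \<in> \<T>" and s: "short_exact_seq \<A> P f T0 g T1"
      by (rule tilting_sequence[OF t P(1)])
    have "T1 \<in> ?C" using TC T0(2) by blast
    then obtain h where h: "\<langle>h : T0 \<rightarrow> A\<rangle>" "h \<cdot> f = e" by (rule ext1_extend[OF E s P(2)])
    show "A \<in> ?D" using FacI[OF T0(1) h(1)] epi_of_comp[OF _ sesD(1)[OF s] h(1)] h(2) P(3) by simp
  qed
  have env: "\<exists>D'\<in>?D. \<exists>C'\<in>\<T>. \<exists>f g. short_exact_seq \<A> A f D' g C'" if A: "A \<in> Ob \<A>" for A
  proof -
    obtain P e where P: "projective \<A> P" "\<langle>e : P \<rightarrow> A\<rangle>" "is_epi \<A> e" by (rule projective_presentation[OF A])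
    obtain T0 T1 f g where T0: "T0 \<in> \<T>" "T1 \<in> \<T>" and s: "short_exact_seq \<A> P f T0 g T1"
      by (rule tilting_sequence[OF t P(1)])
    obtain E i e' c' where E: "short_exact_seq \<A> A i E c' T1" "\<langle>e' : T0 \<rightarrow> E\<rangle>" "e' \<cdot> f = i \<cdot> e" "c' \<cdot> e' = g"
      by (rule pushout_ses[OF s P(2)])
    have "E \<in> ?D" using FacI[OF T0(1) E(2) pushout_of_epi[OF s E(1) P(2,3) E(2-4)]] .
    then show ?thesis using T0(2) E(1) by blast
  qed
  have cov: "\<exists>D\<in>?D. \<exists>C\<in>?C. \<exists>f g. short_exact_seq \<A> D f C g A" if A: "A \<in> Ob \<A>" for A
  proof -
    obtain P e where P: "projective \<A> P" "\<langle>e : P \<rightarrow> A\<rangle>" "is_epi \<A> e" by (rule projective_presentation[OF A])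
    obtain K k where s: "short_exact_seq \<A> K k P e A" by (rule ses_of_epi[OF P(2,3)])
    have "K \<in> Ob \<A>" using hom_Ob[OF sesD(1)[OF s]] by simp
    then obtain D' C' f g where D': "D' \<in> ?D" "C' \<in> \<T>" and u: "short_exact_seq \<A> K f D' g C'"
      using env by blast
    obtain E i e' c' where E: "short_exact_seq \<A> D' i E c' A" "\<langle>e' : P \<rightarrow> E\<rangle>" "e' \<cdot> k = i \<cdot> f" "c' \<cdot> e' = e"
      by (rule pushout_ses[OF s sesD(1)[OF u]])
    obtain C'' g' where v: "short_exact_seq \<A> P e' E g' C''" "isomorphic \<A> C' C''"
      by (rule pushout_of_mono[OF s E(1) u E(2-4)])
    have "C' \<in> ?C" using TC D'(2) by blast
    then have "C'' \<in> ?C" using subcategory_iso[OF sub _ v(2)] by simp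
    then have "E \<in> ?C"
      using left_perp_extension[OF Fac_sub_Ob v(1) projective_in_left_perp[OF Fac_sub_Ob P(1)]] by simp
    then show ?thesis using D'(1) E(1) by blast
  qed
  have "cotorsion_pair \<A> ?C ?D"
    unfolding cotorsion_pair_def
  proof (intro conjI ballI sub Fac_subcategory refl perp)
    fix A assume A: "A \<in> Ob \<A>"
    show "\<exists>D\<in>?D. \<exists>C\<in>?C. \<exists>f g. short_exact_seq \<A> D f C g A" by (rule cov[OF A])
    show "\<exists>D'\<in>?D. \<exists>C'\<in>?C. \<exists>f g. short_exact_seq \<A> A f D' g C'" using env[OF A] TC by blast
  qed
  then show ?thesis
    unfolding cotorsion_torsion_triple_def using torsion_pair_Fac[OF T(1,5) st(6)] by blast
qed

end

section \<open>The bijections\<close>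

theorem theorem1p3:
  fixes \<A> :: "('o, 'm) cat"
  assumes "abelian_category \<A>"
    and "enough_projectives \<A>"
  shows "Phi \<A> \<in> support_tau_tilting_subcategories \<A> \<rightarrow> tau_cotorsion_torsion_triples \<A> \<and>
    Psi \<in> tau_cotorsion_torsion_triples \<A> \<rightarrow> support_tau_tilting_subcategories \<A> \<and>
    bij_betw (Phi \<A>) (support_tau_tilting_subcategories \<A>) (tau_cotorsion_torsion_triples \<A>) \<and>
    bij_betw Psi (tau_cotorsion_torsion_triples \<A>) (support_tau_tilting_subcategories \<A>) \<and>
    (\<forall>\<T>\<in>support_tau_tilting_subcategories \<A>. Psi (Phi \<A> \<T>) = \<T>) \<and>
    (\<forall>t\<in>tau_cotorsion_torsion_triples \<A>. Phi \<A> (Psi t) = t) \<and>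
    tilting_subcategories \<A> \<subseteq> support_tau_tilting_subcategories \<A> \<and>
    cotorsion_torsion_triples \<A> \<subseteq> tau_cotorsion_torsion_triples \<A> \<and>
    bij_betw (Phi \<A>) (tilting_subcategories \<A>) (cotorsion_torsion_triples \<A>) \<and>
    bij_betw Psi (cotorsion_torsion_triples \<A>) (tilting_subcategories \<A>)"
proof -
  interpret abelian_category_enough_projectives \<A>
    using assms by (simp add: abelian_category_enough_projectives_def abelian_category_enough_projectives_axioms_def)
  let ?S = "support_tau_tilting_subcategories \<A>" and ?C = "tau_cotorsion_torsion_triples \<A>"
  let ?T = "tilting_subcategories \<A>" and ?CT = "cotorsion_torsion_triples \<A>"
  have Phi: "Phi \<A> \<T> \<in> ?C" "Psi (Phi \<A> \<T>) = \<T>" if "\<T> \<in> ?S" for \<T>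
    using that stt_imp_tau_cotorsion_torsion stt_left_perp_inter_Fac
    by (simp_all add: support_tau_tilting_subcategories_def tau_cotorsion_torsion_triples_def Phi_def Psi_def)
  have Psi: "Psi t \<in> ?S" "Phi \<A> (Psi t) = t" if t: "t \<in> ?C" for t
  proof -
    obtain \<C> \<D> \<F> where eq: "t = (\<C>, \<D>, \<F>)" and c: "tau_cotorsion_torsion_triple \<A> \<C> \<D> \<F>"
      using t unfolding tau_cotorsion_torsion_triples_def by blast
    have P: "Psi t = \<C> \<inter> \<D>" unfolding eq Psi_def by simp
    show "Psi t \<in> ?S" unfolding P support_tau_tilting_subcategories_def
      using tau_cotorsion_torsion_imp_stt[OF c] by simp
    show "Phi \<A> (Psi t) = t" using tau_cotorsion_torsion_Phi_Psi[OF c] by (simp add: eq Psi_def)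
  qed
  have TS: "?T \<subseteq> ?S"
    using tilting_imp_stt by (auto simp: support_tau_tilting_subcategories_def tilting_subcategories_def)
  have CTC: "?CT \<subseteq> ?C"
    using cotorsion_torsion_imp_tau by (auto simp: tau_cotorsion_torsion_triples_def cotorsion_torsion_triples_def)
  have PhiT: "Phi \<A> \<T> \<in> ?CT" if "\<T> \<in> ?T" for \<T>
    using that tilting_imp_cotorsion_torsion
    by (simp add: tilting_subcategories_def cotorsion_torsion_triples_def Phi_def)
  have PsiT: "Psi t \<in> ?T" if "t \<in> ?CT" for t
    using that cotorsion_torsion_imp_tilting
    unfolding tilting_subcategories_def cotorsion_torsion_triples_def Psi_def by auto
  have maps: "Phi \<A> \<in> ?S \<rightarrow> ?C" "Psi \<in> ?C \<rightarrow> ?S" "Phi \<A> \<in> ?T \<rightarrow> ?CT" "Psi \<in> ?CT \<rightarrow> ?T"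
    using Phi(1) Psi(1) PhiT PsiT by (auto intro!: Pi_I)
  have inv: "Psi (Phi \<A> \<T>) = \<T>" if "\<T> \<in> ?T" for \<T> using Phi(2) TS that by blast
  have inv': "Phi \<A> (Psi t) = t" if "t \<in> ?CT" for t using Psi(2) CTC that by blast
  have "bij_betw (Phi \<A>) ?S ?C" "bij_betw Psi ?C ?S"
    by (rule bij_betwI[OF maps(1,2) Phi(2) Psi(2)] bij_betwI[OF maps(2,1) Psi(2) Phi(2)], assumption+)+
  moreover have "bij_betw (Phi \<A>) ?T ?CT" "bij_betw Psi ?CT ?T"
    by (rule bij_betwI[OF maps(3,4) inv inv'] bij_betwI[OF maps(4,3) inv' inv], assumption+)+
  ultimately show ?thesis using maps(1,2) Phi(2) Psi(2) TS CTC by (intro conjI ballI)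
qed

end
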